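(* Fix $\varepsilon > 0$, let $\alpha_1, \alpha_2, \ldots$ be a sequence of elements of $\mathcal K$, and let $\gamma_1, \gamma_2, \ldots$ be a sequence of real numbers. Then there exists a set $\mathcal G \subseteq \mathbf{Bad}$ of Hausdorff dimension $\dim_{\mathrm H}(\mathcal G) = 1$ such that for every $\beta \in \mathcal G$, every $i \in \mathbb N$ and every $\delta \in \mathbb R$, the inequality \[ n \| n\alpha_i - \gamma_i \| \cdot \| n\beta - \delta \| < \frac{(\log\log\log n)^{\varepsilon + 1/2}}{(\log n)^{1/2}} \] has infinitely many solutions $n \in \mathbb N$.
   Context: For $x \in \mathbb R$, $\|x\| = \min\{|x-k| : k \in \mathbb Z\}$ denotes the distance to the nearest integer. The set of badly approximable numbers is $\mathbf{Bad} = \{\alpha \in \mathbb R : \liminf_{n\to\infty} n\|n\alpha\| > 0\}$. For irrational $\alpha = [a_0; a_1, a_2, \ldots]$ (continued fraction expansion), the continued fraction convergent denominators are defined by $q_{-1} = 0$, $q_0 = 1$, $q_k = a_k q_{k-1} + q_{k-2}$ for $k \in \mathbb N$. The set $\mathcal K$ is defined as $\mathcal K = \{\alpha \in \mathbb R \setminus \mathbb Q : \sup\{ t^{-1}\log q_t(\alpha) : t \in \mathbb N\} < \infty\}$, where $q_t(\alpha)$ are the continued fraction denominators of $\alpha$. *)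

theory Defs
  imports "HOL-Analysis.Analysis"
begin

definition nearest_int_dist :: "real \<Rightarrow> real" where
  "nearest_int_dist x = (INF k\<in>\<int>. \<bar>x - k\<bar>)"

(* The infimum is a minimum, attained at the integer nearest to x. *)
lemma nearest_int_dist_eq_round: "nearest_int_dist x = \<bar>x - of_int (round x)\<bar>"
  unfolding nearest_int_dist_def
  by (rule cInf_eq_minimum) (auto elim!: Ints_cases simp: round_diff_minimal)

definition Bad :: "real set" where
  "Bad = {\<alpha>. liminf (\<lambda>n. ereal (real n * nearest_int_dist (real n * \<alpha>))) > 0}"

(* Complete quotients: cf_rem \<alpha> k = [a_k; a_(k+1), ...].  For irrational \<alpha> no fractional
   part vanishes; for rational \<alpha> the values after termination are junk. *)
primrec cf_rem :: "real \<Rightarrow> nat \<Rightarrow> real" where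
  "cf_rem \<alpha> 0 = \<alpha>"
| "cf_rem \<alpha> (Suc k) = 1 / frac (cf_rem \<alpha> k)"

definition cf_coeff :: "real \<Rightarrow> nat \<Rightarrow> int" where
  "cf_coeff \<alpha> k = \<lfloor>cf_rem \<alpha> k\<rfloor>"

(* q_1 = a_1 is the recurrence q_1 = a_1 q_0 + q_(-1) with q_0 = 1, q_(-1) = 0. *)
fun cf_denom :: "real \<Rightarrow> nat \<Rightarrow> int" where
  "cf_denom \<alpha> 0 = 1"
| "cf_denom \<alpha> (Suc 0) = cf_coeff \<alpha> 1"
| "cf_denom \<alpha> (Suc (Suc k)) =
     cf_coeff \<alpha> (Suc (Suc k)) * cf_denom \<alpha> (Suc k) + cf_denom \<alpha> k"

definition K_set :: "real set" where
  "K_set = {\<alpha>. \<alpha> \<notin> \<rat> \<and>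
     (SUP t\<in>{1::nat..}. ereal (ln (real_of_int (cf_denom \<alpha> t)) / real t)) < \<infinity>}"

(* diam(U)^s with 0^0 = 1 for nonempty U (whereas 0 powr 0 = 0 in HOL); the empty set
   contributes 0 for every s.  So the case s = 0 yields counting measure. *)
definition diam_pow :: "real \<Rightarrow> 'a::metric_space set \<Rightarrow> ennreal" where
  "diam_pow s U = (if s = 0 \<and> U \<noteq> {} then 1 else ennreal (diameter U powr s))"

(* Boundedness is required because diameter is unspecified on unbounded sets. *)
definition hausdorff_pre_measure :: "real \<Rightarrow> real \<Rightarrow> 'a::metric_space set \<Rightarrow> ennreal" where
  "hausdorff_pre_measure s \<rho> A =
     (INF U \<in> {U :: nat \<Rightarrow> 'a set. A \<subseteq> (\<Union>i. U i) \<and> (\<forall>i. bounded (U i) \<and> diameter (U i) \<le> \<rho>)}.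
        \<Sum>i. diam_pow s (U i))"

definition hausdorff_measure :: "real \<Rightarrow> 'a::metric_space set \<Rightarrow> ennreal" where
  "hausdorff_measure s A = (SUP \<rho>\<in>{0<..}. hausdorff_pre_measure s \<rho> A)"

definition hausdorff_dim :: "'a::metric_space set \<Rightarrow> ennreal" where
  "hausdorff_dim A = (INF s\<in>{s. 0 \<le> s \<and> hausdorff_measure s A = 0}. ennreal s)"

end

(*
A classical construction gives, for \<alpha> in K_set, integers n_k in [q_k, 2 q_k) with
n_k ||n_k \<alpha> - \<gamma>|| <= 5, where q_k are the convergent denominators and ln q_k = O(k).  It
therefore suffices that the points n_k \<beta> with k of order 3^m come within 3 / 2^m of every \<delta>,
for infinitely many m: there are far more than 2^m such k, and 2^(-m) is much smaller than
(ln n_k)^(-1/2).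

The number \<beta> has bounded partial quotients, mostly free, except that short blocks are forced at
sparse places, one for each target on the grid of mesh 2^(-m).  A block is 1..1 w 2..2 z with w over
{1, 2} and z over {1..M}.  On a cylinder, n \<beta> is up to a tiny error a linear phase a_w + b_w y,
where y depends on z only.  The slopes b_w are well separated because the denominators are
governed by a linear form in 1, (sqrt 5 - 1) / 2, sqrt 2 - 1 and their product, whose norm is a nonzero integer.
The admissible y are so dense in a fine grid that a mean square estimate of exponential sums over
w shows that some a_w + b_w y hits the target.  For M large the resulting Cantor
set has dimension close to 1, and the union over all M has dimension 1.
*)
theory Submission
  imports Defs "HOL-Real_Asymp.Real_Asymp"
begin

text \<open>The obstacle is that n comes from \<alpha> and is unrelated to the denominators of
  \<beta>, while the prefix of \<beta> before a block is arbitrary. The constants a_w are therefore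
  uncontrolled reals, and a hit has to come from an average that is valid for all a_w. That average
  needs slopes that differ by at least the number of words. Tails from two different quadratic
  fields supply this: with the same tail on both sides of w, the form in the four matrix entries of
  w would have nontrivial integer zeros.

  The base 3 is taken strictly between 2 and 4. With ln n of order 3^m there is room for 2^m targets
  at O(m) digits each, a vanishing share of the digits because m 2^m = o(3^m); and 1 / 2^m still
  beats (ln n)^(-1/2) because 3^m = o(4^m).

  A hit is always established for every tail t in [0, 1], so it survives all later choices of
  digits. A block starts when the denominator of \<beta> reaches a threshold, not at a fixed
  position, because it is the denominator that has to match n.\<close>

section \<open>Continued fraction words\<close>

text \<open>\<open>cfval [a\<^sub>1, \<dots>, a\<^sub>k] t = [0; a\<^sub>1, \<dots>, a\<^sub>k + t]\<close>, and \<open>cnum\<close>, \<open>cden\<close>, \<open>cnum_prev\<close>, \<open>cden_prev\<close> are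
  \<open>p\<^sub>k\<close>, \<open>q\<^sub>k\<close>, \<open>p\<^sub>k\<^sub>-\<^sub>1\<close>, \<open>q\<^sub>k\<^sub>-\<^sub>1\<close>.\<close>

primrec cfval :: "nat list \<Rightarrow> real \<Rightarrow> real" where
  "cfval [] t = t"
| "cfval (a # w) t = 1 / (real a + cfval w t)"

fun cnum :: "nat list \<Rightarrow> int" and cden :: "nat list \<Rightarrow> int" where
  "cnum [] = 0"
| "cnum (a # w) = cden w"
| "cden [] = 1"
| "cden (a # w) = int a * cden w + cnum w"

fun cnum_prev :: "nat list \<Rightarrow> int" and cden_prev :: "nat list \<Rightarrow> int" where
  "cnum_prev [] = 1"
| "cnum_prev (a # w) = cden_prev w"
| "cden_prev [] = 0"
| "cden_prev (a # w) = int a * cden_prev w + cnum_prev w"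

abbreviation rden :: "nat list \<Rightarrow> real" where
  "rden w \<equiv> real_of_int (cden w)"

lemma cfval_append: "cfval (u @ v) t = cfval u (cfval v t)"
  by (induction u) auto

lemma cnum_cden_append:
  "cnum (u @ v) = cnum u * cden v + cnum_prev u * cnum v \<and>
   cden (u @ v) = cden u * cden v + cden_prev u * cnum v \<and>
   cnum_prev (u @ v) = cnum u * cden_prev v + cnum_prev u * cnum_prev v \<and>
   cden_prev (u @ v) = cden u * cden_prev v + cden_prev u * cnum_prev v"
  by (induction u) (auto simp: algebra_simps)

lemmas cnum_append = cnum_cden_append[THEN conjunct1]
  and cden_append = cnum_cden_append[THEN conjunct2, THEN conjunct1]
  and cnum_prev_append = cnum_cden_append[THEN conjunct2, THEN conjunct2, THEN conjunct1]
  and cden_prev_append = cnum_cden_append[THEN conjunct2, THEN conjunct2, THEN conjunct2]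

lemma cden_snoc: "cden (w @ [a]) = int a * cden w + cden_prev w"
  and cden_prev_snoc: "cden_prev (w @ [a]) = cden w"
  by (simp_all add: cden_append cden_prev_append)

lemma cf_det: "cnum_prev w * cden w - cnum w * cden_prev w = (-1) ^ length w"
  by (induction w) (auto simp: algebra_simps)

lemma cf_bounds:
  assumes "0 \<notin> set w"
  shows "cden w \<ge> 1" "0 \<le> cnum w" "cnum w \<le> cden w" "0 \<le> cden_prev w" "cden_prev w \<le> cden w"
    "0 \<le> cnum_prev w" "cnum_prev w \<le> cden w"
proof -
  \<comment> \<open>The last conjunct serves the induction: for a = 1 the bound
    \<open>cden_prev (a # w) <= cden (a # w)\<close> is exactly this conjunct for
    \<open>w\<close>.\<close>
  have "cden w \<ge> 1 \<and> 0 \<le> cnum w \<and> cnum w \<le> cden w \<and> 0 \<le> cden_prev w \<and>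
    cden_prev w \<le> cden w \<and> 0 \<le> cnum_prev w \<and> cnum_prev w \<le> cden w \<and>
    cnum_prev w + cden_prev w \<le> cnum w + cden w"
    using assms
  proof (induction w)
    case (Cons a w)
    then have IH: "cden w \<ge> 1" "0 \<le> cnum w" "cnum w \<le> cden w" "0 \<le> cden_prev w"
      "cden_prev w \<le> cden w" "0 \<le> cnum_prev w" "cnum_prev w \<le> cden w"
      "cnum_prev w + cden_prev w \<le> cnum w + cden w" by auto
    define b where "b = int a - 1"
    have b: "int a = 1 + b" "b \<ge> 0" using Cons.prems by (auto simp: b_def)
    have "0 \<le> cden w" using IH by simp
    then have 1: "b * cden_prev w \<le> b * cden w" "0 \<le> b * cden_prev w" "0 \<le> b * cden w"
      using b IH by (simp_all add: mult_left_mono del: mult_le_cancel_left)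
    have "cnum (a # w) = cden w" "cden (a # w) = cden w + b * cden w + cnum w"
      "cnum_prev (a # w) = cden_prev w" "cden_prev (a # w) = cden_prev w + b * cden_prev w + cnum_prev w"
      by (simp_all add: b algebra_simps)
    then show ?case using IH 1 by linarith
  qed simp
  then show "cden w \<ge> 1" "0 \<le> cnum w" "cnum w \<le> cden w" "0 \<le> cden_prev w" "cden_prev w \<le> cden w"
    "0 \<le> cnum_prev w" "cnum_prev w \<le> cden w" by auto
qed

lemma cden_add_pos:
  fixes t :: real
  assumes "0 \<notin> set w" "t \<ge> 0"
  shows "rden w + t * real_of_int (cden_prev w) \<ge> 1"
  using cf_bounds[OF assms(1)] assms(2) by (simp add: add_increasing2)

lemma cfval_eq:
  assumes "0 \<notin> set w" "t \<ge> 0"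
  shows "cfval w t = (real_of_int (cnum w) + t * real_of_int (cnum_prev w)) /
    (rden w + t * real_of_int (cden_prev w))"
  using assms
proof (induction w)
  case (Cons a w)
  have 1: "rden w + t * cden_prev w \<ge> 1"
    using cden_add_pos[of w t] Cons.prems by auto
  have "cfval (a # w) t = 1 / (real a + (cnum w + t * cnum_prev w) / (cden w + t * cden_prev w))"
    using Cons by simp
  also have "\<dots> = (cden w + t * cden_prev w) /
      (real a * (cden w + t * cden_prev w) + (cnum w + t * cnum_prev w))"
    using 1 by (simp add: divide_simps)
  finally show ?case by (simp add: algebra_simps)
qed simp

lemma cfval_bounds:
  assumes "0 \<notin> set w" "0 \<le> t" "t \<le> 1"
  shows "0 \<le> cfval w t" "cfval w t \<le> 1"
proof -
  have "0 \<le> cfval w t \<and> cfval w t \<le> 1" using assms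
  proof (induction w)
    case (Cons a w)
    then have "real a \<ge> 1" "0 \<le> cfval w t" by auto
    then show ?case by (simp add: divide_simps)
  qed simp
  then show "0 \<le> cfval w t" "cfval w t \<le> 1" by auto
qed

lemma cfval_open:
  assumes "0 \<notin> set w" "0 < t" "t < 1"
  shows "0 < cfval w t \<and> cfval w t < 1"
  using assms
proof (induction w)
  case (Cons a w)
  then have "real a \<ge> 1" "0 < cfval w t" by auto
  then show ?case by (simp add: divide_simps)
qed simp

lemma cfval_diff:
  fixes s t :: real
  assumes "0 \<notin> set w" "s \<ge> 0" "t \<ge> 0"
  shows "cfval w t - cfval w s =
    (-1) ^ length w * (t - s) / ((cden w + t * cden_prev w) * (cden w + s * cden_prev w))"
proof -
  let ?D = "\<lambda>t::real. rden w + t * cden_prev w"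
  have 1: "?D t \<noteq> 0" "?D s \<noteq> 0"
    using cden_add_pos[OF assms(1,3)] cden_add_pos[OF assms(1,2)] by linarith+
  have d: "(-1) ^ length w = real_of_int (cnum_prev w) * cden w - cnum w * cden_prev w"
    using cf_det[of w] by (metis of_int_1 of_int_diff of_int_minus of_int_mult of_int_power)
  have "cfval w t - cfval w s =
      ((cnum w + t * cnum_prev w) * ?D s - (cnum w + s * cnum_prev w) * ?D t) / (?D t * ?D s)"
    using 1 by (simp add: cfval_eq assms diff_frac_eq)
  also have "(cnum w + t * cnum_prev w) * ?D s - (cnum w + s * cnum_prev w) * ?D t
     = (-1) ^ length w * (t - s)" by (simp add: d algebra_simps)
  finally show ?thesis .
qed

lemma abs_cfval_diff:
  fixes s t :: real
  assumes "0 \<notin> set w" "s \<ge> 0" "t \<ge> 0"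
  shows "\<bar>cfval w t - cfval w s\<bar> =
    \<bar>t - s\<bar> / ((cden w + t * cden_prev w) * (cden w + s * cden_prev w))"
  using cden_add_pos[OF assms(1), of t] cden_add_pos[OF assms(1), of s] assms
  by (simp add: cfval_diff abs_mult)

lemma abs_cfval_diff_le:
  fixes s t :: real
  assumes "0 \<notin> set w" "s \<ge> 0" "t \<ge> 0"
  shows "\<bar>cfval w t - cfval w s\<bar> \<le> \<bar>t - s\<bar> / (rden w)\<^sup>2"
proof -
  have q: "rden w \<ge> 1" "0 \<le> real_of_int (cden_prev w)"
    using cf_bounds[OF assms(1)] by auto
  have "(rden w)\<^sup>2 \<le> (cden w + t * cden_prev w) * (cden w + s * cden_prev w)"
    unfolding power2_eq_square by (intro mult_mono) (use q assms in auto)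
  then show ?thesis unfolding abs_cfval_diff[OF assms]
    using q by (intro divide_left_mono mult_pos_pos zero_less_power)
      (use q assms in \<open>auto intro!: add_pos_nonneg\<close>)
qed

lemma cden_append_ge:
  assumes "0 \<notin> set u" "0 \<notin> set v"
  shows "cden u * cden v \<le> cden (u @ v)"
  using cf_bounds[OF assms(1)] cf_bounds[OF assms(2)] by (simp add: cden_append)

lemma cden_append_le:
  assumes "0 \<notin> set u" "0 \<notin> set v"
  shows "cden (u @ v) \<le> 2 * cden u * cden v"
proof -
  have "cden_prev u * cnum v \<le> cden u * cden v"
    using cf_bounds[OF assms(1)] cf_bounds[OF assms(2)] by (intro mult_mono) auto
  then show ?thesis by (simp add: cden_append)
qed

lemma cden_mono_append:
  assumes "0 \<notin> set u" "0 \<notin> set v"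
  shows "cden u \<le> cden (u @ v)"
proof -
  have "cden u * 1 \<le> cden u * cden v"
    using cf_bounds(1)[OF assms(1)] cf_bounds(1)[OF assms(2)] by (intro mult_left_mono) auto
  then show ?thesis using cden_append_ge[OF assms] by simp
qed

lemma cden_ge_pow2: "0 \<notin> set w \<Longrightarrow> 2 ^ (length w div 2) \<le> cden w"
proof (induction w rule: length_induct)
  case (1 w)
  show ?case
  proof (cases "length w < 2")
    case True
    then show ?thesis using cf_bounds(1)[OF "1.prems"] by simp
  next
    case False
    then obtain a b v where w: "w = a # b # v"
      by (metis One_nat_def Suc_1 length_Cons less_2_cases_iff list.exhaust list.size(3) zero_less_Suc)
    have v: "0 \<notin> set v" "a \<ge> 1" "b \<ge> 1" using 1 w by auto
    have bv: "0 \<notin> set (b # v)" using v by auto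
    have "2 ^ (length v div 2) \<le> cden v" using 1 v w by simp
    moreover have "cden w \<ge> cden (b # v) + cden v"
    proof -
      have "1 * cden (b # v) \<le> int a * cden (b # v)"
        using v cf_bounds(1)[OF bv] by (intro mult_right_mono) auto
      then show ?thesis using w by simp
    qed
    moreover have "cden (b # v) \<ge> cden v"
    proof -
      have "1 * cden v \<le> int b * cden v"
        using v cf_bounds(1)[OF v(1)] by (intro mult_right_mono) auto
      then show ?thesis using cf_bounds(2)[OF v(1)] by simp
    qed
    ultimately show ?thesis using w by simp
  qed
qed

lemma cden_sq_ge_pow2:
  assumes "0 \<notin> set w"
  shows "2 ^ (length w - 1) \<le> (rden w)\<^sup>2"
proof -
  have "(2::real) ^ (length w - 1) \<le> 2 ^ (2 * (length w div 2))" by (intro power_increasing) auto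
  also have "\<dots> = (2 ^ (length w div 2))\<^sup>2" by (simp add: power_mult power2_eq_square power_mult_distrib[symmetric])
  also have "\<dots> \<le> (rden w)\<^sup>2"
  proof (intro power_mono)
    show "(2::real) ^ (length w div 2) \<le> cden w"
      using cden_ge_pow2[OF assms] by (metis of_int_le_iff of_int_numeral of_int_power)
  qed auto
  finally show ?thesis .
qed

lemma cden_snoc_le:
  assumes "0 \<notin> set w" "a \<le> M"
  shows "cden (w @ [a]) \<le> (int M + 1) * cden w"
proof -
  have "int a * cden w \<le> int M * cden w" using assms cf_bounds(1)[OF assms(1)] by (intro mult_right_mono) auto
  then show ?thesis using cf_bounds(5)[OF assms(1)] by (simp add: cden_snoc distrib_right)
qed

lemma cden_append_le_pow:
  assumes "0 \<notin> set u" "set v \<subseteq> {1..M}"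
  shows "cden (u @ v) \<le> (int M + 1) ^ length v * cden u"
  using assms(2)
proof (induction v rule: rev_induct)
  case (snoc a v)
  have "cden ((u @ v) @ [a]) \<le> (int M + 1) * cden (u @ v)"
    using snoc.prems assms by (intro cden_snoc_le) auto
  also have "\<dots> \<le> (int M + 1) * ((int M + 1) ^ length v * cden u)"
    using snoc by (intro mult_left_mono) auto
  finally show ?case by (simp add: algebra_simps)
qed simp

lemma cden_le_pow: "set v \<subseteq> {1..M} \<Longrightarrow> cden v \<le> (int M + 1) ^ length v"
  using cden_append_le_pow[of "[]" v M] by simp

text \<open>Mirror formula: the recurrence for \<open>cden (w @ [a])\<close> turns the ratio into a
  continued fraction in the reversed digits. It thus depends mainly on the last digits, which is how
  a constant run brings it close to a fixed quadratic number.\<close>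

lemma cden_ratio_append:
  assumes "0 \<notin> set u" "0 \<notin> set v"
  shows "real_of_int (cden_prev (u @ v)) / cden (u @ v) =
    cfval (rev v) (real_of_int (cden_prev u) / cden u)"
  using assms(2)
proof (induction v rule: rev_induct)
  case (snoc a v)
  have "0 \<notin> set (u @ v)" using assms snoc by auto
  from cf_bounds[OF this] have 1: "cden (u @ v) \<ge> 1" by auto
  have "real_of_int (cden_prev ((u @ v) @ [a])) / cden ((u @ v) @ [a]) =
     1 / (real a + real_of_int (cden_prev (u @ v)) / cden (u @ v))"
    using 1 unfolding cden_snoc cden_prev_snoc by (simp add: divide_simps)
  then show ?case using snoc by simp
qed simp

text \<open>A tail strictly between 0 and 1 makes each digit the integer part of a reciprocal. The
  endpoints are excluded because neighbouring cylinders share them.\<close>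

lemma cfval_inj:
  assumes "0 \<notin> set u" "0 \<notin> set v" "length u = length v" "0 < s" "s < 1" "0 < t" "t < 1"
    "cfval u s = cfval v t"
  shows "u = v"
  using assms
proof (induction u arbitrary: v)
  case (Cons a u)
  then obtain b v' where v: "v = b # v'" by (cases v) auto
  have p: "0 < cfval u s \<and> cfval u s < 1" "0 < cfval v' t \<and> cfval v' t < 1"
    using Cons.prems v by (intro cfval_open; simp)+
  have e: "real a + cfval u s = real b + cfval v' t"
    using Cons.prems(8) p unfolding v by (auto simp: field_simps)
  then have "a = b" using p by linarith
  moreover have "u = v'" using Cons.prems e \<open>a = b\<close> v by (intro Cons.IH) auto
  ultimately show ?case using v by simp
qed simp

text \<open>The vectors (cden, cnum) and (cden_prev, cnum_prev) form a basis of the integer lattice,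
  since their determinant is a sign. In the coordinates x, y of (n, p) the error is |x t - y| / D
  with D <= 2 cden w, and 0 < n < cden w forces x and y to have opposite signs unless x = 0, so
  nothing cancels.\<close>

lemma cfval_approx_lower:
  fixes t :: real
  assumes w: "0 \<notin> set w" and t: "0 \<le> t" "t \<le> 1" and n: "0 < n" "n < cden w"
  shows "\<bar>real_of_int n * cfval w t - real_of_int p\<bar> \<ge> 1 / (2 * cden w)"
proof -
  let ?P = "cnum w" and ?P' = "cnum_prev w" and ?Q = "cden w" and ?Q' = "cden_prev w"
  define e :: int where "e = (-1) ^ length w"
  have ee: "e * e = 1" by (simp add: e_def flip: power_mult_distrib)
  have det: "?P' * ?Q - ?P * ?Q' = e" unfolding e_def by (rule cf_det)
  define x where "x = e * (?P' * n - ?Q' * p)"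
  define y where "y = e * (?Q * p - ?P * n)"
  have nx: "n = x * ?Q + y * ?Q'"
  proof -
    have "x * ?Q + y * ?Q' = e * (n * (?P' * ?Q - ?P * ?Q'))" by (simp add: x_def y_def algebra_simps)
    then show ?thesis using det ee by (metis mult.commute mult.assoc mult_1)
  qed
  have px: "p = x * ?P + y * ?P'"
  proof -
    have "x * ?P + y * ?P' = e * (p * (?P' * ?Q - ?P * ?Q'))" by (simp add: x_def y_def algebra_simps)
    then show ?thesis using det ee by (metis mult.commute mult.assoc mult_1)
  qed
  have b: "?Q \<ge> 1" "0 \<le> ?Q'" "?Q' \<le> ?Q" using cf_bounds[OF w] by auto
  define D where "D = real_of_int ?Q + t * real_of_int ?Q'"
  have "t * real_of_int ?Q' \<le> 1 * real_of_int ?Q" using b t by (intro mult_mono) auto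
  then have D: "D \<ge> 1" "D \<le> 2 * ?Q" using b t by (auto simp: D_def add_increasing2)
  have detr: "real_of_int ?P' * ?Q - ?P * ?Q' = e"
    using det by (metis of_int_diff of_int_mult)
  have "real_of_int n * cfval w t - p = (n * (?P + t * ?P') - p * D) / D"
    using D unfolding cfval_eq[OF w t(1)] D_def[symmetric] by (simp add: field_simps)
  also have "n * (?P + t * ?P') - p * D =
      (x * t - y) * (real_of_int ?P' * ?Q - ?P * ?Q')"
    unfolding D_def by (subst nx, subst px) (simp add: algebra_simps)
  finally have eq: "\<bar>real_of_int n * cfval w t - p\<bar> = \<bar>x * t - y\<bar> / D"
    using D ee unfolding detr by (auto simp: abs_mult e_def)
  have "\<bar>x * t - y\<bar> \<ge> 1"
  proof -
    consider "x = 0" | "x > 0" | "x < 0" by linarith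
    then show ?thesis
    proof cases
      case 1
      then have "y \<noteq> 0" using nx n by auto
      then show ?thesis using 1 by simp
    next
      case 2
      have "y < 0"
      proof (rule ccontr)
        assume "\<not> y < 0"
        then have "x * ?Q \<ge> ?Q" "y * ?Q' \<ge> 0" using 2 b by auto
        then show False using nx n by linarith
      qed
      then have "real_of_int y \<le> -1" by simp
      moreover have "real_of_int x * t \<ge> 0" using 2 t by simp
      ultimately show ?thesis by linarith
    next
      case 3
      have "x * ?Q \<le> 0" using 3 b by (simp add: mult_nonpos_nonneg)
      then have "y * ?Q' > 0" using nx n by linarith
      then have "y > 0" using b by (simp add: zero_less_mult_iff)
      then have "real_of_int y \<ge> 1" by simp
      moreover have "real_of_int x * t \<le> 0" using 3 t by (simp add: mult_nonpos_nonneg)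
      ultimately show ?thesis by linarith
    qed
  qed
  then have "1 / (2 * ?Q) \<le> \<bar>x * t - y\<bar> / D" using D by (intro frac_le) auto
  then show ?thesis using eq by simp
qed

section \<open>A biquadratic norm form\<close>

lemma int_sq_eq_mult_sq:
  fixes x y k :: int
  assumes "x\<^sup>2 = k * y\<^sup>2" "\<forall>z. z\<^sup>2 \<noteq> k"
  shows "x = 0" "y = 0"
proof -
  show y: "y = 0"
  proof (rule ccontr)
    assume y: "y \<noteq> 0"
    have "y\<^sup>2 dvd x\<^sup>2" using assms(1) by simp
    then have "y dvd x" by simp
    then obtain z where "x = y * z" by (auto simp: dvd_def)
    then have "z\<^sup>2 = k" using assms(1) y by (simp add: power_mult_distrib)
    then show False using assms(2) by blast
  qed
  show "x = 0" using assms(1) y by simp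
qed

lemma int_nonsquares: "\<forall>z::int. z\<^sup>2 \<noteq> 2" "\<forall>z::int. z\<^sup>2 \<noteq> 5" "\<forall>z::int. z\<^sup>2 \<noteq> 10"
proof -
  have *: "z\<^sup>2 \<noteq> 2 \<and> z\<^sup>2 \<noteq> 5 \<and> z\<^sup>2 \<noteq> 10" for z :: int
  proof (cases "\<bar>z\<bar> \<le> 3")
    case True
    then have "\<bar>z\<bar> = 0 \<or> \<bar>z\<bar> = 1 \<or> \<bar>z\<bar> = 2 \<or> \<bar>z\<bar> = 3" by auto
    then have "\<bar>z\<bar>\<^sup>2 \<noteq> 2 \<and> \<bar>z\<bar>\<^sup>2 \<noteq> 5 \<and> \<bar>z\<bar>\<^sup>2 \<noteq> 10" by (elim disjE) simp_all
    then show ?thesis by simp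
  next
    case False
    then have "4\<^sup>2 \<le> \<bar>z\<bar>\<^sup>2" by (intro power_mono) auto
    then show ?thesis by simp
  qed
  then show "\<forall>z::int. z\<^sup>2 \<noteq> 2" "\<forall>z::int. z\<^sup>2 \<noteq> 5" "\<forall>z::int. z\<^sup>2 \<noteq> 10" by auto
qed

text \<open>The values of [0; 1, 1, ...] and [0; 2, 2, ...]. They generate different quadratic
  fields, so 1, the two numbers and their product are independent over the rationals.\<close>

definition golden_conj :: real where "golden_conj = (sqrt 5 - 1) / 2"
definition silver_conj :: real where "silver_conj = sqrt 2 - 1"

lemma golden_conj_props: "golden_conj\<^sup>2 = 1 - golden_conj" "0 < golden_conj" "golden_conj < 62/100"
proof -
  have "sqrt 5 < 224/100" by (rule real_less_lsqrt) (auto simp: power2_eq_square)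
  moreover have "1 < sqrt 5" by simp
  ultimately show "0 < golden_conj" "golden_conj < 62/100" by (auto simp: golden_conj_def)
  show "golden_conj\<^sup>2 = 1 - golden_conj" by (simp add: golden_conj_def power2_eq_square field_simps)
qed

lemma silver_conj_props: "silver_conj\<^sup>2 = 1 - 2 * silver_conj" "0 < silver_conj" "silver_conj < 42/100"
proof -
  have "sqrt 2 < 142/100" by (rule real_less_lsqrt) (auto simp: power2_eq_square)
  moreover have "1 < sqrt 2" by simp
  ultimately show "0 < silver_conj" "silver_conj < 42/100" by (auto simp: silver_conj_def)
  show "silver_conj\<^sup>2 = 1 - 2 * silver_conj" by (simp add: silver_conj_def power2_eq_square field_simps)
qed

text \<open>The norm of \<open>a + b \<tau> + c \<sigma> + d \<tau> \<sigma>\<close> from the biquadratic field to the rationals.\<close>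
definition biquad_norm :: "int \<Rightarrow> int \<Rightarrow> int \<Rightarrow> int \<Rightarrow> int" where
  "biquad_norm a b c d =
    (let e = a\<^sup>2 + c\<^sup>2 - a * b - c * d - b\<^sup>2 - d\<^sup>2;
         f = 2 * a * c - 2 * c\<^sup>2 - (a * d + b * c) + 2 * c * d - 2 * b * d + 2 * d\<^sup>2
     in e\<^sup>2 - 2 * e * f - f\<^sup>2)"

text \<open>Two relative norms in succession: t, t' are the roots of X^2 + X - 1 and s, s' those of
  X^2 + 2 X - 1. The product over t, t' is e + f s with the e, f of \<open>biquad_norm\<close>, and
  multiplying by e + f s' gives the integer.\<close>

lemma biquad_norm_eq:
  fixes t t' s s' :: real
  assumes t: "t + t' = -1" "t * t' = -1" and s: "s + s' = -2" "s * s' = -1"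
  shows "real_of_int (biquad_norm a b c d) =
    ((a + t * b + s * c + t * s * d) * (a + t' * b + s * c + t' * s * d)) *
    ((a + t * b + s' * c + t * s' * d) * (a + t' * b + s' * c + t' * s' * d))"
proof -
  have quad: "(A + t * B) * (A + t' * B) = A\<^sup>2 - A * B - B\<^sup>2" for A B :: real
  proof -
    have "(A + t * B) * (A + t' * B) = A\<^sup>2 + (t + t') * (A * B) + (t * t') * B\<^sup>2"
      by (simp add: algebra_simps power2_eq_square)
    then show ?thesis using t by simp
  qed
  define e f where "e = a\<^sup>2 + c\<^sup>2 - a * b - c * d - b\<^sup>2 - d\<^sup>2"
    and "f = 2 * a * c - 2 * c\<^sup>2 - (a * d + b * c) + 2 * c * d - 2 * b * d + 2 * d\<^sup>2"
  have step: "(a + t * b + z * c + t * z * d) * (a + t' * b + z * c + t' * z * d) = e + f * z"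
    if z: "z * z = 1 - 2 * z" for z :: real
  proof -
    have "(a + t * b + z * c + t * z * d) * (a + t' * b + z * c + t' * z * d)
       = ((a + c * z) + t * (b + d * z)) * ((a + c * z) + t' * (b + d * z))"
      by (simp add: algebra_simps)
    also have "\<dots> = (a + c * z)\<^sup>2 - (a + c * z) * (b + d * z) - (b + d * z)\<^sup>2" by (rule quad)
    also have "\<dots> = (a\<^sup>2 - a * b - b\<^sup>2) + (2 * a * c - (a * d + b * c) - 2 * b * d) * z
         + (c\<^sup>2 - c * d - d\<^sup>2) * (z * z)"
      by (simp add: algebra_simps power2_eq_square)
    also have "\<dots> = e + f * z"
      unfolding z e_def f_def by (simp add: algebra_simps power2_eq_square)
    finally show ?thesis .
  qed
  have s1: "s * s = 1 - 2 * s"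
  proof -
    have "s * (s + s') = s * (-2)" using s by simp
    then have "s * s + s * s' = - 2 * s" by (simp add: distrib_left)
    then show ?thesis using s by linarith
  qed
  have s2: "s' * s' = 1 - 2 * s'"
  proof -
    have "s' * (s + s') = s' * (-2)" using s by simp
    then have "s * s' + s' * s' = - 2 * s'" by (simp add: distrib_left mult.commute)
    then show ?thesis using s by linarith
  qed
  have "(e + f * s) * (e + f * s') = e\<^sup>2 + (s + s') * (real_of_int e * f) + (s * s') * f\<^sup>2"
    by (simp add: algebra_simps power2_eq_square)
  also have "\<dots> = real_of_int (e\<^sup>2 - 2 * e * f - f\<^sup>2)" using s by simp
  also have "e\<^sup>2 - 2 * e * f - f\<^sup>2 = biquad_norm a b c d"
    unfolding biquad_norm_def e_def f_def Let_def ..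
  finally show ?thesis unfolding step[OF s1] step[OF s2] by simp
qed

lemma biquad_norm_eq_0:
  assumes "biquad_norm a b c d = 0"
  shows "a = 0" "b = 0" "c = 0" "d = 0"
proof -
  define e f where "e = a\<^sup>2 + c\<^sup>2 - a * b - c * d - b\<^sup>2 - d\<^sup>2"
    and "f = 2 * a * c - 2 * c\<^sup>2 - (a * d + b * c) + 2 * c * d - 2 * b * d + 2 * d\<^sup>2"
  have "e\<^sup>2 - 2 * e * f - f\<^sup>2 = 0"
    using assms unfolding biquad_norm_def Let_def e_def f_def .
  then have "(e - f)\<^sup>2 = 2 * f\<^sup>2" by (simp add: power2_eq_square algebra_simps)
  from int_sq_eq_mult_sq[OF this int_nonsquares(1)] have f0: "f = 0" and e0: "e = 0" by auto
  \<comment> \<open>With A = a + c s, B = b + d s and s = sqrt 2 - 1, these are the coordinates in 2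
    A - B = u + v sqrt 2 and B = p + q sqrt 2. Four times the relative norm is (2 A - B)^2 - 5 B^2,
    so it vanishes when (u + v sqrt 2)^2 = 5 (p + q sqrt 2)^2; facts \<open>1\<close> and
    \<open>2\<close> compare the coefficients.\<close>
  define u v p q where "u = 2 * a - b - (2 * c - d)" and "v = 2 * c - d" and "p = b - d" and "q = d"
  have 1: "u\<^sup>2 + 2 * v\<^sup>2 = 5 * (p\<^sup>2 + 2 * q\<^sup>2)"
  proof -
    have "u\<^sup>2 + 2 * v\<^sup>2 - 5 * (p\<^sup>2 + 2 * q\<^sup>2) = 4 * (e - f)"
      unfolding u_def v_def p_def q_def e_def f_def by (simp add: power2_eq_square algebra_simps)
    then show ?thesis using e0 f0 by simp
  qed
  have 2: "u * v = 5 * (p * q)"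
  proof -
    have "2 * (u * v - 5 * (p * q)) = 4 * f"
      unfolding u_def v_def p_def q_def f_def by (simp add: power2_eq_square algebra_simps)
    then show ?thesis using f0 by simp
  qed
  \<comment> \<open>Norms to the rationals determine u^2 - 2 v^2 up to sign. The two signs make 5 or
    10 a rational square unless all four numbers vanish.\<close>
  have "(u\<^sup>2 - 2 * v\<^sup>2)\<^sup>2 = (u\<^sup>2 + 2 * v\<^sup>2)\<^sup>2 - 8 * (u * v)\<^sup>2"
    by (simp add: power2_eq_square algebra_simps)
  also have "\<dots> = (5 * (p\<^sup>2 - 2 * q\<^sup>2))\<^sup>2"
    unfolding 1 2 by (simp add: power2_eq_square algebra_simps)
  finally have "u\<^sup>2 - 2 * v\<^sup>2 = 5 * (p\<^sup>2 - 2 * q\<^sup>2) \<or> u\<^sup>2 - 2 * v\<^sup>2 = - (5 * (p\<^sup>2 - 2 * q\<^sup>2))"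
    by (simp add: power2_eq_iff)
  then have "p = 0 \<and> q = 0 \<and> u = 0 \<and> v = 0"
  proof
    assume "u\<^sup>2 - 2 * v\<^sup>2 = 5 * (p\<^sup>2 - 2 * q\<^sup>2)"
    with 1 have "u\<^sup>2 = 5 * p\<^sup>2" "v\<^sup>2 = 5 * q\<^sup>2" by auto
    then show ?thesis using int_sq_eq_mult_sq int_nonsquares by metis
  next
    assume "u\<^sup>2 - 2 * v\<^sup>2 = - (5 * (p\<^sup>2 - 2 * q\<^sup>2))"
    with 1 have "u\<^sup>2 = 10 * q\<^sup>2" "(2 * v)\<^sup>2 = 10 * p\<^sup>2" by auto
    then show ?thesis using int_sq_eq_mult_sq[of u 10 q] int_sq_eq_mult_sq[of "2 * v" 10 p] int_nonsquares
      by auto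
  qed
  then show "a = 0" "b = 0" "c = 0" "d = 0" unfolding u_def v_def p_def q_def by auto
qed

text \<open>Liouville's argument: the norm is a nonzero integer, so the form is at least the
  reciprocal of the product of its three conjugates. These are at most 4 H, 6 H and 9 H, and 216 = 4
  * 6 * 9.\<close>

lemma biquad_form_lower:
  fixes a b c d :: int and H :: real
  assumes H: "\<bar>real_of_int a\<bar> \<le> H" "\<bar>real_of_int b\<bar> \<le> H" "\<bar>real_of_int c\<bar> \<le> H" "\<bar>real_of_int d\<bar> \<le> H"
    and nz: "a \<noteq> 0 \<or> b \<noteq> 0 \<or> c \<noteq> 0 \<or> d \<noteq> 0"
  shows "1 / (216 * H ^ 3) \<le>
    \<bar>a + golden_conj * b + silver_conj * c + golden_conj * silver_conj * d\<bar>"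
proof -
  define t t' s s' where "t = golden_conj" and "t' = - 1 - golden_conj"
    and "s = silver_conj" and "s' = - 2 - silver_conj"
  have tt: "t + t' = -1" "t * t' = -1"
    using golden_conj_props(1) by (auto simp: t_def t'_def power2_eq_square algebra_simps)
  have ss: "s + s' = -2" "s * s' = -1"
    using silver_conj_props(1) by (auto simp: s_def s'_def power2_eq_square algebra_simps)
  define X where "X = (\<lambda>t s. real_of_int a + t * real_of_int b + s * real_of_int c + t * s * real_of_int d)"
  have Xle: "\<bar>X t s\<bar> \<le> (1 + T + S + T * S) * H" if "\<bar>t\<bar> \<le> T" "\<bar>s\<bar> \<le> S" for t s T S :: real
  proof -
    have "\<bar>t * b\<bar> \<le> T * H" "\<bar>s * c\<bar> \<le> S * H" "\<bar>t * s * d\<bar> \<le> T * S * H"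
      unfolding abs_mult using that H by (auto intro!: mult_mono)
    moreover have "\<bar>X t s\<bar> \<le> \<bar>real_of_int a\<bar> + \<bar>t * b\<bar> + \<bar>s * c\<bar> + \<bar>t * s * d\<bar>"
      unfolding X_def by linarith
    ultimately show ?thesis using H(1) by (simp add: algebra_simps)
  qed
  have H1: "H \<ge> 1"
  proof -
    have "1 \<le> \<bar>real_of_int a\<bar> \<or> 1 \<le> \<bar>real_of_int b\<bar> \<or> 1 \<le> \<bar>real_of_int c\<bar> \<or> 1 \<le> \<bar>real_of_int d\<bar>"
      using nz by linarith
    then show ?thesis using H by linarith
  qed
  have "\<bar>X t' s\<bar> \<le> (1 + 162/100 + 42/100 + 162/100 * (42/100)) * H"
    by (rule Xle) (use golden_conj_props silver_conj_props in \<open>auto simp: t'_def s_def\<close>)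
  then have x1: "\<bar>X t' s\<bar> \<le> 4 * H" using H1 by simp
  have "\<bar>X t s'\<bar> \<le> (1 + 62/100 + 242/100 + 62/100 * (242/100)) * H"
    by (rule Xle) (use golden_conj_props silver_conj_props in \<open>auto simp: t_def s'_def\<close>)
  then have x2: "\<bar>X t s'\<bar> \<le> 6 * H" using H1 by simp
  have "\<bar>X t' s'\<bar> \<le> (1 + 162/100 + 242/100 + 162/100 * (242/100)) * H"
    by (rule Xle) (use golden_conj_props silver_conj_props in \<open>auto simp: t'_def s'_def\<close>)
  then have x3: "\<bar>X t' s'\<bar> \<le> 9 * H" using H1 by simp
  have "biquad_norm a b c d \<noteq> 0" using biquad_norm_eq_0 nz by blast
  then have "1 \<le> \<bar>real_of_int (biquad_norm a b c d)\<bar>" by linarith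
  also have "\<dots> = \<bar>X t s\<bar> * (\<bar>X t' s\<bar> * (\<bar>X t s'\<bar> * \<bar>X t' s'\<bar>))"
    unfolding biquad_norm_eq[OF tt ss] X_def abs_mult by (simp add: mult.assoc)
  also have "\<dots> \<le> \<bar>X t s\<bar> * ((4 * H) * ((6 * H) * (9 * H)))"
    using x1 x2 x3 H1 by (intro mult_left_mono mult_mono) auto
  finally have "1 \<le> \<bar>X t s\<bar> * (216 * H ^ 3)" by (simp add: power3_eq_cube mult_ac)
  then have "1 / (216 * H ^ 3) \<le> \<bar>X t s\<bar>" using H1 by (simp add: divide_simps)
  then show ?thesis unfolding X_def t_def s_def .
qed

section \<open>Linear phases on a grid\<close>

lemma sin_ge_half:
  assumes "0 \<le> y" "y \<le> pi / 2"
  shows "y / 2 \<le> sin y"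
proof -
  have "\<bar>sin y - (\<Sum>m<3. sin_coeff m * y ^ m)\<bar> \<le> inverse (fact 3) * \<bar>y\<bar> ^ 3"
    by (rule Maclaurin_sin_bound)
  moreover have "(\<Sum>m<3. sin_coeff m * y ^ m) = y" by (simp add: eval_nat_numeral sin_coeff_def)
  ultimately have "\<bar>sin y - y\<bar> \<le> y ^ 3 / 6" using assms(1) by (simp add: fact_numeral)
  then have "sin y \<ge> y - y ^ 3 / 6" by linarith
  moreover have "y ^ 3 / 6 \<le> y / 2"
  proof -
    have "y \<le> 17 / 10" using assms pi_less_4 pi_approx by simp
    then have "y * y \<le> 17/10 * (17/10)" using assms by (intro mult_mono) auto
    then have "y * (y * y) \<le> y * 3" using assms by (intro mult_left_mono) auto
    then show ?thesis by (simp add: power3_eq_cube mult_ac)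
  qed
  ultimately show ?thesis by simp
qed

lemma norm_1_minus_cis:
  assumes "\<bar>x\<bar> \<le> pi"
  shows "\<bar>x\<bar> / 2 \<le> norm (1 - cis x)"
proof -
  have "norm (1 - cis x) = 2 * \<bar>sin (x / 2)\<bar>"
    using dist_exp_i_1[of x] by (simp add: norm_minus_commute cis_conv_exp)
  also have "\<bar>sin (x / 2)\<bar> = \<bar>sin (\<bar>x\<bar> / 2)\<bar>" by (simp add: abs_if)
  finally show ?thesis using sin_ge_half[of "\<bar>x\<bar> / 2"] assms by auto
qed

lemma cos_sq_le_nearest_int_dist:
  assumes "nearest_int_dist u > \<eta>" "\<eta> \<ge> 0"
  shows "(cos (pi * u))\<^sup>2 \<le> 1 - 2 * \<eta>\<^sup>2"
proof -
  define v where "v = u - of_int (round u)"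
  have v: "\<bar>v\<bar> \<le> 1/2" "\<bar>v\<bar> > \<eta>"
    using of_int_round_abs_le[of u] assms by (auto simp: v_def nearest_int_dist_eq_round abs_minus_commute)
  have u: "pi * u = pi * v + of_int (round u) * pi" by (simp add: v_def algebra_simps)
  have "(cos (pi * u))\<^sup>2 = (cos (pi * v))\<^sup>2 * (cos (pi * of_int (round u)))\<^sup>2"
    unfolding u by (simp add: cos_add power_mult_distrib mult.commute[of _ pi])
  also have "\<dots> \<le> (cos (pi * v))\<^sup>2" by (simp add: mult_left_le power2_le_iff_abs_le abs_square_le_1)
  also have "\<dots> = 1 - (sin (pi * \<bar>v\<bar>))\<^sup>2" by (simp add: cos_squared_eq abs_if)
  also have "\<dots> \<le> 1 - 2 * \<eta>\<^sup>2"
  proof -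
    have "pi * \<bar>v\<bar> / 2 \<le> sin (pi * \<bar>v\<bar>)"
      using v by (intro sin_ge_half) auto
    moreover have "3/2 * \<bar>v\<bar> \<le> pi * \<bar>v\<bar> / 2" using pi_gt3 by (simp add: mult_right_mono)
    ultimately have "(3/2 * \<eta>) \<le> sin (pi * \<bar>v\<bar>)" using v by linarith
    then have "(3/2 * \<eta>)\<^sup>2 \<le> (sin (pi * \<bar>v\<bar>))\<^sup>2" using assms by (intro power_mono) auto
    moreover have "2 * \<eta>\<^sup>2 \<le> (3/2 * \<eta>)\<^sup>2" by (simp add: power2_eq_square)
    ultimately show ?thesis by linarith
  qed
  finally show ?thesis .
qed

lemma cos_power_expansion:
  "complex_of_real ((cos (pi * u)) ^ (2 * K)) =
    (\<Sum>i\<le>2*K. of_real (real (2 * K choose i) / 4 ^ K) * cis (2 * pi * of_int (int i - int K) * u))"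
proof -
  have "cis (pi * u) + cis (- (pi * u)) = 2 * complex_of_real (cos (pi * u))"
    by (simp add: complex_eq_iff)
  then have "complex_of_real ((cos (pi * u)) ^ (2 * K)) = (cis (pi * u) + cis (- (pi * u))) ^ (2 * K) / 4 ^ K"
    by (simp add: power_mult_distrib power_mult)
  also have "\<dots> = (\<Sum>i\<le>2*K. of_nat (2 * K choose i) * cis (pi * u) ^ i * cis (- (pi * u)) ^ (2 * K - i)) / 4 ^ K"
    by (simp add: binomial_ring)
  also have "\<dots> = (\<Sum>i\<le>2*K. of_real (real (2 * K choose i) / 4 ^ K) *
      cis (2 * pi * of_int (int i - int K) * u))"
    unfolding sum_divide_distrib
  proof (intro sum.cong refl)
    fix i assume "i \<in> {..2*K}"
    then have "cis (pi * u) ^ i * cis (- (pi * u)) ^ (2 * K - i) = cis (2 * pi * of_int (int i - int K) * u)"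
      by (simp add: Complex.DeMoivre cis_mult of_nat_diff algebra_simps)
    then show "of_nat (2 * K choose i) * cis (pi * u) ^ i * cis (- (pi * u)) ^ (2 * K - i) / 4 ^ K =
       complex_of_real (real (2 * K choose i) / 4 ^ K) * cis (2 * pi * of_int (int i - int K) * u)"
      by (simp add: mult.assoc)
  qed
  finally show ?thesis .
qed

lemma geometric_cis_bound:
  assumes "x \<noteq> 0" "\<bar>x\<bar> \<le> pi"
  shows "norm (\<Sum>j<R. cis (real j * x)) \<le> 4 / \<bar>x\<bar>"
proof -
  have 1: "norm (1 - cis x) \<ge> \<bar>x\<bar> / 2" "\<bar>x\<bar> / 2 > 0" using norm_1_minus_cis assms by auto
  then have "cis x \<noteq> 1" by auto
  have "(\<Sum>j<R. cis (real j * x)) = (\<Sum>j<R. cis x ^ j)" by (intro sum.cong refl Complex.DeMoivre[symmetric])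
  also have "\<dots> = (1 - cis x ^ R) / (1 - cis x)" using \<open>cis x \<noteq> 1\<close> by (simp add: sum_gp_strict)
  finally have "norm (\<Sum>j<R. cis (real j * x)) = norm (1 - cis x ^ R) / norm (1 - cis x)"
    by (simp add: norm_divide)
  also have "\<dots> \<le> 2 / (\<bar>x\<bar> / 2)"
  proof (intro frac_le)
    have "norm (1 - cis x ^ R) \<le> norm (1::complex) + norm (cis x ^ R)" by (rule norm_triangle_ineq4)
    then show "norm (1 - cis x ^ R) \<le> 2" by (simp add: norm_power)
  qed (use 1 in auto)
  finally show ?thesis by simp
qed

text \<open>Expanding the square gives \<open>card W * R\<close> from the diagonal and geometric
  sums off it. The lower bound on the differences of b makes each geometric sum at most
  \<open>R / card W\<close>, so all pairs together add at most \<open>card W * R\<close> again. The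
  upper bound \<open>R / 2\<close> keeps the angle \<open>x v w\<close> within [-pi, pi], so that no
  difference wraps around.\<close>

lemma grid_mean_square:
  fixes a b :: "'w \<Rightarrow> real"
  assumes W: "finite W"
    and sep: "\<And>v w. v \<in> W \<Longrightarrow> w \<in> W \<Longrightarrow> v \<noteq> w \<Longrightarrow>
      real (card W) \<le> \<bar>b v - b w\<bar> \<and> \<bar>b v - b w\<bar> \<le> R / 2"
  shows "(\<Sum>j<R. (norm (\<Sum>w\<in>W. cis (2 * pi * (a w + b w * (real j / R)))))\<^sup>2) \<le> 2 * card W * real R"
proof (cases "R = 0")
  case False
  define x where "x v w = 2 * pi * ((b v - b w) / R)" for v w
  have sq: "complex_of_real ((norm (\<Sum>w\<in>W. cis (2 * pi * (a w + b w * (real j / R)))))\<^sup>2) =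
     (\<Sum>v\<in>W. \<Sum>w\<in>W. cis (2 * pi * (a v - a w)) * cis (real j * x v w))" for j
  proof -
    have "complex_of_real ((norm (\<Sum>w\<in>W. cis (2 * pi * (a w + b w * (real j / R)))))\<^sup>2) =
       (\<Sum>w\<in>W. cis (2 * pi * (a w + b w * (real j / R)))) * cnj (\<Sum>w\<in>W. cis (2 * pi * (a w + b w * (real j / R))))"
      by (rule complex_norm_square)
    also have "\<dots> = (\<Sum>v\<in>W. \<Sum>w\<in>W. cis (2 * pi * (a v + b v * (real j / R))) * cis (- (2 * pi * (a w + b w * (real j / R)))))"
      by (simp add: sum_product cis_cnj)
    also have "\<dots> = (\<Sum>v\<in>W. \<Sum>w\<in>W. cis (2 * pi * (a v - a w)) * cis (real j * x v w))"
      unfolding cis_mult x_def by (intro sum.cong refl arg_cong[where f = cis]) (simp add: algebra_simps diff_divide_distrib)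
    finally show ?thesis .
  qed
  have "complex_of_real (\<Sum>j<R. (norm (\<Sum>w\<in>W. cis (2 * pi * (a w + b w * (real j / R)))))\<^sup>2) =
     (\<Sum>j<R. \<Sum>v\<in>W. \<Sum>w\<in>W. cis (2 * pi * (a v - a w)) * cis (real j * x v w))"
    unfolding of_real_sum sq ..
  also have "\<dots> = (\<Sum>v\<in>W. \<Sum>w\<in>W. cis (2 * pi * (a v - a w)) * (\<Sum>j<R. cis (real j * x v w)))"
    by (subst sum.swap, intro sum.cong refl, subst sum.swap) (simp add: sum_distrib_left)
  finally have eq: "complex_of_real (\<Sum>j<R. (norm (\<Sum>w\<in>W. cis (2 * pi * (a w + b w * (real j / R)))))\<^sup>2) =
     (\<Sum>v\<in>W. \<Sum>w\<in>W. cis (2 * pi * (a v - a w)) * (\<Sum>j<R. cis (real j * x v w)))" .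
  have bound: "norm (cis (2 * pi * (a v - a w)) * (\<Sum>j<R. cis (real j * x v w))) \<le>
      (if v = w then real R else 0) + real R / card W" if "v \<in> W" "w \<in> W" for v w
  proof (cases "v = w")
    case True
    have "norm (\<Sum>j<R. cis (real j * x v w)) \<le> (\<Sum>j<R. norm (cis (real j * x v w)))" by (rule norm_sum)
    then show ?thesis using True by (simp add: norm_mult add_increasing2)
  next
    case ne: False
    define D where "D = \<bar>b v - b w\<bar>"
    have D: "real (card W) \<le> D" "D \<le> R / 2" using sep[OF that ne] by (auto simp: D_def)
    have cW: "card W > 0" using that W card_gt_0_iff by blast
    have x: "\<bar>x v w\<bar> = 2 * pi * (D / R)" by (simp add: x_def D_def abs_mult)
    have "D / R \<le> 1 / 2" using D False by (simp add: field_simps)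
    then have "2 * pi * (D / R) \<le> 2 * pi * (1 / 2)" by (intro mult_left_mono) auto
    then have "\<bar>x v w\<bar> \<le> pi" unfolding x by simp
    moreover have "x v w \<noteq> 0" using x D cW False by auto
    ultimately have "norm (\<Sum>j<R. cis (real j * x v w)) \<le> 4 / \<bar>x v w\<bar>"
      by (intro geometric_cis_bound)
    also have "\<dots> = (2 / pi) * (R / D)" unfolding x using D cW False by (simp add: field_simps)
    also have "\<dots> \<le> 1 * (R / card W)"
      using pi_gt3 D cW by (intro mult_mono divide_left_mono) auto
    finally show ?thesis using ne by (simp add: norm_mult)
  qed
  have "(\<Sum>j<R. (norm (\<Sum>w\<in>W. cis (2 * pi * (a w + b w * (real j / R)))))\<^sup>2) =
      norm (complex_of_real (\<Sum>j<R. (norm (\<Sum>w\<in>W. cis (2 * pi * (a w + b w * (real j / R)))))\<^sup>2))"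
    unfolding norm_of_real by (intro abs_of_nonneg[symmetric] sum_nonneg) simp
  also have "\<dots> \<le> (\<Sum>v\<in>W. \<Sum>w\<in>W. (if v = w then real R else 0) + real R / card W)"
    unfolding eq by (intro order.trans[OF norm_sum] sum_mono bound)
  also have "\<dots> = card W * R + card W * (card W * (R / card W))"
    using W by (simp add: sum.distrib)
  also have "\<dots> \<le> 2 * card W * real R" by (cases "card W = 0") auto
  finally show ?thesis .
qed simp

text \<open>Cauchy-Schwarz over Y, after which the sum of squares is enlarged to the full grid; this
  is why Y may be an arbitrary subset.\<close>

lemma grid_sum_bound:
  fixes a b :: "'w \<Rightarrow> real" and Y :: "nat set"
  assumes W: "finite W" and Y: "Y \<subseteq> {..<R}"
    and sep: "\<And>v w. v \<in> W \<Longrightarrow> w \<in> W \<Longrightarrow> v \<noteq> w \<Longrightarrow>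
      real (card W) \<le> \<bar>b v - b w\<bar> \<and> \<bar>b v - b w\<bar> \<le> R / 2"
  shows "(norm (\<Sum>j\<in>Y. \<Sum>w\<in>W. cis (2 * pi * (a w + b w * (real j / R)))))\<^sup>2 \<le> card Y * (2 * card W * real R)"
proof -
  let ?Z = "\<lambda>j. norm (\<Sum>w\<in>W. cis (2 * pi * (a w + b w * (real j / R))))"
  have "norm (\<Sum>j\<in>Y. \<Sum>w\<in>W. cis (2 * pi * (a w + b w * (real j / R)))) \<le> (\<Sum>j\<in>Y. 1 * ?Z j)"
    by (simp add: norm_sum)
  then have "(norm (\<Sum>j\<in>Y. \<Sum>w\<in>W. cis (2 * pi * (a w + b w * (real j / R)))))\<^sup>2 \<le> (\<Sum>j\<in>Y. 1 * ?Z j)\<^sup>2"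
    by (intro power_mono) auto
  also have "\<dots> \<le> (\<Sum>j\<in>Y. 1\<^sup>2) * (\<Sum>j\<in>Y. (?Z j)\<^sup>2)" by (rule Cauchy_Schwarz_ineq_sum)
  also have "\<dots> = card Y * (\<Sum>j\<in>Y. (?Z j)\<^sup>2)" by simp
  also have "\<dots> \<le> card Y * (\<Sum>j<R. (?Z j)\<^sup>2)"
    using Y by (intro mult_left_mono sum_mono2) auto
  also have "\<dots> \<le> card Y * (2 * card W * real R)"
    by (intro mult_left_mono grid_mean_square[OF W sep]) auto
  finally show ?thesis .
qed

text \<open>If no phase came close to an integer, the trigonometric polynomial \<open>cos (\<pi> u) ^ (2 K)\<close>, whose
  Fourier coefficients are dominated by its mean, would be too small on average.\<close>
lemma grid_hit:
  fixes a b :: "'w \<Rightarrow> real" and Y :: "nat set"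
  assumes W: "finite W" "W \<noteq> {}" and Y: "Y \<subseteq> {..<R}" and K: "K > 0" and \<eta>: "\<eta> \<ge> 0"
    and sep: "\<And>v w. v \<in> W \<Longrightarrow> w \<in> W \<Longrightarrow> v \<noteq> w \<Longrightarrow>
      real (card W) \<le> \<bar>b v - b w\<bar> \<and> real K * \<bar>b v - b w\<bar> \<le> R / 2"
    and dense: "32 * (real K)\<^sup>2 * R \<le> card W * card Y" and R: "R > 0"
    and small: "(1 - 2 * \<eta>\<^sup>2) ^ K < 1 / (4 * real K)"
  shows "\<exists>w\<in>W. \<exists>j\<in>Y. nearest_int_dist (a w + b w * (real j / R)) \<le> \<eta>"
proof (rule ccontr)
  assume *: "\<not> ?thesis"
  define u where "u w j = a w + b w * (real j / R)" for w j
  have far: "\<eta> < nearest_int_dist (u w j)" if "w \<in> W" "j \<in> Y" for w j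
    using * that by (force simp: u_def)
  define N where "N = real (card W) * card Y"
  have finY: "finite Y" using Y finite_subset by blast
  have "32 * (real K)\<^sup>2 * real R > 0" using K R by simp
  then have N0: "N > 0" using dense unfolding N_def of_nat_mult by linarith
  define c where "c i = real (2 * K choose i) / 4 ^ K" for i
  have cK: "c i \<le> c K" for i
    unfolding c_def by (intro divide_right_mono) (auto intro!: binomial_maximum')
  \<comment> \<open>\<open>c K\<close> is the mean of the trigonometric polynomial. Half of this
    lower bound is 1 / (4 K), the threshold in \<open>small\<close>.\<close>
  have cK0: "c K \<ge> 1 / (2 * real K)"
    using central_binomial_lower_bound[OF K] by (simp add: c_def field_simps)
  have cis_bound: "norm (\<Sum>j\<in>Y. \<Sum>w\<in>W. cis (2 * pi * of_int h * u w j)) \<le> N / (4 * real K)"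
    if h: "h \<noteq> 0" "\<bar>h\<bar> \<le> int K" for h :: int
  proof -
    have sep': "real (card W) \<le> \<bar>of_int h * b v - of_int h * b w\<bar> \<and> \<bar>of_int h * b v - of_int h * b w\<bar> \<le> R / 2"
      if "v \<in> W" "w \<in> W" "v \<noteq> w" for v w
    proof -
      have "\<bar>of_int h * b v - of_int h * b w\<bar> = \<bar>real_of_int h\<bar> * \<bar>b v - b w\<bar>"
        by (simp add: abs_mult right_diff_distrib[symmetric])
      moreover have "1 * \<bar>b v - b w\<bar> \<le> \<bar>real_of_int h\<bar> * \<bar>b v - b w\<bar>"
        using h by (intro mult_right_mono) auto
      moreover have "\<bar>real_of_int h\<bar> \<le> real K" using h(2) by linarith
      then have "\<bar>real_of_int h\<bar> * \<bar>b v - b w\<bar> \<le> real K * \<bar>b v - b w\<bar>"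
        by (intro mult_right_mono) auto
      ultimately show ?thesis using sep[OF that, THEN conjunct1] sep[OF that, THEN conjunct2]
        by (intro conjI) linarith+
    qed
    have "(norm (\<Sum>j\<in>Y. \<Sum>w\<in>W. cis (2 * pi * of_int h * u w j)))\<^sup>2 =
      (norm (\<Sum>j\<in>Y. \<Sum>w\<in>W. cis (2 * pi * (of_int h * a w + of_int h * b w * (real j / R)))))\<^sup>2"
      by (simp add: u_def algebra_simps)
    also have "\<dots> \<le> card Y * (2 * card W * real R)" by (rule grid_sum_bound[OF W(1) Y sep'])
    \<comment> \<open>The 32 in \<open>dense\<close> is 16 * 2: the 16 comes from squaring 4 K, the
      2 from the mean square bound.\<close>
    also have "\<dots> \<le> (N / (4 * real K))\<^sup>2"
    proof -
      have "16 * (real K)\<^sup>2 * (card Y * (2 * card W * real R)) = N * (32 * (real K)\<^sup>2 * R)"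
        by (simp add: N_def)
      also have "\<dots> \<le> N * N" using dense N0 by (intro mult_left_mono) (auto simp: N_def)
      finally show ?thesis using K by (simp add: field_simps power2_eq_square)
    qed
    finally show ?thesis by (rule power2_le_imp_le) (use N0 in simp)
  qed
  define S where "S i = (\<Sum>j\<in>Y. \<Sum>w\<in>W. cis (2 * pi * of_int (int i - int K) * u w j))" for i
  have SK: "S K = of_real N" by (simp add: S_def N_def mult.commute)
  have "complex_of_real (\<Sum>j\<in>Y. \<Sum>w\<in>W. (cos (pi * u w j)) ^ (2 * K)) =
      (\<Sum>j\<in>Y. \<Sum>w\<in>W. \<Sum>i\<le>2*K. of_real (c i) * cis (2 * pi * of_int (int i - int K) * u w j))"
    by (simp only: of_real_sum cos_power_expansion c_def)
  also have "\<dots> = (\<Sum>j\<in>Y. \<Sum>i\<le>2*K. \<Sum>w\<in>W. of_real (c i) * cis (2 * pi * of_int (int i - int K) * u w j))"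
    by (rule sum.cong[OF refl sum.swap])
  also have "\<dots> = (\<Sum>i\<le>2*K. of_real (c i) * S i)"
    unfolding S_def sum_distrib_left by (rule sum.swap)
  also have "\<dots> = of_real (c K) * S K + (\<Sum>i\<in>{..2*K} - {K}. of_real (c i) * S i)"
    by (rule sum.remove) auto
  finally have eq: "complex_of_real (\<Sum>j\<in>Y. \<Sum>w\<in>W. (cos (pi * u w j)) ^ (2 * K)) - of_real (c K * N) =
      (\<Sum>i\<in>{..2*K} - {K}. of_real (c i) * S i)" by (simp add: SK)
  \<comment> \<open>There are 2 K nonzero frequencies, each with coefficient at most
    \<open>c K\<close> and exponential sum at most N / (4 K). Together they reach at most half of
    the main term \<open>c K * N\<close>.\<close>
  have "norm (\<Sum>i\<in>{..2*K} - {K}. of_real (c i) * S i) \<le> (\<Sum>i\<in>{..2*K} - {K}. c K * (N / (4 * real K)))"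
  proof (intro order.trans[OF norm_sum] sum_mono)
    fix i assume i: "i \<in> {..2*K} - {K}"
    have "norm (S i) \<le> N / (4 * real K)" unfolding S_def by (rule cis_bound) (use i in auto)
    moreover have "0 \<le> c i" by (simp add: c_def)
    ultimately show "norm (complex_of_real (c i) * S i) \<le> c K * (N / (4 * real K))"
      unfolding norm_mult norm_of_real using cK[of i] by (intro mult_mono) auto
  qed
  also have "\<dots> = real (2 * K) * (c K * (N / (4 * real K)))" by simp
  also have "\<dots> = c K * N / 2" using K by (simp add: field_simps)
  finally have "\<bar>(\<Sum>j\<in>Y. \<Sum>w\<in>W. (cos (pi * u w j)) ^ (2 * K)) - c K * N\<bar> \<le> c K * N / 2"
    unfolding eq[symmetric] of_real_diff[symmetric] norm_of_real .
  then have low: "c K * N / 2 \<le> (\<Sum>j\<in>Y. \<Sum>w\<in>W. (cos (pi * u w j)) ^ (2 * K))" by linarith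
  have "(\<Sum>j\<in>Y. \<Sum>w\<in>W. (cos (pi * u w j)) ^ (2 * K)) \<le> (\<Sum>j\<in>Y. \<Sum>w\<in>W. (1 - 2 * \<eta>\<^sup>2) ^ K)"
    using cos_sq_le_nearest_int_dist[OF far \<eta>]
    by (intro sum_mono) (auto simp: power_mult intro!: power_mono)
  also have "\<dots> = N * (1 - 2 * \<eta>\<^sup>2) ^ K" by (simp add: N_def)
  also have "\<dots> < N * (1 / (4 * real K))" using small N0 by (intro mult_strict_left_mono) auto
  also have "\<dots> = (1 / (2 * real K)) * N / 2" by simp
  also have "\<dots> \<le> c K * N / 2" using cK0 N0 by (intro divide_right_mono mult_right_mono) auto
  finally show False using low by simp
qed

section \<open>Lengths of cylinders\<close>

text \<open>By the intermediate value theorem the image of (0, 1) under \<open>f i\<close> contains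
  the open interval between its endpoint values, and \<open>inj\<close> makes these intervals
  disjoint. The lemma serves both to count grid cells and to bound the total length of disjoint
  cylinders near a point.\<close>

lemma sum_image_lengths_le:
  fixes f :: "'i \<Rightarrow> real \<Rightarrow> real"
  assumes I: "finite I" and cont: "\<And>i. i \<in> I \<Longrightarrow> continuous_on {0..1} (f i)"
    and inj: "\<And>i j s t. i \<in> I \<Longrightarrow> j \<in> I \<Longrightarrow> 0 < s \<Longrightarrow> s < 1 \<Longrightarrow> 0 < t \<Longrightarrow> t < 1 \<Longrightarrow>
      f i s = f j t \<Longrightarrow> i = j"
    and sub: "\<And>i t. i \<in> I \<Longrightarrow> 0 < t \<Longrightarrow> t < 1 \<Longrightarrow> f i t \<in> S"
    and S: "S \<in> lmeasurable"
  shows "(\<Sum>i\<in>I. \<bar>f i 1 - f i 0\<bar>) \<le> measure lebesgue S"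
proof -
  define J where "J i = {min (f i 0) (f i 1)<..<max (f i 0) (f i 1)}" for i
  have J: "\<exists>t. 0 < t \<and> t < 1 \<and> f i t = y" if i: "i \<in> I" and y: "y \<in> J i" for i y
  proof -
    have "\<exists>t. 0 \<le> t \<and> t \<le> 1 \<and> f i t = y"
    proof (cases "f i 0 \<le> f i 1")
      case True
      then show ?thesis using y IVT'[of "f i" 0 y 1] cont[OF i] by (auto simp: J_def)
    next
      case False
      then show ?thesis using y IVT2'[of "f i" 1 y 0] cont[OF i] by (auto simp: J_def)
    qed
    then obtain t where t: "0 \<le> t" "t \<le> 1" "f i t = y" by blast
    moreover have "t \<noteq> 0" "t \<noteq> 1" using t y by (auto simp: J_def)
    ultimately show ?thesis by (intro exI[of _ t]) auto
  qed
  have disj: "disjoint_family_on J I"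
    unfolding disjoint_family_on_def using J inj by blast
  have "(\<Sum>i\<in>I. \<bar>f i 1 - f i 0\<bar>) = (\<Sum>i\<in>I. measure lebesgue (J i))"
    by (intro sum.cong refl) (auto simp: J_def min_def max_def)
  also have "\<dots> = measure lebesgue (\<Union>i\<in>I. J i)"
  proof (rule measure_finite_Union[symmetric, OF I _ disj])
    show "J ` I \<subseteq> sets lebesgue" by (auto simp: J_def)
    show "emeasure lebesgue (J i) \<noteq> \<infinity>" for i unfolding infinity_ennreal_def
      by (intro fmeasurableD2 lmeasurable_open) (auto simp: J_def)
  qed
  also have "\<dots> \<le> measure lebesgue S"
  proof (rule measure_mono_fmeasurable[OF _ _ S])
    show "(\<Union>i\<in>I. J i) \<subseteq> S" using J sub by blast
    show "(\<Union>i\<in>I. J i) \<in> sets lebesgue" using I by (intro sets.finite_UN) (auto simp: J_def)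
  qed
  finally show ?thesis .
qed

section \<open>Words with digits at most M\<close>

definition words :: "nat \<Rightarrow> nat \<Rightarrow> nat list set" where
  "words M k = {w. set w \<subseteq> {1..M} \<and> length w = k}"

lemma finite_words: "finite (words M k)"
  unfolding words_def by (rule finite_lists_length_eq) simp

lemma words_pos: "w \<in> words M k \<Longrightarrow> 0 \<notin> set w"
  by (auto simp: words_def)

lemma words_0: "words M 0 = {[]}"
  by (auto simp: words_def)

lemma card_words: "card (words M k) = M ^ k"
  unfolding words_def by (simp add: card_lists_length_eq)

lemma words_Suc_eq: "words M (Suc k) = (\<lambda>(w, a). w @ [a]) ` (words M k \<times> {1..M})"
proof (intro equalityI subsetI)
  fix w assume w: "w \<in> words M (Suc k)"
  then have "w \<noteq> []" by (auto simp: words_def)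
  then have "w = (\<lambda>(w, a). w @ [a]) (butlast w, last w)" by simp
  moreover have "(butlast w, last w) \<in> words M k \<times> {1..M}"
    using w last_in_set[OF \<open>w \<noteq> []\<close>] unfolding words_def by (auto dest: in_set_butlastD)
  ultimately show "w \<in> (\<lambda>(w, a). w @ [a]) ` (words M k \<times> {1..M})" by blast
qed (auto simp: words_def)

lemma sum_words_Suc:
  "(\<Sum>w\<in>words M (Suc k). f w) = (\<Sum>w\<in>words M k. \<Sum>a\<in>{1..M}. f (w @ [a]))"
proof -
  have "inj_on (\<lambda>(w, a). w @ [a]) (words M k \<times> {1..M})" by (auto simp: inj_on_def)
  then have "(\<Sum>w\<in>words M (Suc k). f w) = (\<Sum>(w, a)\<in>words M k \<times> {1..M}. f (w @ [a]))"
    unfolding words_Suc_eq by (simp add: sum.reindex case_prod_unfold)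
  then show ?thesis by (simp add: sum.cartesian_product)
qed

text \<open>The distance between \<open>cfval w 0\<close> and \<open>cfval w 1\<close> (see
  \<open>cyl_len_eq\<close>), written with denominators so that their recurrence applies.\<close>

definition cyl_len :: "nat list \<Rightarrow> real" where
  "cyl_len w = 1 / (cden w * (cden w + cden_prev w))"

lemma cyl_len_Nil [simp]: "cyl_len [] = 1"
  by (simp add: cyl_len_def)

lemma cyl_len_pos: "0 \<notin> set w \<Longrightarrow> cyl_len w > 0"
  using cf_bounds[of w] unfolding cyl_len_def
  by (intro divide_pos_pos mult_pos_pos) (auto intro: add_pos_nonneg)

lemma cyl_len_le: "0 \<notin> set w \<Longrightarrow> cyl_len w \<le> 1 / (rden w)\<^sup>2"
  using cf_bounds[of w] unfolding cyl_len_def power2_eq_square of_int_mult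
  by (intro divide_left_mono mult_left_mono mult_pos_pos) (auto intro: add_pos_nonneg)

lemma cyl_len_eq: "0 \<notin> set w \<Longrightarrow> \<bar>cfval w 1 - cfval w 0\<bar> = cyl_len w"
  by (subst abs_cfval_diff) (auto simp: cyl_len_def mult.commute)

text \<open>Partial fractions, arranged so that the sum over consecutive digits telescopes.\<close>

lemma cyl_len_child:
  assumes "0 \<notin> set w" "a \<ge> 1"
  shows "cyl_len (w @ [a]) = (1 / (a * cden w + cden_prev w) - 1 / ((a + 1) * cden w + cden_prev w)) / cden w"
proof -
  define q q' where "q = rden w" and "q' = real_of_int (cden_prev w)"
  have q: "q \<ge> 1" "q' \<ge> 0" using cf_bounds[OF assms(1)] by (auto simp: q_def q'_def)
  have a: "real a \<ge> 1" using assms by simp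
  have p: "real a * q + q' > 0" "(real a + 1) * q + q' > 0" using q a by (auto intro!: add_pos_nonneg)
  have "cyl_len (w @ [a]) = 1 / ((real a * q + q') * (real a * q + q' + q))"
    by (simp add: cyl_len_def cden_snoc cden_prev_snoc q_def q'_def)
  also have "\<dots> = (1 / (real a * q + q') - 1 / ((real a + 1) * q + q')) / q"
    using p q by (simp add: divide_simps) (simp add: algebra_simps)
  finally show ?thesis by (simp add: q_def q'_def)
qed

text \<open>The telescoped sum is the share M q / ((M + 1) q + q') of the parent, and q' <= q.
  Discarding the digits above M thus costs a factor close to 1 per step, which controls the density
  of the grid cells as well as the dimension.\<close>

lemma sum_cyl_len_children:
  assumes "0 \<notin> set w"
  shows "(\<Sum>a\<in>{1..M}. cyl_len (w @ [a])) \<ge> real M / (real M + 2) * cyl_len w"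
proof -
  define q q' where "q = rden w" and "q' = real_of_int (cden_prev w)"
  have q: "q \<ge> 1" "q' \<ge> 0" "q' \<le> q" using cf_bounds[OF assms(1)] by (auto simp: q_def q'_def)
  define h where "h a = 1 / (real a * q + q') / q" for a
  have "(\<Sum>a\<in>{1..M}. cyl_len (w @ [a])) = (\<Sum>a\<in>{1..M}. h a - h (Suc a))"
  proof (intro sum.cong refl)
    fix a assume "a \<in> {1..M}"
    then show "cyl_len (w @ [a]) = h a - h (Suc a)"
      by (subst cyl_len_child[OF assms]) (auto simp: h_def q_def q'_def diff_divide_distrib add.commute)
  qed
  also have "\<dots> = h 1 - h (Suc M)" by (induction M) auto
  also have "\<dots> = real M * q / ((real M + 1) * q + q') * cyl_len w"
  proof -
    have p: "q + q' > 0" "(real M + 1) * q + q' > 0" using q by (auto intro!: add_pos_nonneg)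
    have "h 1 - h (Suc M) = (1 / (q + q') - 1 / ((real M + 1) * q + q')) / q"
      by (simp add: h_def diff_divide_distrib add.commute)
    also have "1 / (q + q') - 1 / ((real M + 1) * q + q') = real M * q / ((q + q') * ((real M + 1) * q + q'))"
      using p by (simp add: divide_simps) (simp add: algebra_simps)
    finally show ?thesis using p q by (simp add: cyl_len_def q_def q'_def mult_ac)
  qed
  also have "\<dots> \<ge> real M / (real M + 2) * cyl_len w"
  proof (intro mult_right_mono)
    have "(real M + 1) * q + q' \<le> (real M + 2) * q" using q by (simp add: algebra_simps)
    then have "real M * q / ((real M + 2) * q) \<le> real M * q / ((real M + 1) * q + q')"
      using q by (intro divide_left_mono mult_pos_pos) (auto intro!: add_pos_nonneg)
    then show "real M / (real M + 2) \<le> real M * q / ((real M + 1) * q + q')" using q by simp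
  qed (use cyl_len_pos[OF assms] in simp)
  finally show ?thesis .
qed

lemma sum_cyl_len_words:
  assumes "0 \<notin> set u"
  shows "(real M / (real M + 2)) ^ k * cyl_len u \<le> (\<Sum>w\<in>words M k. cyl_len (u @ w))"
proof (induction k)
  case 0
  show ?case by (simp add: words_0)
next
  case (Suc k)
  have "(real M / (real M + 2)) ^ Suc k * cyl_len u \<le> (real M / (real M + 2)) * (\<Sum>w\<in>words M k. cyl_len (u @ w))"
    using mult_left_mono[OF Suc, of "real M / (real M + 2)"] by (simp add: mult.assoc)
  also have "\<dots> = (\<Sum>w\<in>words M k. real M / (real M + 2) * cyl_len (u @ w))" by (rule sum_distrib_left)
  also have "\<dots> \<le> (\<Sum>w\<in>words M k. \<Sum>a\<in>{1..M}. cyl_len ((u @ w) @ [a]))"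
    using assms by (intro sum_mono sum_cyl_len_children) (auto dest: words_pos)
  finally show ?case by (simp add: sum_words_Suc)
qed

lemma continuous_on_cfval: "0 \<notin> set w \<Longrightarrow> continuous_on {0..1} (cfval w)"
proof (rule continuous_on_eq)
  assume w: "0 \<notin> set w"
  show "continuous_on {0..1} (\<lambda>t. (real_of_int (cnum w) + t * real_of_int (cnum_prev w)) /
    (rden w + t * real_of_int (cden_prev w)))"
    using cden_add_pos[OF w] by (intro continuous_intros) (fastforce)
qed (auto simp: cfval_eq)

text \<open>With x = \<open>cfval z t\<close>, the expression x / (1 + s x) is the variable in which
  the phase is linear (\<open>cfval_word_linear\<close>). Collected are the cells of mesh 1 / R that
  it visits while the first k digits of x are at most M.\<close>

definition grid_cells :: "nat \<Rightarrow> nat \<Rightarrow> nat \<Rightarrow> real \<Rightarrow> nat set" where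
  "grid_cells M k R s = {j. \<exists>z\<in>words M k. \<exists>t. 0 < t \<and> t < 1 \<and>
     j = nat \<lfloor>real R * (cfval z t / (1 + s * cfval z t))\<rfloor>}"

text \<open>The visited cells have total measure \<open>card / R\<close> and contain the disjoint
  images of the cylinders of all z. The map x / (1 + s x) shrinks lengths by at most 4, since both
  factors 1 + s x and 1 + s y of the difference quotient are at most 2.\<close>

lemma grid_cells:
  assumes s: "0 \<le> s" "s \<le> 1" and R: "R > 0"
  shows "grid_cells M k R s \<subseteq> {..<R}"
    and "real R / 4 * (real M / (real M + 2)) ^ k \<le> card (grid_cells M k R s)"
proof -
  let ?Y = "grid_cells M k R s"
  define f where "f z t = cfval z t / (1 + s * cfval z t)" for z and t :: real
  have f01: "0 < f z t" "f z t < 1" if "z \<in> words M k" "0 < t" "t < 1" for z and t :: real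
  proof -
    have c: "0 < cfval z t" "cfval z t < 1" using cfval_open[OF words_pos[OF that(1)] that(2,3)] by auto
    have "1 + s * cfval z t \<ge> 1" using c s by simp
    then show "0 < f z t" "f z t < 1" using c by (auto simp: f_def divide_simps)
  qed
  show sub: "?Y \<subseteq> {..<R}"
  proof
    fix j assume "j \<in> ?Y"
    then obtain z t where zt: "z \<in> words M k" "0 < t" "t < 1" "j = nat \<lfloor>real R * f z t\<rfloor>"
      by (auto simp: grid_cells_def f_def)
    have "real R * f z t < real R * 1" using f01[OF zt(1-3)] R by (intro mult_strict_left_mono) auto
    then have "\<lfloor>real R * f z t\<rfloor> < int R" by (simp add: floor_less_iff)
    then show "j \<in> {..<R}" using zt(4) R by auto
  qed
  then have fin: "finite ?Y" using finite_subset by blast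
  define S where "S = (\<Union>j\<in>?Y. {real j / R..(real j + 1) / R})"
  have S: "S \<in> lmeasurable" unfolding S_def using fin by (intro fmeasurable.finite_UN) auto
  have "(\<Sum>z\<in>words M k. \<bar>f z 1 - f z 0\<bar>) \<le> measure lebesgue S"
  proof (rule sum_image_lengths_le[OF finite_words _ _ _ S])
    fix z assume z: "z \<in> words M k"
    have "1 + s * cfval z t \<noteq> 0" if "t \<in> {0..1}" for t :: real
    proof -
      have "0 \<le> s * cfval z t" using cfval_bounds(1)[OF words_pos[OF z], of t] that s by simp
      then show ?thesis by linarith
    qed
    then show "continuous_on {0..1} (f z)" unfolding f_def
      by (intro continuous_intros continuous_on_cfval words_pos[OF z]) auto
  next
    fix z z' and t t' :: real assume h: "z \<in> words M k" "z' \<in> words M k" "0 < t" "t < 1" "0 < t'" "t' < 1" "f z t = f z' t'"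
    have c: "0 < cfval z t" "0 < cfval z' t'"
      using cfval_open[OF words_pos[OF h(1)] h(3,4)] cfval_open[OF words_pos[OF h(2)] h(5,6)] by auto
    have "1 + s * cfval z t > 0" "1 + s * cfval z' t' > 0" using c s by (auto intro!: add_pos_nonneg)
    then have "cfval z t = cfval z' t'" using h(7) unfolding f_def by (simp add: divide_simps algebra_simps)
    then show "z = z'" using h by (intro cfval_inj[of z z' t t']) (auto simp: words_def)
  next
    fix z and t :: real assume h: "z \<in> words M k" "0 < t" "t < 1"
    define j where "j = nat \<lfloor>real R * f z t\<rfloor>"
    have "j \<in> ?Y" using h by (auto simp: grid_cells_def f_def j_def)
    moreover have "real j \<le> real R * f z t" "real R * f z t \<le> real j + 1"
      using f01[OF h] R unfolding j_def by (auto simp: of_nat_nat)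
    ultimately show "f z t \<in> S" unfolding S_def using R
      by (auto simp: divide_simps mult.commute intro!: bexI[of _ j])
  qed
  also have "\<dots> \<le> (\<Sum>j\<in>?Y. measure lebesgue {real j / R..(real j + 1) / R})"
    unfolding S_def by (intro measure_UNION_le fin) auto
  also have "\<dots> = real (card ?Y) / R" using R by (simp add: divide_right_mono diff_divide_distrib[symmetric])
  finally have up: "(\<Sum>z\<in>words M k. \<bar>f z 1 - f z 0\<bar>) \<le> real (card ?Y) / R" .
  have "(real M / (real M + 2)) ^ k / 4 \<le> (\<Sum>z\<in>words M k. cyl_len z / 4)"
    using sum_cyl_len_words[of "[]" M k] by (simp flip: sum_divide_distrib)
  also have "\<dots> \<le> (\<Sum>z\<in>words M k. \<bar>f z 1 - f z 0\<bar>)"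
  proof (intro sum_mono)
    fix z assume z: "z \<in> words M k"
    define x y where "x = cfval z 1" and "y = cfval z 0"
    have xy: "0 \<le> x" "x \<le> 1" "0 \<le> y" "y \<le> 1" using cfval_bounds[OF words_pos[OF z]] by (auto simp: x_def y_def)
    have sx: "1 \<le> 1 + s * x" "1 + s * x \<le> 2" "1 \<le> 1 + s * y" "1 + s * y \<le> 2"
      using xy s mult_le_one[of s x] mult_le_one[of s y] by auto
    have "f z 1 - f z 0 = (x - y) / ((1 + s * x) * (1 + s * y))"
      using sx unfolding f_def x_def[symmetric] y_def[symmetric] by (simp add: divide_simps) (simp add: algebra_simps)
    then have "\<bar>f z 1 - f z 0\<bar> = \<bar>x - y\<bar> / ((1 + s * x) * (1 + s * y))" using sx by (simp add: abs_mult)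
    also have "\<bar>x - y\<bar> = cyl_len z" using cyl_len_eq[OF words_pos[OF z]] by (simp add: x_def y_def)
    also have "cyl_len z / 4 \<le> cyl_len z / ((1 + s * x) * (1 + s * y))"
    proof (intro divide_left_mono mult_pos_pos)
      have "(1 + s * x) * (1 + s * y) \<le> 2 * 2" using sx by (intro mult_mono) auto
      then show "(1 + s * x) * (1 + s * y) \<le> 4" by simp
    qed (use sx cyl_len_pos[OF words_pos[OF z]] in auto)
    finally show "cyl_len z / 4 \<le> \<bar>f z 1 - f z 0\<bar>" .
  qed
  finally have "real R * ((real M / (real M + 2)) ^ k / 4) \<le> real R * (\<Sum>z\<in>words M k. \<bar>f z 1 - f z 0\<bar>)"
    by (intro mult_left_mono) auto
  also have "\<dots> \<le> card ?Y" using up R by (simp add: field_simps)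
  finally show "real R / 4 * (real M / (real M + 2)) ^ k \<le> card ?Y" by simp
qed

section \<open>Inhomogeneous approximation along convergents\<close>

definition cf_word :: "real \<Rightarrow> nat \<Rightarrow> nat list" where
  "cf_word \<alpha> t = map (\<lambda>i. nat (cf_coeff \<alpha> (Suc i))) [0..<t]"

lemma cf_word_Suc: "cf_word \<alpha> (Suc t) = cf_word \<alpha> t @ [nat (cf_coeff \<alpha> (Suc t))]"
  by (simp add: cf_word_def)

lemma length_cf_word [simp]: "length (cf_word \<alpha> t) = t"
  by (simp add: cf_word_def)

lemma frac_irrational_pos: "x \<notin> \<rat> \<Longrightarrow> 0 < frac x"
  using frac_ge_0[of x] frac_eq_0_iff[of x] Ints_subset_Rats by (metis antisym_conv1 subsetD)

lemma cf_rem_irrational: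
  assumes "\<alpha> \<notin> \<rat>"
  shows "cf_rem \<alpha> k \<notin> \<rat>"
proof (induction k)
  case (Suc k)
  show ?case
  proof
    assume "cf_rem \<alpha> (Suc k) \<in> \<rat>"
    then have "1 / cf_rem \<alpha> (Suc k) \<in> \<rat>" by (intro Rats_divide) auto
    then have "frac (cf_rem \<alpha> k) + of_int \<lfloor>cf_rem \<alpha> k\<rfloor> \<in> \<rat>" by (intro Rats_add) auto
    then show False using Suc by (simp add: frac_def)
  qed
qed (use assms in simp)

lemma cf_coeff_pos:
  assumes "\<alpha> \<notin> \<rat>"
  shows "cf_coeff \<alpha> (Suc k) \<ge> 1"
proof -
  have "0 < frac (cf_rem \<alpha> k)" "frac (cf_rem \<alpha> k) < 1"
    using frac_irrational_pos[OF cf_rem_irrational[OF assms]] frac_lt_1 by auto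
  then have "cf_rem \<alpha> (Suc k) \<ge> 1" by simp
  then show ?thesis unfolding cf_coeff_def by (simp add: le_floor_iff)
qed

lemma cf_word_pos: "\<alpha> \<notin> \<rat> \<Longrightarrow> 0 \<notin> set (cf_word \<alpha> t)"
proof
  assume \<alpha>: "\<alpha> \<notin> \<rat>" and "0 \<in> set (cf_word \<alpha> t)"
  then obtain i where "nat (cf_coeff \<alpha> (Suc i)) = 0" by (auto simp: cf_word_def)
  with cf_coeff_pos[OF \<alpha>, of i] show False by simp
qed

lemma cden_cf_word:
  assumes "\<alpha> \<notin> \<rat>"
  shows "cden (cf_word \<alpha> t) = cf_denom \<alpha> t"
proof (induction t rule: induct_nat_012)
  case 0
  show ?case by (simp add: cf_word_def)
next
  case 1
  show ?case using cf_coeff_pos[OF assms, of 0] by (simp add: cf_word_def)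
next
  case (ge2 k)
  show ?case using ge2 cf_coeff_pos[OF assms, of "Suc k"]
    by (simp add: cf_word_Suc[of _ "Suc k"] cden_snoc) (simp add: cf_word_Suc cden_prev_snoc)
qed

lemma frac_eq_cfval_cf_word:
  assumes "\<alpha> \<notin> \<rat>"
  shows "frac \<alpha> = cfval (cf_word \<alpha> t) (frac (cf_rem \<alpha> t))"
proof (induction t)
  case 0
  show ?case by (simp add: cf_word_def)
next
  case (Suc t)
  have "real (nat (cf_coeff \<alpha> (Suc t))) + frac (cf_rem \<alpha> (Suc t)) = cf_rem \<alpha> (Suc t)"
    using cf_coeff_pos[OF assms, of t] by (simp add: cf_coeff_def frac_def del: cf_rem.simps)
  then show ?case using Suc by (simp add: cf_word_Suc cfval_append)
qed

lemma convergent_approx: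
  assumes "\<alpha> \<notin> \<rat>"
  obtains p where "coprime p (cf_denom \<alpha> t)" "cf_denom \<alpha> t \<ge> 1"
    "\<bar>\<alpha> - p / cf_denom \<alpha> t\<bar> \<le> 1 / (real_of_int (cf_denom \<alpha> t))\<^sup>2"
proof -
  let ?w = "cf_word \<alpha> t"
  have w: "0 \<notin> set ?w" by (rule cf_word_pos[OF assms])
  have q: "cden ?w = cf_denom \<alpha> t" by (rule cden_cf_word[OF assms])
  have q1: "cden ?w \<ge> 1" by (rule cf_bounds(1)[OF w])
  define p where "p = cnum ?w + \<lfloor>\<alpha>\<rfloor> * cden ?w"
  have "coprime (cnum ?w) (cden ?w)"
  proof (rule coprimeI)
    fix d assume "d dvd cnum ?w" "d dvd cden ?w"
    then have "d dvd cnum_prev ?w * cden ?w - cnum ?w * cden_prev ?w" by (intro dvd_diff dvd_mult dvd_mult2)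
    then show "is_unit d" unfolding cf_det using dvd_trans[of d "(-1) ^ t" "1::int"] by (simp add: minus_one_power_iff split: if_splits)
  qed
  then have "coprime p (cden ?w)" unfolding p_def
    by (metis add.commute gcd_add_mult gcd.commute coprime_iff_gcd_eq_1 mult.commute)
  moreover have "\<alpha> - p / cden ?w = cfval ?w (frac (cf_rem \<alpha> t)) - cfval ?w 0"
    using q1 unfolding frac_eq_cfval_cf_word[OF assms, of t, symmetric] p_def
    by (simp add: cfval_eq[OF w] frac_def field_simps)
  moreover have "\<bar>cfval ?w (frac (cf_rem \<alpha> t)) - cfval ?w 0\<bar> \<le> \<bar>frac (cf_rem \<alpha> t) - 0\<bar> / (real_of_int (cden ?w))\<^sup>2"
    by (intro abs_cfval_diff_le[OF w]) auto
  moreover have "\<bar>frac (cf_rem \<alpha> t) - 0\<bar> / (real_of_int (cden ?w))\<^sup>2 \<le> 1 / (real_of_int (cden ?w))\<^sup>2"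
    using frac_lt_1[of "cf_rem \<alpha> t"] by (intro divide_right_mono) auto
  ultimately show ?thesis using q1 unfolding q by (intro that[of p]) auto
qed

lemma nearest_int_dist_le: "nearest_int_dist x \<le> \<bar>x - of_int k\<bar>"
  unfolding nearest_int_dist_eq_round using round_diff_minimal[of x k] by simp

lemma nearest_int_dist_nonneg: "nearest_int_dist x \<ge> 0"
  by (simp add: nearest_int_dist_eq_round)

lemma nearest_int_dist_triangle: "nearest_int_dist (x + y) \<le> nearest_int_dist x + \<bar>y\<bar>"
  using nearest_int_dist_le[of "x + y" "round x"] unfolding nearest_int_dist_eq_round[of x] by linarith

text \<open>For a convergent \<open>p / q\<close>, the numbers \<open>n p / q\<close> with \<open>q \<le> n < 2 q\<close> run through all fractions with
  denominator \<open>q\<close> modulo 1, so one of them is within \<open>1 / (2 q)\<close> of \<open>\<gamma>\<close>.\<close>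
lemma inhomogeneous_approx:
  assumes "\<alpha> \<notin> \<rat>"
  obtains n where "int n \<ge> cf_denom \<alpha> t" "int n < 2 * cf_denom \<alpha> t"
    "real n * nearest_int_dist (real n * \<alpha> - \<gamma>) \<le> 5"
proof -
  obtain p where p: "coprime p (cf_denom \<alpha> t)" "cf_denom \<alpha> t \<ge> 1"
    "\<bar>\<alpha> - p / cf_denom \<alpha> t\<bar> \<le> 1 / (real_of_int (cf_denom \<alpha> t))\<^sup>2"
    using convergent_approx[OF assms, of t] by blast
  define q where "q = cf_denom \<alpha> t"
  have q: "q \<ge> 1" "coprime p q" using p by (auto simp: q_def)
  define m where "m = round (q * \<gamma>)"
  \<comment> \<open>x inverts p modulo q, so n congruent to x m gives n p congruent to m, where m /
    q is the fraction nearest to \<gamma>. Adding q to the residue places n in [q, 2 q).\<close>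
  obtain x y where xy: "x * p + y * q = 1" using bezout_int[of p q] q(2) by auto
  define r where "r = x * m"
  define n where "n = q + r mod q"
  have n: "n \<ge> q" "n < 2 * q" using q by (auto simp: n_def)
  define k where "k = p - p * (r div q) - y * m"
  have k: "p * n = m + q * k"
  proof -
    have "p * n = m * (x * p + y * q) + q * k"
      unfolding n_def k_def minus_mult_div_eq_mod[symmetric] r_def by (simp add: algebra_simps)
    then show ?thesis using xy by simp
  qed
  have qr: "real_of_int q \<ge> 1" using q by simp
  have n': "0 \<le> real_of_int n" "real_of_int n \<le> 2 * q" using n q by auto
  have "n * \<alpha> - n * (p / q) = n * (\<alpha> - p / q)" by (simp add: algebra_simps)
  then have "\<bar>n * \<alpha> - n * (p / q)\<bar> = n * \<bar>\<alpha> - p / q\<bar>"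
    using n' by (simp only: abs_mult abs_of_nonneg)
  also have "\<dots> \<le> (2 * q) * (1 / (real_of_int q)\<^sup>2)"
    using n' p(3) unfolding q_def[symmetric] by (intro mult_mono) auto
  also have "\<dots> = 2 / q" using qr by (simp add: power2_eq_square)
  finally have 1: "\<bar>n * \<alpha> - n * (p / q)\<bar> \<le> 2 / q" .
  have "n * (real_of_int p / q) = m / q + k"
    using arg_cong[OF k, of real_of_int] qr by (simp add: field_simps)
  moreover have "\<bar>m / q - \<gamma>\<bar> \<le> 1 / (2 * q)"
  proof -
    have "m / q - \<gamma> = (m - q * \<gamma>) / q" using qr by (simp add: field_simps)
    moreover have "\<bar>m - q * \<gamma>\<bar> \<le> 1 / 2" unfolding m_def by (rule of_int_round_abs_le)
    ultimately show ?thesis using qr by (simp add: divide_right_mono field_simps)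
  qed
  \<comment> \<open>Replacing \<alpha> by p / q costs 2 / q and rounding \<gamma> costs 1 / (2 q);
    multiplied by n <= 2 q this is 4 + 1 = 5.\<close>
  ultimately have "\<bar>n * \<alpha> - \<gamma> - k\<bar> \<le> 2 / q + 1 / (2 * q)" using 1 by linarith
  then have "nearest_int_dist (n * \<alpha> - \<gamma>) \<le> 2 / q + 1 / (2 * q)"
    using nearest_int_dist_le[of "n * \<alpha> - \<gamma>" k] by linarith
  then have "n * nearest_int_dist (n * \<alpha> - \<gamma>) \<le> (2 * q) * (2 / q + 1 / (2 * q))"
    using n' nearest_int_dist_nonneg by (intro mult_mono) auto
  also have "\<dots> = 5" using qr by (simp add: field_simps)
  finally show ?thesis using n q by (intro that[of "nat n"]) (auto simp: q_def)
qed

lemma cf_denom_growth: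
  assumes "\<alpha> \<notin> \<rat>"
  shows "2 ^ (j div 2) * cf_denom \<alpha> k \<le> cf_denom \<alpha> (k + j)"
proof -
  define v where "v = map (\<lambda>i. nat (cf_coeff \<alpha> (Suc i))) [k..<k+j]"
  have w: "cf_word \<alpha> (k + j) = cf_word \<alpha> k @ v"
    unfolding cf_word_def v_def upt_add_eq_append[of 0 k j, simplified] by simp
  have v: "0 \<notin> set v" using cf_word_pos[OF assms, of "k + j"] unfolding w by simp
  have "2 ^ (length v div 2) * cden (cf_word \<alpha> k) \<le> cden v * cden (cf_word \<alpha> k)"
    using cden_ge_pow2[OF v] cf_bounds(1)[OF cf_word_pos[OF assms, of k]] by (intro mult_right_mono) auto
  also have "\<dots> \<le> cden (cf_word \<alpha> (k + j))"
    unfolding w using cden_append_ge[OF cf_word_pos[OF assms] v] by (simp add: mult.commute)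
  finally show ?thesis by (simp add: cden_cf_word[OF assms] v_def)
qed

lemma K_setE:
  assumes "\<alpha> \<in> K_set"
  obtains C where "C \<ge> 0" "\<And>t. ln (real_of_int (cf_denom \<alpha> t)) \<le> C * real t" "\<alpha> \<notin> \<rat>"
proof -
  have irr: "\<alpha> \<notin> \<rat>" using assms by (simp add: K_set_def)
  define S where "S = (SUP t\<in>{1::nat..}. ereal (ln (real_of_int (cf_denom \<alpha> t)) / real t))"
  have S: "S < \<infinity>" using assms by (simp add: K_set_def S_def)
  have le: "ereal (ln (real_of_int (cf_denom \<alpha> t)) / real t) \<le> S" if "t \<ge> 1" for t
    unfolding S_def using that by (intro SUP_upper) auto
  obtain C where C: "S = ereal C" using S le[of 1] by (cases S) auto
  have q1: "ln (real_of_int (cf_denom \<alpha> t)) \<ge> 0" for t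
    using cf_bounds(1)[OF cf_word_pos[OF irr], of t] by (simp add: cden_cf_word[OF irr])
  have "C \<ge> 0" using le[of 1] q1[of 1] by (simp add: C)
  moreover have "ln (real_of_int (cf_denom \<alpha> t)) \<le> C * real t" for t
    using le[of t] by (cases "t = 0") (simp_all add: C divide_le_eq)
  ultimately show ?thesis using irr that by blast
qed

section \<open>Forcing one target\<close>

lemma cfval_replicate_fixed: "1 / (real a + x) = x \<Longrightarrow> cfval (replicate k a) x = x"
  by (induction k) auto

lemma golden_fixed: "1 / (real 1 + golden_conj) = golden_conj"
  using golden_conj_props by (simp add: field_simps power2_eq_square)

lemma silver_fixed: "1 / (real 2 + silver_conj) = silver_conj"
  using silver_conj_props by (simp add: field_simps power2_eq_square)

text \<open>x is fixed by prepending the digit a, so both numbers are images under one map, which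
  contracts by the squared denominator.\<close>

lemma cfval_replicate_close:
  assumes "1 / (real a + x) = x" "0 \<le> x" "x \<le> 1" "0 \<le> t" "t \<le> 1" "a \<ge> 1"
  shows "\<bar>cfval (replicate k a) t - x\<bar> \<le> 1 / (rden (replicate k a))\<^sup>2"
proof -
  have pos: "0 \<notin> set (replicate k a)" using assms(6) by auto
  have "\<bar>cfval (replicate k a) t - cfval (replicate k a) x\<bar> \<le> \<bar>t - x\<bar> / (rden (replicate k a))\<^sup>2"
    using assms by (intro abs_cfval_diff_le[OF pos]) auto
  also have "\<dots> \<le> 1 / (rden (replicate k a))\<^sup>2"
    using assms by (intro divide_right_mono) auto
  finally show ?thesis unfolding cfval_replicate_fixed[OF assms(1)] .
qed

lemma cden_ratio_bounds:
  assumes "0 \<notin> set u"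
  shows "0 \<le> real_of_int (cden_prev u) / cden u" "real_of_int (cden_prev u) / cden u \<le> 1"
  using cf_bounds[OF assms] by (auto simp: divide_le_eq)

lemma cden_ratio_replicate_close:
  assumes "0 \<notin> set u" "1 / (real a + x) = x" "0 \<le> x" "x \<le> 1" "a \<ge> 1"
  shows "\<bar>real_of_int (cden_prev (u @ replicate k a)) / cden (u @ replicate k a) - x\<bar>
    \<le> 1 / (rden (replicate k a))\<^sup>2"
proof -
  have pos: "0 \<notin> set (replicate k a)" using assms(5) by auto
  show ?thesis unfolding cden_ratio_append[OF assms(1) pos] rev_replicate
    by (intro cfval_replicate_close cden_ratio_bounds) (use assms in auto)
qed

text \<open>Comparison with the tail 0: the phase is affine in x / (1 + q x), where q is the ratio
  of the last two denominators of w, and its slope is n divided by the squared denominator, up to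
  sign. The source of a_w + b_w y.\<close>

lemma cfval_word_linear:
  fixes n x :: real
  assumes "0 \<notin> set w" "x \<ge> 0"
  shows "n * cfval w x = n * cnum w / cden w + (-1) ^ length w * (n / (rden w)\<^sup>2) *
    (x / (1 + real_of_int (cden_prev w) / cden w * x))"
proof -
  define Q D where "Q = rden w" and "D = rden w + x * real_of_int (cden_prev w)"
  have Q: "Q \<ge> 1" using cf_bounds[OF assms(1)] by (simp add: Q_def)
  have D: "D \<ge> 1" unfolding D_def by (rule cden_add_pos[OF assms])
  have "cfval w x - cfval w 0 = (-1) ^ length w * x / (D * Q)"
    using cfval_diff[OF assms(1) _ assms(2), of 0] by (simp add: D_def Q_def)
  moreover have "cfval w 0 = cnum w / Q" using cfval_eq[OF assms(1), of 0] by (simp add: Q_def)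
  ultimately have "n * cfval w x = n * (cnum w / Q) + n * ((-1) ^ length w * x / (D * Q))"
    by (metis add_diff_cancel_left' diff_add_cancel distrib_left add.commute)
  moreover have "1 + real_of_int (cden_prev w) / Q * x = D / Q"
    using Q by (simp add: D_def Q_def field_simps)
  moreover have "n * ((-1) ^ length w * x / (D * Q)) = (-1) ^ length w * (n / Q\<^sup>2) * (x / (D / Q))"
    using Q D by (simp add: power2_eq_square mult_ac)
  ultimately show ?thesis unfolding Q_def[symmetric] by simp
qed

text \<open>The factor by which w enlarges the product of the denominators of its neighbours
  (\<open>cden_append3\<close>). The neighbours enter only through r on the left and s on the right,
  and for fixed r, s the form is linear in the integer matrix of w.\<close>

definition cross_form :: "real \<Rightarrow> real \<Rightarrow> nat list \<Rightarrow> real" where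
  "cross_form r s w = rden w + r * real_of_int (cnum w) + s * real_of_int (cden_prev w)
    + r * s * real_of_int (cnum_prev w)"

lemma cden_append3:
  assumes "0 \<notin> set u" "0 \<notin> set v"
  shows "rden (u @ w @ v) =
    rden u * rden v * cross_form (real_of_int (cden_prev u) / cden u) (real_of_int (cnum v) / cden v) w"
proof -
  have "rden u \<ge> 1" "rden v \<ge> 1"
    using cf_bounds[OF assms(1)] cf_bounds[OF assms(2)] by auto
  then show ?thesis by (simp add: cross_form_def cden_append cnum_append field_simps)
qed

lemma words_2_entries:
  assumes "w \<in> words 2 L"
  shows "1 \<le> cden w" "cden w \<le> 3 ^ L" "0 \<le> cnum w" "cnum w \<le> 3 ^ L" "0 \<le> cden_prev w"
    "cden_prev w \<le> 3 ^ L" "0 \<le> cnum_prev w" "cnum_prev w \<le> 3 ^ L"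
proof -
  have "cden w \<le> 3 ^ L" using cden_le_pow[of w 2] assms by (auto simp: words_def)
  with cf_bounds[OF words_pos[OF assms]]
  show "1 \<le> cden w" "cden w \<le> 3 ^ L" "0 \<le> cnum w" "cnum w \<le> 3 ^ L" "0 \<le> cden_prev w"
    "cden_prev w \<le> 3 ^ L" "0 \<le> cnum_prev w" "cnum_prev w \<le> 3 ^ L" by auto
qed

lemma cross_form_bounds:
  assumes w: "w \<in> words 2 L" and r: "0 \<le> r" "r \<le> 1" and s: "0 \<le> s" "s \<le> 1"
  shows "1 \<le> cross_form r s w" "cross_form r s w \<le> 4 * 3 ^ L"
proof -
  have e: "1 \<le> rden w" "rden w \<le> 3 ^ L" "0 \<le> real_of_int (cnum w)"
    "real_of_int (cnum w) \<le> 3 ^ L" "0 \<le> real_of_int (cden_prev w)" "real_of_int (cden_prev w) \<le> 3 ^ L"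
    "0 \<le> real_of_int (cnum_prev w)" "real_of_int (cnum_prev w) \<le> 3 ^ L"
    using words_2_entries[OF w]
    by (simp_all add: of_int_le_iff[of _ "3 ^ L", where 'a = real, unfolded of_int_power of_int_numeral])
  have rs: "0 \<le> r * s" "r * s \<le> 1" using r s by (auto intro: mult_le_one)
  have "r * cnum w \<le> 1 * 3 ^ L" "s * cden_prev w \<le> 1 * 3 ^ L" "r * s * cnum_prev w \<le> 1 * 3 ^ L"
    using e r s rs by (intro mult_mono; simp)+
  moreover have "0 \<le> r * cnum w" "0 \<le> s * cden_prev w" "0 \<le> r * s * cnum_prev w"
    using e r s by auto
  ultimately show "1 \<le> cross_form r s w" "cross_form r s w \<le> 4 * 3 ^ L"
    using e unfolding cross_form_def by linarith+
qed

text \<open>The four entries determine the map \<open>cfval\<close>, and its value at an interior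
  point determines the digits.\<close>

lemma words_entries_inj:
  assumes "v \<in> words M L" "w \<in> words M L" "cden v = cden w" "cnum v = cnum w"
    "cden_prev v = cden_prev w" "cnum_prev v = cnum_prev w"
  shows "v = w"
proof -
  have "cfval v (1/2) = cfval w (1/2)"
    using assms by (simp add: cfval_eq words_pos)
  then show ?thesis using assms by (intro cfval_inj[of v w "1/2" "1/2"]) (auto simp: words_def)
qed

text \<open>At the exact values of r and s the difference is the biquadratic form in integers of
  size at most H = 3 ^ L, hence at least 1 / (216 H^3). Moving r and s by e changes it by at most 4
  e H, and the tolerance 1 / (3456 * 81 ^ L) makes this a quarter of the main term.\<close>

lemma cross_form_separation:
  assumes v: "v \<in> words 2 L" and w: "w \<in> words 2 L" and ne: "v \<noteq> w"
    and r: "0 \<le> r" "r \<le> 1" "\<bar>r - golden_conj\<bar> \<le> e" and s: "0 \<le> s" "s \<le> 1" "\<bar>s - silver_conj\<bar> \<le> e"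
    and e: "e \<le> 1 / (3456 * 81 ^ L)"
  shows "1 / (432 * 27 ^ L) \<le> \<bar>cross_form r s v - cross_form r s w\<bar>"
proof -
  define a b c d where "a = cden v - cden w" and "b = cnum v - cnum w"
    and "c = cden_prev v - cden_prev w" and "d = cnum_prev v - cnum_prev w"
  define H :: real where "H = 3 ^ L"
  have abcd: "\<bar>real_of_int a\<bar> \<le> H" "\<bar>real_of_int b\<bar> \<le> H" "\<bar>real_of_int c\<bar> \<le> H" "\<bar>real_of_int d\<bar> \<le> H"
  proof -
    have *: "\<bar>real_of_int z\<bar> \<le> H" if "\<bar>z\<bar> \<le> 3 ^ L" for z
      using that unfolding H_def by (metis of_int_abs of_int_le_iff of_int_numeral of_int_power)
    show "\<bar>real_of_int a\<bar> \<le> H" "\<bar>real_of_int b\<bar> \<le> H" "\<bar>real_of_int c\<bar> \<le> H" "\<bar>real_of_int d\<bar> \<le> H"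
      by (rule *; use words_2_entries[OF v] words_2_entries[OF w] in \<open>simp add: a_def b_def c_def d_def\<close>)+
  qed
  have nz: "a \<noteq> 0 \<or> b \<noteq> 0 \<or> c \<noteq> 0 \<or> d \<noteq> 0"
    using words_entries_inj[OF v w] ne by (auto simp: a_def b_def c_def d_def)
  define D where "D = a + golden_conj * b + silver_conj * c + golden_conj * silver_conj * d"
  have low: "1 / (216 * H ^ 3) \<le> \<bar>D\<bar>" unfolding D_def by (rule biquad_form_lower[OF abcd nz])
  have H3: "H ^ 3 = 27 ^ L" by (simp add: H_def power3_eq_cube flip: power_mult_distrib)
  define d1 d2 d3 where "d1 = (r - golden_conj) * real_of_int b" and "d2 = (s - silver_conj) * real_of_int c"
    and "d3 = (r * s - golden_conj * silver_conj) * real_of_int d"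
  define Z where "Z = cross_form r s v - cross_form r s w"
  have e0: "0 \<le> e" by (rule order.trans[OF abs_ge_zero r(3)])
  have Z: "Z = D + (d1 + (d2 + d3))"
    unfolding Z_def cross_form_def a_def b_def c_def d_def D_def d1_def d2_def d3_def
    by (simp add: algebra_simps)
  have "r * s - golden_conj * silver_conj = (r - golden_conj) * s + golden_conj * (s - silver_conj)"
    by (simp add: algebra_simps)
  moreover have "\<bar>(r - golden_conj) * s\<bar> \<le> e * 1" "\<bar>golden_conj * (s - silver_conj)\<bar> \<le> 1 * e"
    unfolding abs_mult
    by (rule mult_mono[OF r(3) _ e0 abs_ge_zero], use s in simp)
      (rule mult_mono[OF _ s(3) _ abs_ge_zero], use golden_conj_props in auto)
  ultimately have "\<bar>r * s - golden_conj * silver_conj\<bar> \<le> 2 * e"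
    using abs_triangle_ineq[of "(r - golden_conj) * s" "golden_conj * (s - silver_conj)"] by simp
  then have "\<bar>d3\<bar> \<le> (2 * e) * H"
    unfolding abs_mult d3_def by (rule mult_mono) (use abcd e0 in auto)
  moreover have "\<bar>d1\<bar> \<le> e * H" "\<bar>d2\<bar> \<le> e * H"
    unfolding abs_mult d1_def d2_def
    by (rule mult_mono[OF r(3) abcd(2) e0 abs_ge_zero], rule mult_mono[OF s(3) abcd(3) e0 abs_ge_zero])
  moreover have "\<bar>D\<bar> \<le> \<bar>Z\<bar> + (\<bar>d1\<bar> + (\<bar>d2\<bar> + \<bar>d3\<bar>))"
  proof -
    have "\<bar>D\<bar> = \<bar>Z - (d1 + (d2 + d3))\<bar>" using Z by simp
    also have "\<dots> \<le> \<bar>Z\<bar> + \<bar>d1 + (d2 + d3)\<bar>" by (rule abs_triangle_ineq4)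
    also have "\<bar>d1 + (d2 + d3)\<bar> \<le> \<bar>d1\<bar> + \<bar>d2 + d3\<bar>" by (rule abs_triangle_ineq)
    also have "\<bar>d2 + d3\<bar> \<le> \<bar>d2\<bar> + \<bar>d3\<bar>" by (rule abs_triangle_ineq)
    finally show ?thesis by simp
  qed
  ultimately have DZ: "\<bar>D\<bar> \<le> \<bar>Z\<bar> + 4 * (e * H)" by simp
  define E where "E = 1 / (432 * H ^ 3)"
  have "4 * (e * H) \<le> E / 2"
  proof -
    have "(81::real) ^ L = 3 ^ L * 27 ^ L" by (simp flip: power_mult_distrib)
    then have "(81::real) ^ L = H * H ^ 3" unfolding H3 by (simp add: H_def)
    moreover have H0: "H > 0" by (simp add: H_def)
    ultimately have "e * H \<le> 1 / (3456 * (H * H ^ 3)) * H" using e by (intro mult_right_mono) auto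
    also have "\<dots> = E / 8" using H0 by (simp add: E_def)
    finally show ?thesis by simp
  qed
  moreover have "2 * E \<le> \<bar>D\<bar>" using low by (simp add: E_def)
  moreover have "0 \<le> E" by (simp add: H_def E_def)
  ultimately have "E \<le> \<bar>Z\<bar>" using DZ by simp
  then show ?thesis unfolding E_def H3 Z_def .
qed

lemma inverse_sq_separation:
  fixes x y :: real
  assumes "1 \<le> x" "x \<le> B" "1 \<le> y" "y \<le> B"
  shows "2 * \<bar>x - y\<bar> / B ^ 3 \<le> \<bar>1 / x\<^sup>2 - 1 / y\<^sup>2\<bar>"
proof -
  have "1 / x\<^sup>2 - 1 / y\<^sup>2 = (y - x) * ((x + y) / (x\<^sup>2 * y\<^sup>2))"
    using assms by (simp add: field_simps power2_eq_square)
  then have "\<bar>1 / x\<^sup>2 - 1 / y\<^sup>2\<bar> = \<bar>x - y\<bar> * ((x + y) / (x\<^sup>2 * y\<^sup>2))"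
    using assms by (simp add: abs_mult abs_minus_commute)
  also have "(x + y) / (x\<^sup>2 * y\<^sup>2) = 1 / (x * y\<^sup>2) + 1 / (x\<^sup>2 * y)"
    using assms by (simp add: field_simps power2_eq_square)
  also have "\<bar>x - y\<bar> * \<dots> \<ge> \<bar>x - y\<bar> * (1 / B ^ 3 + 1 / B ^ 3)"
  proof (intro mult_left_mono add_mono divide_left_mono)
    have "x * (y * y) \<le> B * (B * B)" "x * x * y \<le> B * B * B" using assms by (intro mult_mono; simp)+
    then show "x * y\<^sup>2 \<le> B ^ 3" "x\<^sup>2 * y \<le> B ^ 3" by (simp_all add: power2_eq_square power3_eq_cube mult_ac)
  qed (use assms in auto)
  finally show ?thesis by (simp add: algebra_simps)
qed

text \<open>The ones before \<open>w\<close> and the twos after it bring the parameters \<open>r\<close>, \<open>s\<close> of \<open>cross_form r s w\<close>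
  exponentially close to \<open>golden_conj\<close> and \<open>silver_conj\<close>, and they make the dependence of \<open>n \<beta>\<close> on \<open>z\<close>
  linear in a variable that is independent of \<open>w\<close>.\<close>
lemma forced_block_aux:
  fixes n \<delta> \<eta> B :: real and u :: "nat list" and g h L e K R M :: nat
  defines "C \<equiv> rden (replicate h 2)"
  defines "u1 \<equiv> u @ replicate g 1"
  defines "T \<equiv> n / ((rden u1)\<^sup>2 * C\<^sup>2)"
  assumes u: "0 \<notin> set u" and M: "M \<ge> 1"
    and T: "13824 * 1458 ^ L \<le> T" "T \<le> B"
    and F: "1 / (rden (replicate g 1))\<^sup>2 \<le> 1 / (3456 * 81 ^ L)"
    and C: "1 / C\<^sup>2 \<le> 1 / (3456 * 81 ^ L)"
    and K: "K > 0" and R: "2 * real K * B \<le> real R"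
    and dense: "128 * (real K)\<^sup>2 \<le> 2 ^ L * (real M / (real M + 2)) ^ e"
    and small: "(1 - 2 * \<eta>\<^sup>2) ^ K < 1 / (4 * real K)" and \<eta>: "\<eta> \<ge> 0"
    and err: "B / C\<^sup>2 + B / 2 ^ (e - 1) + B / R \<le> \<eta>"
  shows "\<exists>w\<in>words 2 L. \<exists>z\<in>words M e. \<forall>t\<in>{0..1}.
    nearest_int_dist (n * cfval (u @ replicate g 1 @ w @ replicate h 2 @ z) t - \<delta>) \<le> 2 * \<eta>"
proof -
  define v where "v = replicate h (2::nat)"
  define r where "r = real_of_int (cden_prev u1) / cden u1"
  define s where "s = real_of_int (cnum v) / cden v"
  define X where "X = cross_form r s"
  define U where "U w = u1 @ w @ v" for w
  have u1: "0 \<notin> set u1" and v: "0 \<notin> set v" using u by (auto simp: u1_def v_def)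
  have B: "B > 0" using T by (smt (verit) zero_less_power)
  then have "2 * real K * B > 0" using K by simp
  then have R0: "R > 0" using R by (cases R) auto
  have Q1: "rden u1 \<ge> 1" using cf_bounds[OF u1] by simp
  have C1: "C \<ge> 1" using cf_bounds[OF v] by (simp add: C_def v_def)
  have r01: "0 \<le> r" "r \<le> 1" unfolding r_def by (rule cden_ratio_bounds[OF u1])+
  have rc: "\<bar>r - golden_conj\<bar> \<le> 1 / (3456 * 81 ^ L)"
    using cden_ratio_replicate_close[OF u golden_fixed, of g] golden_conj_props F
    unfolding r_def u1_def by auto
  have scf: "s = cfval v 0" using cfval_eq[OF v, of 0] by (simp add: s_def)
  have s01: "0 \<le> s" "s \<le> 1" unfolding scf by (rule cfval_bounds[OF v]; simp)+
  have sc: "\<bar>s - silver_conj\<bar> \<le> 1 / (3456 * 81 ^ L)"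
    using cfval_replicate_close[OF silver_fixed, of 0 h] silver_conj_props C
    unfolding scf v_def C_def by auto
  have X1: "1 \<le> X w" "X w \<le> 4 * 3 ^ L" if "w \<in> words 2 L" for w
    using cross_form_bounds[OF that r01 s01] by (auto simp: X_def)
  have U0: "0 \<notin> set (U w)" if "w \<in> words 2 L" for w
    using words_pos[OF that] u1 v by (auto simp: U_def)
  have QU: "rden (U w) = cden u1 * C * X w" for w
    unfolding U_def X_def r_def s_def C_def v_def by (rule cden_append3[OF u1 v[unfolded v_def]])
  \<comment> \<open>All w have length L, so the sign in the slope is common to them and does not
    affect the separation.\<close>
  define sg :: real where "sg = (-1) ^ (length u1 + L + h)"
  have sg: "\<bar>sg\<bar> = 1" by (simp add: sg_def)
  define b where "b w = sg * (T / (X w)\<^sup>2)" for w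
  define a where "a w = n * cnum (U w) / cden (U w) - \<delta>" for w
  have T0: "T > 0" using T by (smt (verit) zero_less_power)
  have bB: "\<bar>b w\<bar> \<le> B" "0 \<le> T / (X w)\<^sup>2" "T / (X w)\<^sup>2 \<le> B" if "w \<in> words 2 L" for w
  proof -
    have "1 \<le> (X w)\<^sup>2" using X1[OF that] by simp
    then have "T / (X w)\<^sup>2 \<le> T / 1" using T0 by (intro divide_left_mono) auto
    then show "T / (X w)\<^sup>2 \<le> B" "0 \<le> T / (X w)\<^sup>2" using T T0 by auto
    then show "\<bar>b w\<bar> \<le> B" by (simp add: b_def abs_mult sg)
  qed
  have sep: "real (card (words 2 L)) \<le> \<bar>b w - b w'\<bar> \<and> real K * \<bar>b w - b w'\<bar> \<le> R / 2"
    if w: "w \<in> words 2 L" and w': "w' \<in> words 2 L" and ne: "w \<noteq> w'" for w w'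
  proof
    have beq: "\<bar>b w - b w'\<bar> = T * \<bar>1 / (X w)\<^sup>2 - 1 / (X w')\<^sup>2\<bar>"
    proof -
      have "b w - b w' = sg * (T * (1 / (X w)\<^sup>2 - 1 / (X w')\<^sup>2))" by (simp add: b_def algebra_simps)
      then show ?thesis using T0 by (simp add: abs_mult sg)
    qed
    have "1 / (432 * 27 ^ L) \<le> \<bar>X w - X w'\<bar>"
      unfolding X_def by (rule cross_form_separation[OF w w' ne r01 rc s01 sc order.refl])
    then have "2 * (1 / (432 * 27 ^ L)) / (4 * 3 ^ L) ^ 3 \<le> 2 * \<bar>X w - X w'\<bar> / (4 * 3 ^ L) ^ 3"
      by (intro divide_right_mono mult_left_mono) auto
    also have "\<dots> \<le> \<bar>1 / (X w)\<^sup>2 - 1 / (X w')\<^sup>2\<bar>"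
      by (rule inverse_sq_separation) (use X1 w w' in auto)
    finally have 1: "2 * (1 / (432 * 27 ^ L)) / (4 * 3 ^ L) ^ 3 \<le> \<bar>1 / (X w)\<^sup>2 - 1 / (X w')\<^sup>2\<bar>" .
    \<comment> \<open>Passing to inverse squares of numbers up to 4 * 3 ^ L leaves a separation of 1
      / (13824 * 729 ^ L). Since 1458 = 2 * 729, the lower bound on T raises it to 2 ^ L, the number
      of words.\<close>
    have "((3::real) ^ L) ^ 3 = 27 ^ L" by (simp add: power3_eq_cube flip: power_mult_distrib)
    then have "2 * (1 / (432 * 27 ^ L)) / (4 * 3 ^ L) ^ 3 = (1::real) / (13824 * (27 ^ L * 27 ^ L))"
      by (simp add: power_mult_distrib)
    also have "\<dots> = 1 / (13824 * 729 ^ L)" by (simp flip: power_mult_distrib)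
    finally have 2: "2 * (1 / (432 * 27 ^ L)) / (4 * 3 ^ L) ^ 3 = (1::real) / (13824 * 729 ^ L)" .
    have "real (card (words 2 L)) = 2 ^ L" by (simp add: card_words)
    also have "\<dots> = (13824 * 1458 ^ L) * (1 / (13824 * 729 ^ L))"
    proof -
      have "(1458::real) ^ L = 2 ^ L * 729 ^ L" by (simp flip: power_mult_distrib)
      then show ?thesis by simp
    qed
    also have "\<dots> \<le> T * \<bar>1 / (X w)\<^sup>2 - 1 / (X w')\<^sup>2\<bar>"
      using T(1) 1 unfolding 2 by (intro mult_mono) (use T0 in auto)
    finally show "real (card (words 2 L)) \<le> \<bar>b w - b w'\<bar>" unfolding beq .
    have "b w - b w' = sg * (T / (X w)\<^sup>2 - T / (X w')\<^sup>2)" by (simp add: b_def algebra_simps)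
    then have "\<bar>b w - b w'\<bar> = \<bar>T / (X w)\<^sup>2 - T / (X w')\<^sup>2\<bar>" by (simp add: abs_mult sg)
    also have "\<dots> \<le> B" using bB[OF w] bB[OF w'] by linarith
    finally have "real K * \<bar>b w - b w'\<bar> \<le> real K * B" by (intro mult_left_mono) auto
    then show "real K * \<bar>b w - b w'\<bar> \<le> R / 2" using R by linarith
  qed
  \<comment> \<open>\<open>silver_conj\<close> stands for the true ratio of the last denominators of
    \<open>U w\<close>, so that the same grid set serves all w.\<close>
  define Y where "Y = grid_cells M e R silver_conj"
  have Y: "Y \<subseteq> {..<R}" "real R / 4 * (real M / (real M + 2)) ^ e \<le> card Y"
    unfolding Y_def by (rule grid_cells; use silver_conj_props R0 in simp)+
  have "32 * (real K)\<^sup>2 * R = real R / 4 * (128 * (real K)\<^sup>2)" by simp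
  also have "\<dots> \<le> real R / 4 * (2 ^ L * (real M / (real M + 2)) ^ e)"
    using dense by (intro mult_left_mono) auto
  also have "\<dots> = 2 ^ L * (real R / 4 * (real M / (real M + 2)) ^ e)" by simp
  also have "\<dots> \<le> 2 ^ L * real (card Y)" using Y(2) by (intro mult_left_mono) auto
  finally have dense': "32 * (real K)\<^sup>2 * R \<le> real (card (words 2 L) * card Y)" by (simp add: card_words)
  have "replicate L 1 \<in> words 2 L" by (auto simp: words_def)
  then have "\<exists>w\<in>words 2 L. \<exists>j\<in>Y. nearest_int_dist (a w + b w * (real j / R)) \<le> \<eta>"
    by (intro grid_hit[OF finite_words _ Y(1) K \<eta> sep dense' R0 small]) auto
  then obtain w j where w: "w \<in> words 2 L" and j: "j \<in> Y"
    and hit: "nearest_int_dist (a w + b w * (real j / R)) \<le> \<eta>" by blast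
  define y where "y x = x / (1 + silver_conj * x)" for x
  obtain z t0 where z: "z \<in> words M e" and t0: "0 < t0" "t0 < 1"
    and jeq: "j = nat \<lfloor>real R * y (cfval z t0)\<rfloor>"
    using j unfolding Y_def grid_cells_def y_def by auto
  note z0 = words_pos[OF z]
  have y_lip: "\<bar>y x - y x'\<bar> \<le> \<bar>x - x'\<bar>" if "0 \<le> x" "0 \<le> x'" for x x'
  proof -
    have p: "1 \<le> 1 + silver_conj * x" "1 \<le> 1 + silver_conj * x'" using that silver_conj_props by auto
    then have "y x - y x' = (x - x') / ((1 + silver_conj * x) * (1 + silver_conj * x'))"
      unfolding y_def by (simp add: divide_simps) (simp add: algebra_simps)
    then have "\<bar>y x - y x'\<bar> = \<bar>x - x'\<bar> / ((1 + silver_conj * x) * (1 + silver_conj * x'))"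
      using p by (simp add: abs_mult)
    also have "\<dots> \<le> \<bar>x - x'\<bar> / 1" using p mult_mono[of 1 "1 + silver_conj * x" 1 "1 + silver_conj * x'"]
      by (intro divide_left_mono) auto
    finally show ?thesis by simp
  qed
  define q where "q = real_of_int (cden_prev (U w)) / cden (U w)"
  have q01: "0 \<le> q" unfolding q_def by (rule cden_ratio_bounds[OF U0[OF w]])
  have "0 \<notin> set (u1 @ w)" using u1 words_pos[OF w] by auto
  from cden_ratio_replicate_close[OF this silver_fixed, of h]
  have qs: "\<bar>q - silver_conj\<bar> \<le> 1 / C\<^sup>2"
    using silver_conj_props unfolding q_def U_def v_def C_def by auto
  show ?thesis
  proof (intro bexI[OF _ w] bexI[OF _ z] ballI)
    fix t :: real assume t: "t \<in> {0..1}"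
    define x where "x = cfval z t"
    have x: "0 \<le> x" "x \<le> 1" using cfval_bounds[OF z0] t by (auto simp: x_def)
    have x0: "0 \<le> cfval z t0" "cfval z t0 \<le> 1" using cfval_bounds[OF z0] t0 by auto
    have sgl: "(-1) ^ length (U w) * (n / (rden (U w))\<^sup>2) = b w"
    proof -
      have "length (U w) = length u1 + L + h" using w by (simp add: U_def v_def words_def)
      then show ?thesis unfolding b_def sg_def QU T_def by (simp add: power_mult_distrib)
    qed
    have eq: "n * cfval (u @ replicate g 1 @ w @ replicate h 2 @ z) t - \<delta> = a w + b w * (x / (1 + q * x))"
      using cfval_word_linear[OF U0[OF w] x(1), of n] unfolding sgl q_def[symmetric]
      by (simp add: a_def x_def U_def u1_def v_def cfval_append)
    \<comment> \<open>Three replacements lead from the true variable to the grid point: the ratio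
      \<open>q\<close> by \<open>silver_conj\<close> (e1), the tail t by the t0 that produced j
      (e2), the value by its cell (e3). Slopes are at most B, so \<open>err\<close> absorbs all of
      them.\<close>
    have e1: "\<bar>x / (1 + q * x) - y x\<bar> \<le> 1 / C\<^sup>2"
    proof -
      have p: "1 \<le> 1 + silver_conj * x" "1 \<le> 1 + q * x" using x q01 silver_conj_props by auto
      then have "x / (1 + q * x) - y x = (silver_conj - q) * (x * x) / ((1 + q * x) * (1 + silver_conj * x))"
        unfolding y_def by (simp add: divide_simps) (simp add: algebra_simps)
      then have "\<bar>x / (1 + q * x) - y x\<bar> = \<bar>silver_conj - q\<bar> * (x * x) / ((1 + q * x) * (1 + silver_conj * x))"
        using p x by (simp add: abs_mult)
      also have "\<dots> \<le> \<bar>silver_conj - q\<bar> * (x * x) / 1"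
        using p x mult_mono[of 1 "1 + q * x" 1 "1 + silver_conj * x"]
        by (intro divide_left_mono) auto
      also have "\<dots> \<le> \<bar>silver_conj - q\<bar>" using x mult_le_one[of x x] by (simp add: mult_left_le)
      finally show ?thesis using qs by (simp add: abs_minus_commute)
    qed
    have e2: "\<bar>y x - y (cfval z t0)\<bar> \<le> 1 / 2 ^ (e - 1)"
    proof -
      have "\<bar>y x - y (cfval z t0)\<bar> \<le> \<bar>x - cfval z t0\<bar>" by (rule y_lip[OF x(1) x0(1)])
      also have "\<dots> \<le> \<bar>t - t0\<bar> / (rden z)\<^sup>2"
        unfolding x_def using t t0 by (intro abs_cfval_diff_le[OF z0]) auto
      also have "\<dots> \<le> 1 / 2 ^ (e - 1)"
        using t t0 cden_sq_ge_pow2[OF z0] z by (intro frac_le) (auto simp: words_def)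
      finally show ?thesis .
    qed
    have e3: "\<bar>y (cfval z t0) - real j / R\<bar> \<le> 1 / R"
    proof -
      have "0 \<le> y (cfval z t0)" using x0 silver_conj_props by (simp add: y_def)
      then have "real j \<le> real R * y (cfval z t0)" "real R * y (cfval z t0) \<le> real j + 1"
        unfolding jeq by (auto simp: of_nat_nat)
      then have "\<bar>real R * y (cfval z t0) - real j\<bar> \<le> 1" by linarith
      moreover have "y (cfval z t0) - real j / R = (real R * y (cfval z t0) - real j) / R"
        using R0 by (simp add: field_simps)
      ultimately show ?thesis using R0 by (simp add: divide_right_mono)
    qed
    have "\<bar>x / (1 + q * x) - real j / R\<bar> \<le> 1 / C\<^sup>2 + 1 / 2 ^ (e - 1) + 1 / R" using e1 e2 e3 by linarith
    then have "\<bar>b w * (x / (1 + q * x) - real j / R)\<bar> \<le> B * (1 / C\<^sup>2 + 1 / 2 ^ (e - 1) + 1 / R)"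
      unfolding abs_mult using bB(1)[OF w] B by (intro mult_mono) auto
    also have "\<dots> \<le> \<eta>" using err by (simp add: algebra_simps)
    finally have small_err: "\<bar>b w * (x / (1 + q * x) - real j / R)\<bar> \<le> \<eta>" .
    have "a w + b w * (x / (1 + q * x)) = (a w + b w * (real j / R)) + b w * (x / (1 + q * x) - real j / R)"
      by (simp add: algebra_simps)
    then have "nearest_int_dist (a w + b w * (x / (1 + q * x))) \<le>
        nearest_int_dist (a w + b w * (real j / R)) + \<bar>b w * (x / (1 + q * x) - real j / R)\<bar>"
      using nearest_int_dist_triangle by metis
    then show "nearest_int_dist (n * cfval (u @ replicate g 1 @ w @ replicate h 2 @ z) t - \<delta>) \<le> 2 * \<eta>"
      unfolding eq using hit small_err by linarith
  qed
qed

text \<open>The 824 is 200 (ones) + 24 (length of \<open>w\<close>) + 300 (twos) + 300 (length of \<open>z\<close>), a generous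
  choice for which the inequalities in \<open>forced_block_aux\<close> hold with room to spare.\<close>
definition block_length :: "nat \<Rightarrow> nat" where
  "block_length m = 824 * m"

text \<open>The largest admissible n / (cden u)^2. Appending the ones multiplies the denominator of
  u by their own up to a factor 2, which gives the 4 after squaring; (M + 1)^2 is the precision with
  which a prefix reaches a prescribed scale. With both in reserve, the T of
  \<open>forced_block_aux\<close> never falls below its required lower bound for L = 24 m.\<close>

definition block_scale :: "nat \<Rightarrow> nat \<Rightarrow> real" where
  "block_scale M m = 13824 * 1458 ^ (24 * m) * 4 * (real M + 1)\<^sup>2 *
    (rden (replicate (200 * m) 1))\<^sup>2 * (rden (replicate (300 * m) 2))\<^sup>2"

lemma block_scale_pos: "block_scale M m > 0"
proof -
  have "rden (replicate (200 * m) 1) \<ge> 1" "rden (replicate (300 * m) 2) \<ge> 1"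
    using cf_bounds(1)[of "replicate (200 * m) 1"] cf_bounds(1)[of "replicate (300 * m) 2"] by auto
  then show ?thesis unfolding block_scale_def by (intro mult_pos_pos zero_less_power) auto
qed

text \<open>With y = 2 ^ m and K = y^3 the left side is at most exp (- 2 y). The cube is chosen so
  that K / y^2 still tends to infinity while K remains polynomial in y.\<close>

lemma exp_small:
  assumes "m \<ge> 7"
  shows "(1 - 2 * (1 / 2 ^ m)\<^sup>2) ^ (2 ^ (3 * m)) < 1 / (4 * 2 ^ (3 * m) :: real)"
proof -
  define y :: real where "y = 2 ^ m"
  have y: "y \<ge> 128" using power_increasing[OF assms, of "2::real"] by (simp add: y_def)
  have y3: "(2::real) ^ (3 * m) = y ^ 3" by (simp add: y_def mult.commute flip: power_mult)
  have "0 \<le> 1 - 2 * (1 / y)\<^sup>2"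
  proof -
    have "(1 / y)\<^sup>2 \<le> (1/128)\<^sup>2" using y by (intro power_mono) (auto simp: field_simps)
    then show ?thesis by (simp add: power2_eq_square)
  qed
  moreover have "1 - 2 * (1 / y)\<^sup>2 \<le> exp (- (2 * (1 / y)\<^sup>2))"
    using exp_ge_add_one_self[of "- (2 * (1 / y)\<^sup>2)"] by simp
  ultimately have "(1 - 2 * (1 / y)\<^sup>2) ^ (2 ^ (3 * m)) \<le> exp (- (2 * (1 / y)\<^sup>2)) ^ (2 ^ (3 * m))"
    by (intro power_mono)
  also have "\<dots> = exp (real (2 ^ (3 * m)) * - (2 * (1 / y)\<^sup>2))" by (rule exp_of_nat_mult[symmetric])
  also have "\<dots> = exp (- (2 * y))"
  proof -
    have "real (2 ^ (3 * m)) = y ^ 3" using y3 by simp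
    then have "real (2 ^ (3 * m)) * - (2 * (1 / y)\<^sup>2) = - (2 * y)"
      using y by (simp add: power2_eq_square power3_eq_cube)
    then show ?thesis by (simp only:)
  qed
  also have "\<dots> < 1 / (4 * y ^ 3)"
  proof -
    have "y / 2 \<le> exp (y / 2)" using exp_ge_add_one_self[of "y / 2"] by linarith
    then have "(y / 2) ^ 4 \<le> exp (y / 2) ^ 4" using y by (intro power_mono) auto
    also have "\<dots> = exp (2 * y)" by (simp add: exp_of_nat_mult[symmetric])
    finally have "y ^ 4 / 16 \<le> exp (2 * y)" by (simp add: power_divide)
    moreover have "4 * y ^ 3 < y ^ 4 / 16"
    proof -
      have "64 * y ^ 3 < y * y ^ 3" using y by (intro mult_strict_right_mono) auto
      then show ?thesis by (simp add: eval_nat_numeral)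
    qed
    ultimately have "4 * y ^ 3 < exp (2 * y)" by linarith
    then have "1 / exp (2 * y) < 1 / (4 * y ^ 3)"
      using y by (intro divide_strict_left_mono mult_pos_pos) auto
    then show ?thesis by (simp add: exp_minus inverse_eq_divide)
  qed
  finally show ?thesis unfolding y3 by (simp add: y_def)
qed

lemma cden_replicate_sq_ge:
  assumes "a \<ge> 1"
  shows "2 ^ (k - 1) \<le> (rden (replicate k a))\<^sup>2"
  using cden_sq_ge_pow2[of "replicate k a"] assms by simp

text \<open>The parameters are L = 24 m, K = 2 ^ (3 m), R = 2 K B and \<eta> = 1 / 2 ^ m. The window
  for n / (cden u)^2 is a factor (M + 1)^2 wide, because a prefix cannot be steered more finely by
  whole digits.\<close>

theorem forced_block:
  fixes n \<delta> :: real
  assumes M: "M \<ge> 1200" and m: "m \<ge> 7" and Mm: "(real M + 1)\<^sup>2 \<le> 2 ^ m" and u: "0 \<notin> set u"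
    and n: "block_scale M m / (real M + 1)\<^sup>2 \<le> n / (rden u)\<^sup>2"
      "n / (rden u)\<^sup>2 \<le> block_scale M m"
  shows "\<exists>b\<in>words M (block_length m). \<forall>t\<in>{0..1}.
    nearest_int_dist (n * cfval (u @ b) t - \<delta>) \<le> 2 / 2 ^ m"
proof -
  define F C where "F = rden (replicate (200 * m) 1)"
    and "C = rden (replicate (300 * m) 2)"
  define N B :: real where "N = 13824 * 1458 ^ (24 * m)" and "B = N * 4 * (real M + 1)\<^sup>2"
  define u1 where "u1 = u @ replicate (200 * m) 1"
  define T where "T = n / ((rden u1)\<^sup>2 * C\<^sup>2)"
  define q where "q = rden u"
  have FC: "1 \<le> F" "1 \<le> C" using cf_bounds(1)[of "replicate (200 * m) 1"] cf_bounds(1)[of "replicate (300 * m) 2"]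
    by (auto simp: F_def C_def)
  have FC2: "2 ^ (200 * m - 1) \<le> F\<^sup>2" "2 ^ (300 * m - 1) \<le> C\<^sup>2"
    unfolding F_def C_def by (rule cden_replicate_sq_ge; simp)+
  have scale: "block_scale M m = B * F\<^sup>2 * C\<^sup>2"
    by (simp add: block_scale_def B_def N_def F_def C_def)
  have q: "q \<ge> 1" using cf_bounds(1)[OF u] by (simp add: q_def)
  have "real_of_int (cden u * cden (replicate (200 * m) 1)) \<le> cden u1"
    "rden u1 \<le> real_of_int (2 * cden u * cden (replicate (200 * m) 1))"
    unfolding of_int_le_iff u1_def by (rule cden_append_ge[OF u] cden_append_le[OF u]; simp)+
  then have u1: "q * F \<le> cden u1" "cden u1 \<le> 2 * q * F"
    by (simp_all add: q_def F_def)
  have "1 * 1 \<le> q * F" using q FC by (intro mult_mono) auto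
  then have u10: "0 < cden u1" using u1 by linarith
  have N0: "N > 0" by (simp add: N_def)
  have B0: "B > 0" using N0 by (simp add: B_def)
  have n0: "n > 0"
  proof -
    have "0 < block_scale M m / (real M + 1)\<^sup>2" using block_scale_pos[of M m]
      by (intro divide_pos_pos zero_less_power) auto
    then have "0 < n / q\<^sup>2" using n(1) unfolding q_def by linarith
    then show ?thesis using q by (simp add: zero_less_divide_iff)
  qed
  have sq: "(q * F)\<^sup>2 \<le> (rden u1)\<^sup>2" "(rden u1)\<^sup>2 \<le> (2 * q * F)\<^sup>2"
    using u1 q FC by (intro power_mono; simp)+
  have TB: "T \<le> B"
  proof -
    have "T \<le> n / ((q * F)\<^sup>2 * C\<^sup>2)" unfolding T_def
      using sq n0 q FC u10 by (intro divide_left_mono mult_right_mono mult_pos_pos) auto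
    also have "\<dots> = (n / q\<^sup>2) / (F\<^sup>2 * C\<^sup>2)" by (simp add: power_mult_distrib)
    also have "\<dots> \<le> block_scale M m / (F\<^sup>2 * C\<^sup>2)"
      using n(2) by (intro divide_right_mono) (auto simp: q_def)
    also have "\<dots> = B" using FC by (simp add: scale)
    finally show ?thesis .
  qed
  have NT: "N \<le> T"
  proof -
    have "N = (block_scale M m / (real M + 1)\<^sup>2) / (4 * F\<^sup>2 * C\<^sup>2)"
      using FC by (simp add: scale B_def field_simps)
    also have "\<dots> \<le> (n / q\<^sup>2) / (4 * F\<^sup>2 * C\<^sup>2)"
      using n(1) by (intro divide_right_mono) (auto simp: q_def)
    also have "\<dots> = n / ((2 * q * F)\<^sup>2 * C\<^sup>2)" by (simp add: power_mult_distrib mult_ac)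
    also have "\<dots> \<le> T" unfolding T_def
      using sq n0 q FC u10 by (intro divide_left_mono mult_right_mono mult_pos_pos) (auto intro!: zero_less_power)
    finally show ?thesis .
  qed
  \<comment> \<open>Since 81 < 2 ^ 7 and 7 * 24 = 168, the runs of 200 m ones and 300 m twos are
    both long enough for the tolerance of \<open>cross_form_separation\<close>.\<close>
  have pow: "(3456::real) * 81 ^ (24 * m) \<le> 2 ^ (12 + 168 * m)"
  proof -
    have "(81::real) ^ (24 * m) \<le> (2 ^ 7) ^ (24 * m)" by (intro power_mono) auto
    also have "\<dots> = 2 ^ (168 * m)" unfolding power_mult[symmetric] by simp
    finally have "3456 * (81::real) ^ (24 * m) \<le> 2 ^ 12 * 2 ^ (168 * m)" by (intro mult_mono) auto
    then show ?thesis by (simp add: power_add)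
  qed
  have BB: "B \<le> 2 ^ (16 + 265 * m)"
  proof -
    have "(1458::real) ^ (24 * m) \<le> (2 ^ 11) ^ (24 * m)" by (intro power_mono) auto
    also have "\<dots> = 2 ^ (264 * m)" unfolding power_mult[symmetric] by simp
    finally have "B \<le> (2 ^ 14 * 2 ^ (264 * m)) * 2 ^ 2 * 2 ^ m"
      unfolding B_def N_def using Mm by (intro mult_mono) auto
    also have "\<dots> = 2 ^ (14 + 264 * m + 2 + m)" by (simp only: power_add)
    also have "14 + 264 * m + 2 + m = 16 + 265 * m" by simp
    finally show ?thesis .
  qed
  \<comment> \<open>B is at most 2 ^ (16 + 265 m), so 300 m digits reduce it to a quarter of \<eta>.
    This is used for the twos and for z; the grid error \<open>B3\<close> takes a third
    quarter.\<close>
  have Bdiv: "B / x \<le> 1 / 2 ^ m / 4" if x: "2 ^ (300 * m - 1) \<le> x" for x :: real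
  proof -
    have "B * (2 ^ m * 4) \<le> 2 ^ (16 + 265 * m) * (2 ^ m * 2 ^ 2)" using BB by (intro mult_mono) auto
    also have "\<dots> = 2 ^ (16 + 265 * m + (m + 2))" by (simp only: power_add)
    also have "\<dots> \<le> 2 ^ (300 * m - 1)" using m by (intro power_increasing) auto
    finally have "B * (2 ^ m * 4) \<le> x" using x by linarith
    moreover have "x > 0" using x by (smt (verit) zero_less_power)
    ultimately show ?thesis by (simp add: field_simps)
  qed
  \<comment> \<open>R is 2 K B as an integer, so that K times a difference of slopes, which is at
    most K B, stays within R / 2.\<close>
  define K R :: nat where "K = 2 ^ (3 * m)" and "R = 2 * 2 ^ (3 * m) * (13824 * 1458 ^ (24 * m) * 4 * (M + 1)\<^sup>2)"
  have R: "real R = 2 * real K * B" by (simp add: R_def K_def B_def N_def)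
  have B3: "B / R \<le> 1 / 2 ^ m / 4"
  proof -
    have "B / R = 1 / (2 * 2 ^ (3 * m))" using B0 unfolding R K_def by simp
    also have "\<dots> \<le> 1 / (2 ^ m * 4)"
    proof (intro divide_left_mono)
      have "(2::real) ^ (m + 2) \<le> 2 ^ (3 * m + 1)" using m by (intro power_increasing) auto
      then show "(2::real) ^ m * 4 \<le> 2 * 2 ^ (3 * m)" by simp
    qed auto
    finally show ?thesis by simp
  qed
  have "\<exists>w\<in>words 2 (24 * m). \<exists>z\<in>words M (300 * m). \<forall>t\<in>{0..1}.
    nearest_int_dist (n * cfval (u @ replicate (200 * m) 1 @ w @ replicate (300 * m) 2 @ z) t - \<delta>) \<le> 2 * (1 / 2 ^ m)"
  proof (rule forced_block_aux[where B = B and K = K and R = R])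
    show "0 \<notin> set u" by (rule u)
    show "13824 * 1458 ^ (24 * m) \<le> n / ((rden (u @ replicate (200 * m) 1))\<^sup>2 *
        (rden (replicate (300 * m) 2))\<^sup>2)"
      using NT by (simp add: N_def T_def u1_def C_def)
    show "n / ((rden (u @ replicate (200 * m) 1))\<^sup>2 *
        (rden (replicate (300 * m) 2))\<^sup>2) \<le> B"
      using TB by (simp add: T_def u1_def C_def)
    have "2 ^ (12 + 168 * m) \<le> (2::real) ^ (200 * m - 1)" using m by (intro power_increasing) auto
    then have "3456 * 81 ^ (24 * m) \<le> F\<^sup>2" using FC2 pow by linarith
    then show "1 / (rden (replicate (200 * m) 1))\<^sup>2 \<le> 1 / (3456 * 81 ^ (24 * m))"
      unfolding F_def[symmetric] using FC by (intro divide_left_mono mult_pos_pos) auto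
    have "2 ^ (12 + 168 * m) \<le> (2::real) ^ (300 * m - 1)" using m by (intro power_increasing) auto
    then have "3456 * 81 ^ (24 * m) \<le> C\<^sup>2" using FC2 pow by linarith
    then show "1 / (rden (replicate (300 * m) 2))\<^sup>2 \<le> 1 / (3456 * 81 ^ (24 * m))"
      unfolding C_def[symmetric] using FC by (intro divide_left_mono mult_pos_pos) auto
    show "128 * (real K)\<^sup>2 \<le> 2 ^ (24 * m) * (real M / (real M + 2)) ^ (300 * m)"
    proof -
      \<comment> \<open>The origin of M >= 1200: over 300 digits the restriction to {1..M} then
        loses at most half of the length, hence at most 2 ^ m over all of z, which the 2 ^ (24 m)
        words w outweigh.\<close>
      have "1 / 2 \<le> 1 + real 300 * (- (2 / (real M + 2)))" using M by (simp add: field_simps)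
      also have "\<dots> \<le> (1 + - (2 / (real M + 2))) ^ 300" using M by (intro Bernoulli_inequality) (simp add: field_simps)
      also have "1 + - (2 / (real M + 2)) = real M / (real M + 2)" by (simp add: field_simps)
      finally have "(1/2) ^ m \<le> ((real M / (real M + 2)) ^ 300) ^ m" by (intro power_mono) auto
      then have "(1/2) ^ m \<le> (real M / (real M + 2)) ^ (300 * m)" by (simp add: power_mult)
      then have "2 ^ (24 * m) * (1/2) ^ m \<le> 2 ^ (24 * m) * (real M / (real M + 2)) ^ (300 * m)"
        by (intro mult_left_mono) auto
      moreover have "2 ^ (24 * m) * (1/2) ^ m = (2::real) ^ (23 * m)"
      proof -
        have "(2::real) ^ (24 * m) = 2 ^ (23 * m) * 2 ^ m" by (simp flip: power_add)
        then show ?thesis by (simp add: power_one_over)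
      qed
      moreover have "128 * (real K)\<^sup>2 = 2 ^ (7 + 6 * m)"
      proof -
        have "(real K)\<^sup>2 = 2 ^ (6 * m)" by (simp add: K_def flip: power_mult)
        then show ?thesis by (simp add: power_add)
      qed
      moreover have "2 ^ (7 + 6 * m) \<le> (2::real) ^ (23 * m)" using m by (intro power_increasing) auto
      ultimately show ?thesis by linarith
    qed
    show "(1 - 2 * (1 / 2 ^ m)\<^sup>2) ^ K < 1 / (4 * real K)"
      using exp_small[OF m] by (simp add: K_def)
    show "B / (rden (replicate (300 * m) 2))\<^sup>2 + B / 2 ^ (300 * m - 1) + B / real R \<le> 1 / 2 ^ m"
    proof -
      define h :: real where "h = 1 / 2 ^ m"
      have "0 \<le> h" by (simp add: h_def)
      then show ?thesis
        using Bdiv[OF FC2(2)] Bdiv[OF order.refl] B3 unfolding C_def h_def[symmetric] by linarith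
    qed
  qed (use M R in \<open>auto simp: K_def\<close>)
  then obtain w z where w: "w \<in> words 2 (24 * m)" and z: "z \<in> words M (300 * m)"
    and hit: "\<forall>t\<in>{0..1}. nearest_int_dist (n * cfval (u @ replicate (200 * m) 1 @ w @ replicate (300 * m) 2 @ z) t - \<delta>) \<le> 2 * (1 / 2 ^ m)"
    by blast
  have "replicate (200 * m) 1 @ w @ replicate (300 * m) 2 @ z \<in> words M (block_length m)"
    using w z M by (auto simp: words_def block_length_def)
  then show ?thesis using hit by (intro bexI) auto
qed

section \<open>Forcing all targets\<close>

text \<open>Numbers in \<open>K_set\<close> may have huge partial quotients, so a window in which \<open>ln q\<^sub>k\<close> grows at its
  average rate has to be selected.\<close>
lemma slow_growth_interval:
  fixes f :: "nat \<Rightarrow> real"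
  assumes f0: "\<And>k. 0 \<le> f k" and fC: "\<And>k. f k \<le> C * real k" and h: "1 \<le> h" "h \<le> k0" and C: "C \<ge> 0"
  obtains k where "k0 \<le> k" "k + h \<le> 2 * k0" "f (k + h) - f k \<le> 4 * C * real h"
proof -
  define J where "J = k0 div h"
  have J1: "J \<ge> 1" using h by (simp add: J_def Suc_le_eq div_greater_zero_iff)
  have Jh: "J * h \<le> k0" by (simp add: J_def)
  have "k0 = J * h + k0 mod h" by (simp add: J_def)
  moreover have "k0 mod h < h" using h by simp
  moreover have "1 * h \<le> J * h" using J1 by (intro mult_right_mono) auto
  ultimately have J2: "k0 < 2 * (J * h)" by linarith
  \<comment> \<open>J consecutive steps of length h cover more than k0 / 2. If f grew by more than 4
    C h in each, it would exceed 2 C k0 at k0 + J h <= 2 k0, against the linear bound.\<close>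
  have "\<exists>j<J. f (k0 + j * h + h) - f (k0 + j * h) \<le> 4 * C * real h"
  proof (rule ccontr)
    assume *: "\<not> ?thesis"
    have lower: "real j * (4 * C * real h) \<le> f (k0 + j * h)" if "j \<le> J" for j
      using that
    proof (induction j)
      case (Suc j)
      have "f (k0 + j * h + h) - f (k0 + j * h) > 4 * C * real h" using * Suc.prems by (simp add: not_le)
      moreover have "k0 + Suc j * h = k0 + j * h + h" by simp
      ultimately show ?case using Suc by (simp add: algebra_simps)
    qed (use f0 in simp)
    obtain J' where J': "J = Suc J'" using J1 by (cases J) auto
    have "real J' * (4 * C * real h) \<le> f (k0 + J' * h)" using lower[of J'] J' by simp
    moreover have "f (k0 + J' * h + h) - f (k0 + J' * h) > 4 * C * real h"
      using * J' by (simp add: not_le)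
    moreover have "k0 + J' * h + h = k0 + J * h" using J' by simp
    moreover have "real J' * (4 * C * real h) + 4 * C * real h = real J * (4 * C * real h)"
      using J' by (simp add: algebra_simps)
    ultimately have "f (k0 + J * h) > real J * (4 * C * real h)" by simp
    also have "real J * (4 * C * real h) = 2 * C * real (2 * (J * h))" by simp
    finally have "2 * C * real (2 * (J * h)) < f (k0 + J * h)" .
    moreover have "real k0 \<le> real (2 * (J * h))" using J2 unfolding of_nat_le_iff by linarith
    then have "2 * C * real k0 \<le> 2 * C * real (2 * (J * h))" using C by (intro mult_left_mono) auto
    ultimately have "2 * C * real k0 < f (k0 + J * h)" by linarith
    moreover have "f (k0 + J * h) \<le> C * real (k0 + J * h)" by (rule fC)
    moreover have "real (k0 + J * h) \<le> real (2 * k0)" using Jh unfolding of_nat_le_iff by linarith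
    then have "C * real (k0 + J * h) \<le> C * real (2 * k0)" using C by (intro mult_left_mono) auto
    ultimately show False by simp
  qed
  then obtain j where j: "j < J" "f (k0 + j * h + h) - f (k0 + j * h) \<le> 4 * C * real h" by blast
  have "Suc j * h \<le> J * h" using j(1) by (intro mult_right_mono) auto
  then have "k0 + j * h + h \<le> 2 * k0" using Jh by simp
  then show ?thesis using j by (intro that[of "k0 + j * h"]) auto
qed

text \<open>Ones are appended until the threshold is first reached; the last one multiplies the
  squared denominator by at most (M + 1)^2.\<close>

lemma reach_scale:
  assumes u: "0 \<notin> set u" and \<theta>: "(rden u)\<^sup>2 < \<theta>" and M: "M \<ge> 1"
  obtains c where "\<theta> \<le> (rden (u @ replicate c 1))\<^sup>2"
    "(rden (u @ replicate c 1))\<^sup>2 < \<theta> * (real M + 1)\<^sup>2"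
proof -
  define g where "g c = (rden (u @ replicate c 1))\<^sup>2" for c
  have pos: "0 \<notin> set (u @ replicate c 1)" for c using u by auto
  have ex: "\<exists>c. \<theta> \<le> g c"
  proof -
    obtain k where k: "\<theta> < 2 ^ k" using real_arch_pow[of 2 \<theta>] by auto
    have "2 ^ k \<le> (2::real) ^ (length (u @ replicate (Suc k) 1) - 1)" by (intro power_increasing) auto
    also have "\<dots> \<le> g (Suc k)" unfolding g_def by (rule cden_sq_ge_pow2[OF pos])
    finally show ?thesis using k by (intro exI[of _ "Suc k"]) linarith
  qed
  define c where "c = (LEAST c. \<theta> \<le> g c)"
  have c: "\<theta> \<le> g c" unfolding c_def using ex by (rule LeastI_ex)
  have "c \<noteq> 0"
  proof
    assume "c = 0"
    then show False using c \<theta> by (simp add: g_def)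
  qed
  then obtain d where d: "c = Suc d" by (cases c) auto
  have gd: "g d < \<theta>" using not_less_Least[of d "\<lambda>c. \<theta> \<le> g c"] d by (simp add: c_def)
  have eq: "u @ replicate c 1 = (u @ replicate d 1) @ [1]"
    using d by (simp add: replicate_append_same)
  have "cden (u @ replicate c 1) \<le> (int M + 1) * cden (u @ replicate d 1)"
    unfolding eq by (rule cden_snoc_le[OF pos M])
  then have "rden (u @ replicate c 1) \<le> real_of_int ((int M + 1) * cden (u @ replicate d 1))"
    unfolding of_int_le_iff .
  then have "rden (u @ replicate c 1) \<le> (real M + 1) * cden (u @ replicate d 1)" by simp
  then have "g c \<le> ((real M + 1) * cden (u @ replicate d 1))\<^sup>2"
    unfolding g_def using cf_bounds(1)[OF pos, of c] by (intro power_mono) auto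
  also have "\<dots> = g d * (real M + 1)\<^sup>2" by (simp add: g_def power_mult_distrib)
  also have "\<dots> < \<theta> * (real M + 1)\<^sup>2" using gd by (intro mult_strict_right_mono) auto
  finally show ?thesis using c that unfolding g_def by blast
qed

text \<open>Induction on the number of targets. A block multiplies the squared denominator by at
  most (M + 1) ^ (2 * block_length m), and the prefix may overshoot its scale by (M + 1)^2;
  \<open>growth\<close> leaves room for both, and ones fill the gap up to the scale of the next n.
  Earlier hits persist because they hold for every tail.\<close>

lemma hit_chain:
  fixes n :: "nat \<Rightarrow> real" and \<delta> :: "nat \<Rightarrow> real"
  assumes M: "M \<ge> 1200" and m: "m \<ge> 7" and Mm: "(real M + 1)\<^sup>2 \<le> 2 ^ m" and u: "set u \<subseteq> {1..M}"
    and growth: "\<And>a. n a * (real M + 1) ^ (2 * block_length m + 2) \<le> n (Suc a)"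
    and start: "n 0 / block_scale M m \<le> (rden u)\<^sup>2"
      "(rden u)\<^sup>2 < n 0 / block_scale M m * (real M + 1)\<^sup>2"
  shows "\<exists>b. set b \<subseteq> {1..M} \<and>
    (\<forall>a<A. \<forall>t\<in>{0..1}. nearest_int_dist (n a * cfval (u @ b) t - \<delta> a) \<le> 2 / 2 ^ m) \<and>
    n A / block_scale M m \<le> (rden (u @ b))\<^sup>2 \<and>
    (rden (u @ b))\<^sup>2 < n A / block_scale M m * (real M + 1)\<^sup>2"
proof (induction A)
  case 0
  show ?case using start by (intro exI[of _ "[]"]) auto
next
  case (Suc A)
  define S where "S = block_scale M m"
  have S: "S > 0" by (simp add: S_def block_scale_pos)
  obtain b where b: "set b \<subseteq> {1..M}"
    "\<And>a t. a < A \<Longrightarrow> t \<in> {0..1} \<Longrightarrow> nearest_int_dist (n a * cfval (u @ b) t - \<delta> a) \<le> 2 / 2 ^ m"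
    "n A / S \<le> (rden (u @ b))\<^sup>2" "(rden (u @ b))\<^sup>2 < n A / S * (real M + 1)\<^sup>2"
    using Suc.IH unfolding S_def by blast
  have ub: "0 \<notin> set (u @ b)" using u b by auto
  define q where "q = (rden (u @ b))\<^sup>2"
  have q: "q > 0" using cf_bounds(1)[OF ub] by (simp add: q_def)
  have M2: "(real M + 1)\<^sup>2 > 0" by (intro zero_less_power) simp
  have "S / (real M + 1)\<^sup>2 \<le> n A / q"
  proof -
    have "S * q < n A * (real M + 1)\<^sup>2" using b(4) S unfolding q_def[symmetric] by (simp add: field_simps)
    then show ?thesis using q M2 by (simp add: field_simps)
  qed
  moreover have "n A / q \<le> S" using b(3) S q unfolding q_def[symmetric] by (simp add: field_simps)
  ultimately obtain b1 where b1: "b1 \<in> words M (block_length m)"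
    "\<And>t. t \<in> {0..1} \<Longrightarrow> nearest_int_dist (n A * cfval ((u @ b) @ b1) t - \<delta> A) \<le> 2 / 2 ^ m"
    using forced_block[OF M m Mm ub] unfolding q_def S_def by blast
  have ubb: "0 \<notin> set ((u @ b) @ b1)" using ub words_pos[OF b1(1)] by auto
  have "cden ((u @ b) @ b1) \<le> (int M + 1) ^ block_length m * cden (u @ b)"
    using cden_append_le_pow[OF ub, of b1 M] b1(1) by (simp add: words_def)
  then have "rden ((u @ b) @ b1) \<le> real_of_int ((int M + 1) ^ block_length m * cden (u @ b))"
    unfolding of_int_le_iff .
  then have "(rden ((u @ b) @ b1))\<^sup>2 \<le> ((real M + 1) ^ block_length m * cden (u @ b))\<^sup>2"
    using cf_bounds(1)[OF ubb] by (intro power_mono) auto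
  also have "\<dots> = (real M + 1) ^ (2 * block_length m) * q"
    by (simp add: q_def power_mult_distrib mult.commute flip: power_mult)
  also have "\<dots> < (real M + 1) ^ (2 * block_length m) * (n A / S * (real M + 1)\<^sup>2)"
    using b(4) unfolding q_def by (intro mult_strict_left_mono) auto
  also have "\<dots> = n A * (real M + 1) ^ (2 * block_length m + 2) / S" by (simp add: power_add power2_eq_square)
  also have "\<dots> \<le> n (Suc A) / S" using growth S by (intro divide_right_mono) auto
  finally have "(rden ((u @ b) @ b1))\<^sup>2 < n (Suc A) / S" .
  moreover have "M \<ge> 1" using M by simp
  ultimately obtain c where c: "n (Suc A) / S \<le> (rden (((u @ b) @ b1) @ replicate c 1))\<^sup>2"
    "(rden (((u @ b) @ b1) @ replicate c 1))\<^sup>2 < n (Suc A) / S * (real M + 1)\<^sup>2"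
    using reach_scale[OF ubb] by blast
  have hits: "nearest_int_dist (n a * cfval (u @ b @ b1 @ replicate c 1) t - \<delta> a) \<le> 2 / 2 ^ m"
    if "a < Suc A" "t \<in> {0..1}" for a t
  proof (cases "a = A")
    case True
    have "cfval (replicate c 1) t \<in> {0..1}"
      using cfval_bounds[of "replicate c 1" t] that(2) by auto
    from b1(2)[OF this] show ?thesis using True by (simp add: cfval_append)
  next
    case False
    have "0 \<notin> set (b1 @ replicate c 1)" using ubb by auto
    then have "cfval (b1 @ replicate c 1) t \<in> {0..1}"
      using cfval_bounds[of "b1 @ replicate c 1" t] that(2) by auto
    from b(2)[OF _ this, of a] show ?thesis using False that(1) by (simp add: cfval_append)
  qed
  show ?case
    by (intro exI[of _ "b @ b1 @ replicate c 1"])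
      (use b(1) b1(1) hits c M in \<open>auto simp: words_def S_def\<close>)
qed

lemma nearest_int_dist_shift: "nearest_int_dist (x - of_int k) \<le> nearest_int_dist x"
  using nearest_int_dist_le[of "x - of_int k" "round x - k"] unfolding nearest_int_dist_eq_round[of x] by simp

text \<open>This reduces all real \<delta> to finitely many targets: the grid point below the
  fractional part of \<delta> is off by at most one mesh.\<close>

lemma grid_targets_suffice:
  assumes "\<And>a. a < 2 ^ m \<Longrightarrow> nearest_int_dist (y a - real a / 2 ^ m) \<le> 2 / 2 ^ m"
  obtains a where "a < (2::nat) ^ m" "nearest_int_dist (y a - \<delta>) \<le> 3 / 2 ^ m"
proof -
  define a where "a = nat \<lfloor>2 ^ m * frac \<delta>\<rfloor>"
  have f: "0 \<le> 2 ^ m * frac \<delta>" "2 ^ m * frac \<delta> < 2 ^ m"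
    using frac_lt_1[of \<delta>] frac_ge_0[of \<delta>] by auto
  have a: "real a \<le> 2 ^ m * frac \<delta>" "2 ^ m * frac \<delta> < real a + 1"
    using f(1) unfolding a_def by auto
  have "real a < 2 ^ m" using a f by linarith
  then have "real a < real (2 ^ m)" by simp
  then have a2: "a < 2 ^ m" unfolding of_nat_less_iff .
  have "real a / 2 ^ m - frac \<delta> = (real a - 2 ^ m * frac \<delta>) / 2 ^ m" by (simp add: field_simps)
  moreover have "\<bar>real a - 2 ^ m * frac \<delta>\<bar> \<le> 1" using a by linarith
  ultimately have "\<bar>real a / 2 ^ m - frac \<delta>\<bar> \<le> 1 / 2 ^ m" by (simp add: divide_right_mono)
  moreover have "nearest_int_dist (y a - \<delta>) \<le> nearest_int_dist (y a - real a / 2 ^ m) + \<bar>real a / 2 ^ m - frac \<delta>\<bar>"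
  proof -
    have eq: "y a - \<delta> = (y a - real a / 2 ^ m) + (real a / 2 ^ m - frac \<delta>) - of_int \<lfloor>\<delta>\<rfloor>"
      by (simp add: frac_def)
    show ?thesis
      by (subst eq, rule order.trans[OF nearest_int_dist_shift nearest_int_dist_triangle])
  qed
  ultimately show ?thesis using assms[OF a2] a2 by (intro that[of a]) auto
qed

section \<open>Asymptotic comparisons and the window for one \<alpha>\<close>

lemma eventually_pow3_dominates:
  assumes "e > 0"
  shows "eventually (\<lambda>m::nat. c1 * (real m * 2 ^ m) + c2 * 2 ^ m + c3 * real m + c4 \<le> e * 3 ^ m) sequentially"
proof -
  have l: "(\<lambda>m::nat. real m * 2 ^ m / 3 ^ m) \<longlonglongrightarrow> 0" "(\<lambda>m::nat. 2 ^ m / 3 ^ m :: real) \<longlonglongrightarrow> 0"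
    "(\<lambda>m::nat. real m / 3 ^ m) \<longlonglongrightarrow> 0" "(\<lambda>m::nat. 1 / 3 ^ m :: real) \<longlonglongrightarrow> 0"
    by real_asymp+
  have "(\<lambda>m::nat. c1 * (real m * 2 ^ m / 3 ^ m) + c2 * (2 ^ m / 3 ^ m) + c3 * (real m / 3 ^ m) + c4 * (1 / 3 ^ m))
     \<longlonglongrightarrow> c1 * 0 + c2 * 0 + c3 * 0 + c4 * 0"
    by (intro tendsto_intros l)
  then have "eventually (\<lambda>m::nat. c1 * (real m * 2 ^ m / 3 ^ m) + c2 * (2 ^ m / 3 ^ m) + c3 * (real m / 3 ^ m) + c4 * (1 / 3 ^ m) < e) sequentially"
    using assms by (intro order_tendstoD(2)[where a = e]) auto
  then show ?thesis
  proof eventually_elim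
    case (elim m)
    then have "(c1 * (real m * 2 ^ m / 3 ^ m) + c2 * (2 ^ m / 3 ^ m) + c3 * (real m / 3 ^ m) + c4 * (1 / 3 ^ m)) * 3 ^ m \<le> e * 3 ^ m"
      by (intro mult_right_mono) auto
    then show ?case by (simp add: distrib_right)
  qed
qed

lemma ln_block_scale_le:
  assumes "M \<ge> 1"
  shows "\<exists>A B. \<forall>m. ln (block_scale M m) \<le> A + B * real m"
proof -
  define P where "P = (13824::real) * 4 * (real M + 1)\<^sup>2"
  define G :: real where "G = 1458 ^ 24 * (2 ^ 200)\<^sup>2 * (3 ^ 300)\<^sup>2"
  have PG: "P > 0" "G > 0" unfolding P_def G_def by (intro mult_pos_pos zero_less_power; simp)+
  have "ln (block_scale M m) \<le> ln P + ln G * real m" for m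
  proof -
    have 1: "rden (replicate (200 * m) 1) \<le> 2 ^ (200 * m)"
    proof -
      have "cden (replicate (200 * m) 1) \<le> (int 1 + 1) ^ length (replicate (200 * m) (1::nat))"
        by (rule cden_le_pow) auto
      then have "rden (replicate (200 * m) 1) \<le> real_of_int (2 ^ (200 * m))"
        unfolding of_int_le_iff by simp
      then show ?thesis by simp
    qed
    have 2: "rden (replicate (300 * m) 2) \<le> 3 ^ (300 * m)"
    proof -
      have "cden (replicate (300 * m) 2) \<le> (int 2 + 1) ^ length (replicate (300 * m) (2::nat))"
        by (rule cden_le_pow) auto
      then have "rden (replicate (300 * m) 2) \<le> real_of_int (3 ^ (300 * m))"
        unfolding of_int_le_iff by simp
      then show ?thesis by simp
    qed
    have nn: "0 \<le> rden (replicate (200 * m) 1)" "0 \<le> rden (replicate (300 * m) 2)"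
      using cf_bounds(1)[of "replicate (200 * m) 1"] cf_bounds(1)[of "replicate (300 * m) 2"] by auto
    have "block_scale M m \<le> 13824 * 1458 ^ (24 * m) * 4 * (real M + 1)\<^sup>2 * (2 ^ (200 * m))\<^sup>2 * (3 ^ (300 * m))\<^sup>2"
      unfolding block_scale_def using 1 2 nn by (intro mult_mono mult_left_mono power_mono) auto
    also have "\<dots> = P * G ^ m"
      by (simp only: P_def G_def power_mult_distrib power_mult[symmetric] mult_ac)
    finally have "ln (block_scale M m) \<le> ln (P * G ^ m)" 
      using block_scale_pos[of M m] PG by (subst ln_le_cancel_iff) auto
    also have "\<dots> = ln P + ln G * real m" using PG by (simp add: ln_mult ln_realpow)
    finally show ?thesis .
  qed
  then show ?thesis by blast
qed

definition good_approx :: "real \<Rightarrow> real \<Rightarrow> real \<Rightarrow> real \<Rightarrow> real \<Rightarrow> nat \<Rightarrow> bool" where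
  "good_approx \<epsilon> \<alpha> \<gamma> \<beta> \<delta> n \<longleftrightarrow> n \<ge> 1 \<and>
    real n * nearest_int_dist (real n * \<alpha> - \<gamma>) * nearest_int_dist (real n * \<beta> - \<delta>)
      < ln (ln (ln (real n))) powr (\<epsilon> + 1/2) / ln (real n) powr (1/2)"

text \<open>The threshold \<theta> and the length l do not depend on the prefix u, which is what
  lets the block be inserted everywhere in the tree. The freely chosen Z pushes the window beyond
  all earlier ones, and e makes its share of the digits negligible.\<close>

proposition forcing_window:
  fixes \<epsilon> \<gamma> \<alpha> e Z :: real
  assumes M: "M \<ge> 1200" and \<epsilon>: "\<epsilon> > 0" and \<alpha>: "\<alpha> \<in> K_set" and e: "e > 0"
  shows "\<exists>\<theta> l. Z \<le> \<theta> \<and> real l \<le> e * ln \<theta> \<and>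
    (\<forall>u. set u \<subseteq> {1..M} \<and> \<theta> \<le> (rden u)\<^sup>2 \<and>
       (rden u)\<^sup>2 < \<theta> * (real M + 1)\<^sup>2 \<longrightarrow>
      (\<exists>b\<in>words M l. \<forall>t\<in>{0..1}. \<forall>\<delta>. \<exists>n. Z \<le> real n \<and>
        good_approx \<epsilon> \<alpha> \<gamma> (cfval (u @ b) t) \<delta> n))"
proof -
  obtain C where C: "C \<ge> 0" "\<And>t. ln (real_of_int (cf_denom \<alpha> t)) \<le> C * real t" and irr: "\<alpha> \<notin> \<rat>"
    using K_setE[OF \<alpha>] by blast
  define q where "q t = real_of_int (cf_denom \<alpha> t)" for t
  define f where "f t = ln (q t)" for t
  have q1: "q t \<ge> 1" for t
    using cf_bounds(1)[OF cf_word_pos[OF irr], of t] by (simp add: cden_cf_word[OF irr] q_def)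
  have f0: "0 \<le> f t" for t using q1[of t] by (simp add: f_def)
  have fC: "f t \<le> C * real t" for t using C(2) by (simp add: f_def q_def)
  have qg: "2 ^ (j div 2) * q t \<le> q (t + j)" for t j
  proof -
    have "real_of_int (2 ^ (j div 2) * cf_denom \<alpha> t) \<le> real_of_int (cf_denom \<alpha> (t + j))"
      unfolding of_int_le_iff by (rule cf_denom_growth[OF irr])
    then show ?thesis by (simp add: q_def)
  qed
  have q_mono: "q t \<le> q (t + j)" for t j
  proof -
    have "1 * q t \<le> 2 ^ (j div 2) * q t" using q1[of t] by (intro mult_right_mono) auto
    then show ?thesis using qg[where j = j and t = t] by linarith
  qed
  obtain A B where AB: "\<And>m. ln (block_scale M m) \<le> A + B * real m"
    using ln_block_scale_le[of M] M by auto
  \<comment> \<open>Over \<open>s m\<close> indices the denominators grow by 2 ^ (s m div 2) = 2 * 2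
    ^ ((M + 1) * (2 * block_length m + 2)). The power covers the growth asked for in
    \<open>hit_chain\<close>, the extra 2 the freedom q <= n < 2 q.\<close>
  define s where "s m = 2 * ((M + 1) * (2 * block_length m + 2) + 1)" for m
  \<comment> \<open>Beyond exp (exp (exp 1)) the triple logarithm is at least 1, and so is its power
    in the numerator.\<close>
  define Z' where "Z' = max 1 (max Z (exp (exp (exp 1))))"
  \<comment> \<open>\<open>len m\<close> will bound the number of digits spent in the window and
    \<open>low m\<close> will bound ln \<theta> from below. The former is O(m 2^m), the latter of
    order 3^m; \<open>ev3\<close> compares them.\<close>
  define len where "len m = 2 + (2 * ln (real M + 1) + ln 2 + 4 * C * real (2 ^ m * s m)) / ln 2" for m
  define low where "low m = (3 ^ m / 2 - 1) * ln 2 - A - B * real m" for m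
  have s_eq: "real (2 ^ m * s m) = (2 * (real M + 1) * 1648) * (real m * 2 ^ m) + (2 * (2 * (real M + 1) + 1)) * 2 ^ m" for m
    by (simp add: s_def block_length_def algebra_simps)
  have ev1: "eventually (\<lambda>m. 2 ^ m * s m \<le> 3 ^ m) sequentially"
  proof -
    have "eventually (\<lambda>m. (2 * (real M + 1) * 1648) * (real m * 2 ^ m) + (2 * (2 * (real M + 1) + 1)) * 2 ^ m + 0 * real m + 0 \<le> 1 * 3 ^ m) sequentially"
      by (rule eventually_pow3_dominates) simp
    then show ?thesis
    proof eventually_elim
      case (elim m)
      then have "real (2 ^ m * s m) \<le> real (3 ^ m)" unfolding s_eq by simp
      then show ?case unfolding of_nat_le_iff .
    qed
  qed
  have ev2: "eventually (\<lambda>m. ln Z' + (A + B * real m) + ln 2 \<le> 3 ^ m / 2 * ln 2) sequentially"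
  proof -
    have "eventually (\<lambda>m. 0 * (real m * 2 ^ m) + 0 * 2 ^ m + B * real m + (ln Z' + A + ln 2) \<le> (ln 2 / 2) * 3 ^ m) sequentially"
      by (rule eventually_pow3_dominates) simp
    then show ?thesis by eventually_elim (simp add: algebra_simps)
  qed
  have ev2': "eventually (\<lambda>m. ln Z' + ln 2 \<le> 3 ^ m / 2 * ln 2) sequentially"
  proof -
    have "eventually (\<lambda>m. 0 * (real m * 2 ^ m) + 0 * 2 ^ m + 0 * real m + (ln Z' + ln 2) \<le> (ln 2 / 2) * 3 ^ m) sequentially"
      by (rule eventually_pow3_dominates) simp
    then show ?thesis by eventually_elim (simp add: algebra_simps)
  qed
  have ev3: "eventually (\<lambda>m. len m \<le> e * low m) sequentially"
  proof -
    define c1 where "c1 = 4 * C * (2 * (real M + 1) * 1648) / ln 2"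
    define c2 where "c2 = 4 * C * (2 * (2 * (real M + 1) + 1)) / ln 2"
    have "eventually (\<lambda>m. c1 * (real m * 2 ^ m) + c2 * 2 ^ m + (e * B) * real m +
        (2 + (2 * ln (real M + 1) + ln 2) / ln 2 + e * (ln 2 + A)) \<le> (e * ln 2 / 2) * 3 ^ m) sequentially"
      by (rule eventually_pow3_dominates) (use e in simp)
    then show ?thesis
    proof eventually_elim
      case (elim m)
      have "len m = 2 + (2 * ln (real M + 1) + ln 2) / ln 2 + (c1 * (real m * 2 ^ m) + c2 * 2 ^ m)"
        unfolding len_def s_eq c1_def c2_def by (simp add: add_divide_distrib algebra_simps)
      moreover have "e * low m = (e * ln 2 / 2) * 3 ^ m - e * (ln 2 + A) - (e * B) * real m"
        by (simp add: low_def algebra_simps)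
      ultimately show ?case using elim by linarith
    qed
  qed
  \<comment> \<open>225 = 15^2, where 15 = 5 * 3 multiplies the constants of the inhomogeneous
    approximation and of the grid. The bracket bounds ln n, and 4 ^ m is the square of 2 ^
    m.\<close>
  have ev4: "eventually (\<lambda>m. 225 * (ln 2 + 2 * C * 3 ^ m) < 4 ^ m) sequentially"
  proof -
    have l: "(\<lambda>m::nat. 3 ^ m / 4 ^ m :: real) \<longlonglongrightarrow> 0" "(\<lambda>m::nat. 1 / 4 ^ m :: real) \<longlonglongrightarrow> 0" by real_asymp+
    have "(\<lambda>m::nat. (225 * ln 2) * (1 / 4 ^ m) + (450 * C) * (3 ^ m / 4 ^ m)) \<longlonglongrightarrow> (225 * ln 2) * 0 + (450 * C) * 0"
      by (intro tendsto_intros l)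
    then have "eventually (\<lambda>m::nat. (225 * ln 2) * (1 / 4 ^ m) + (450 * C) * (3 ^ m / 4 ^ m) < 1) sequentially"
      by (intro order_tendstoD(2)[where a = 1]) auto
    then show ?thesis by eventually_elim (simp add: field_simps)
  qed
  have ev5: "eventually (\<lambda>m. (real M + 1)\<^sup>2 \<le> 2 ^ m) sequentially"
  proof -
    obtain k where k: "(real M + 1)\<^sup>2 < 2 ^ k" using real_arch_pow[of 2 "(real M + 1)\<^sup>2"] by auto
    show ?thesis using eventually_ge_at_top[of k]
    proof eventually_elim
      case (elim m)
      then have "(2::real) ^ k \<le> 2 ^ m" by (intro power_increasing) auto
      then show ?case using k by linarith
    qed
  qed
  have "eventually (\<lambda>m. m \<ge> 7 \<and> 2 ^ m * s m \<le> 3 ^ m \<and> ln Z' + (A + B * real m) + ln 2 \<le> 3 ^ m / 2 * ln 2 \<and>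
      ln Z' + ln 2 \<le> 3 ^ m / 2 * ln 2 \<and>
      len m \<le> e * low m \<and> 225 * (ln 2 + 2 * C * 3 ^ m) < 4 ^ m \<and> (real M + 1)\<^sup>2 \<le> 2 ^ m) sequentially"
    by (intro eventually_conj ev1 ev2 ev2' ev3 ev4 ev5 eventually_ge_at_top)
  then obtain m where m: "m \<ge> 7" "2 ^ m * s m \<le> 3 ^ m" "ln Z' + (A + B * real m) + ln 2 \<le> 3 ^ m / 2 * ln 2"
    "ln Z' + ln 2 \<le> 3 ^ m / 2 * ln 2"
    "len m \<le> e * low m" "225 * (ln 2 + 2 * C * 3 ^ m) < 4 ^ m" "(real M + 1)\<^sup>2 \<le> 2 ^ m"
    unfolding eventually_sequentially by blast
  define h where "h = 2 ^ m * s m"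
  have "s m > 0" by (simp add: s_def)
  then have "h > 0" by (simp add: h_def)
  then have "1 \<le> h" "h \<le> 3 ^ m" using m(2) by (simp_all add: h_def)
  then obtain k where k: "3 ^ m \<le> k" "k + h \<le> 2 * 3 ^ m" "f (k + h) - f k \<le> 4 * C * real h"
    using slow_growth_interval[of f C h "3 ^ m"] f0 fC C(1) by blast
  have "\<exists>n. int n \<ge> cf_denom \<alpha> t \<and> int n < 2 * cf_denom \<alpha> t \<and>
      real n * nearest_int_dist (real n * \<alpha> - \<gamma>) \<le> 5" for t
    using inhomogeneous_approx[OF irr] by metis
  then obtain N where N: "\<And>t. int (N t) \<ge> cf_denom \<alpha> t" "\<And>t. int (N t) < 2 * cf_denom \<alpha> t"
    "\<And>t. real (N t) * nearest_int_dist (real (N t) * \<alpha> - \<gamma>) \<le> 5"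
    by metis
  have Nq: "q t \<le> real (N t)" "real (N t) \<le> 2 * q t" for t
  proof -
    have "real_of_int (cf_denom \<alpha> t) \<le> real_of_int (int (N t))" unfolding of_int_le_iff by (rule N(1))
    then show "q t \<le> real (N t)" by (simp add: q_def)
    have "real_of_int (int (N t)) \<le> real_of_int (2 * cf_denom \<alpha> t)" unfolding of_int_le_iff using N(2)[of t] by simp
    then show "real (N t) \<le> 2 * q t" by (simp add: q_def)
  qed
  define n where "n a = N (k + a * s m)" for a
  define S where "S = block_scale M m"
  have S: "S > 0" by (simp add: S_def block_scale_pos)
  have growth: "real (n a) * (real M + 1) ^ (2 * block_length m + 2) \<le> real (n (Suc a))" for a
  proof -
    define E where "E = 2 * block_length m + 2"
    have "real M + 1 \<le> 2 ^ (M + 1)"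
      using of_nat_mono[OF less_imp_le[OF less_exp[of "M + 1"]], where 'a = real] by simp
    then have "(real M + 1) ^ E \<le> (2 ^ (M + 1)) ^ E" by (intro power_mono) auto
    also have "\<dots> = 2 ^ ((M + 1) * E)" by (simp only: power_mult)
    finally have 1: "(real M + 1) ^ E \<le> 2 ^ ((M + 1) * E)" .
    have "real (n a) * (real M + 1) ^ E \<le> (2 * q (k + a * s m)) * 2 ^ ((M + 1) * E)"
      unfolding n_def using Nq(2)[of "k + a * s m"] 1 q1[of "k + a * s m"] by (intro mult_mono) auto
    also have "\<dots> = 2 ^ (s m div 2) * q (k + a * s m)" by (simp add: s_def E_def)
    also have "\<dots> \<le> q (k + a * s m + s m)" by (rule qg)
    also have "\<dots> \<le> real (n (Suc a))" using Nq(1)[of "k + a * s m + s m"] by (simp add: n_def add_ac)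
    finally show ?thesis by (simp add: E_def)
  qed
  have lnq: "(3 ^ m / 2 - 1) * ln 2 \<le> f k"
  proof -
    have "(3 ^ m / 2 - 1 :: real) \<le> real (3 ^ m div 2)"
    proof -
      define d :: nat where "d = 3 ^ m div 2"
      have "(3::nat) ^ m \<le> 2 * d + 1" unfolding d_def by simp
      then have "real (3 ^ m) \<le> real (2 * d + 1)" unfolding of_nat_le_iff .
      then have "3 ^ m \<le> 2 * real d + 1" by simp
      then have "3 ^ m / 2 - 1 \<le> real d" by linarith
      then show ?thesis unfolding d_def .
    qed
    then have "(3 ^ m / 2 - 1) * ln 2 \<le> real (3 ^ m div 2) * ln 2" by (intro mult_right_mono) auto
    also have "\<dots> = ln (2 ^ (3 ^ m div 2))" by (simp add: ln_realpow)
    also have "\<dots> \<le> ln (q k)"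
    proof (subst ln_le_cancel_iff)
      have "2 ^ (3 ^ m div 2) * 1 \<le> 2 ^ (3 ^ m div 2) * q (k - 3 ^ m)" using q1 by (intro mult_left_mono) auto
      also have "\<dots> \<le> q (k - 3 ^ m + 3 ^ m)" by (rule qg)
      finally show "2 ^ (3 ^ m div 2) \<le> q k" using k(1) by simp
    qed (use q1[of k] in auto)
    finally show ?thesis by (simp add: f_def)
  qed
  have n0: "real (n a) \<ge> q k" for a
    using q_mono[of k "a * s m"] Nq(1)[of "k + a * s m"] unfolding n_def by linarith
  have n0pos: "real (n a) > 0" for a using n0[of a] q1[of k] by linarith
  have Z'1: "Z' \<ge> 1" by (simp add: Z'_def)
  have nZ': "Z' \<le> real (n a)" for a
  proof -
    have "ln Z' \<le> (3 ^ m / 2 - 1) * ln 2" using m(4) by (simp add: algebra_simps)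
    also have "\<dots> \<le> ln (q k)" using lnq by (simp add: f_def)
    finally have "Z' \<le> q k" using Z'1 q1[of k] by (subst (asm) ln_le_cancel_iff) auto
    then show ?thesis using n0[of a] by linarith
  qed
  define \<theta> where "\<theta> = real (n 0) / S"
  have \<theta>0: "\<theta> > 0" using n0pos[of 0] S by (simp add: \<theta>_def)
  have ln\<theta>: "low m \<le> ln \<theta>"
  proof -
    have "ln \<theta> = ln (real (n 0)) - ln S" using n0pos[of 0] S by (simp add: \<theta>_def ln_div)
    moreover have "ln (q k) \<le> ln (real (n 0))" using n0[of 0] q1[of k] n0pos[of 0] by (subst ln_le_cancel_iff) auto
    moreover have "ln S \<le> A + B * real m" using AB by (simp add: S_def)
    ultimately show ?thesis using lnq unfolding low_def f_def by linarith
  qed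
  have Z\<theta>: "Z' \<le> \<theta>"
  proof -
    have "ln Z' \<le> low m" using m(3) by (simp add: low_def algebra_simps)
    then have "ln Z' \<le> ln \<theta>" using ln\<theta> by linarith
    then show ?thesis using Z'1 \<theta>0 by (subst (asm) ln_le_cancel_iff) auto
  qed
  define l where "l = nat \<lfloor>len m\<rfloor>"
  have len0: "0 \<le> len m" using C(1) by (simp add: len_def)
  have l: "real l \<le> len m" "len m < real l + 1" using len0 by (auto simp: l_def)
  have le: "real l \<le> e * ln \<theta>"
    using l(1) m(5) mult_left_mono[OF ln\<theta>, of e] e by linarith
  have main: "\<exists>b\<in>words M l. \<forall>t\<in>{0..1}. \<forall>\<delta>. \<exists>n. Z \<le> real n \<and>
        good_approx \<epsilon> \<alpha> \<gamma> (cfval (u @ b) t) \<delta> n"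
    if u: "set u \<subseteq> {1..M}" and u\<theta>: "\<theta> \<le> (rden u)\<^sup>2"
      "(rden u)\<^sup>2 < \<theta> * (real M + 1)\<^sup>2" for u
  proof -
    have upos: "0 \<notin> set u" using u by auto
    obtain b where b: "set b \<subseteq> {1..M}"
      "\<And>a t. a < 2 ^ m \<Longrightarrow> t \<in> {0..1} \<Longrightarrow> nearest_int_dist (real (n a) * cfval (u @ b) t - real a / 2 ^ m) \<le> 2 / 2 ^ m"
      "(rden (u @ b))\<^sup>2 < real (n (2 ^ m)) / S * (real M + 1)\<^sup>2"
      using hit_chain[where n = "\<lambda>a. real (n a)" and A = "2 ^ m" and \<delta> = "\<lambda>a. real a / 2 ^ m",
          OF M m(1) m(7) u growth] u\<theta>
      unfolding \<theta>_def S_def by blast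
    have bpos: "0 \<notin> set b" using b(1) by auto
    \<comment> \<open>The squared denominator of b is at least 2 ^ (length b - 1), while the scale
      moves only from n 0 to n (2 ^ m). The slow window bounds the logarithm of that growth by 4 C h
      plus constants.\<close>
    have "length b \<le> l"
    proof -
      define Qu where "Qu = rden u"
      have Qu: "Qu \<ge> 1" using cf_bounds(1)[OF upos] by (simp add: Qu_def)
      have "real_of_int (cden u * cden b) \<le> cden (u @ b)"
        unfolding of_int_le_iff by (rule cden_append_ge[OF upos bpos])
      then have "Qu * cden b \<le> cden (u @ b)" by (simp add: Qu_def)
      then have "(Qu * cden b)\<^sup>2 \<le> (rden (u @ b))\<^sup>2"
        using Qu cf_bounds(1)[OF bpos] by (intro power_mono) auto
      then have 1: "Qu\<^sup>2 * (rden b)\<^sup>2 < real (n (2 ^ m)) / S * (real M + 1)\<^sup>2"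
        using b(3) by (simp add: power_mult_distrib)
      have "\<theta> * 2 ^ (length b - 1) \<le> Qu\<^sup>2 * (rden b)\<^sup>2"
        using u\<theta>(1) cden_sq_ge_pow2[OF bpos] \<theta>0 unfolding Qu_def by (intro mult_mono) auto
      then have "\<theta> * 2 ^ (length b - 1) < real (n (2 ^ m)) / S * (real M + 1)\<^sup>2" using 1 by linarith
      then have "real (n 0) * 2 ^ (length b - 1) < real (n (2 ^ m)) * (real M + 1)\<^sup>2"
        using S by (simp add: \<theta>_def field_simps)
      also have "\<dots> \<le> (2 * q (k + h)) * (real M + 1)\<^sup>2"
        using Nq(2)[of "k + h"] by (intro mult_right_mono) (auto simp: n_def h_def)
      finally have "real (n 0) * 2 ^ (length b - 1) < (2 * q (k + h)) * (real M + 1)\<^sup>2" .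
      moreover have "q k * 2 ^ (length b - 1) \<le> real (n 0) * 2 ^ (length b - 1)"
        by (intro mult_right_mono n0) auto
      ultimately have "q k * 2 ^ (length b - 1) < (2 * q (k + h)) * (real M + 1)\<^sup>2" by linarith
      then have "ln (q k * 2 ^ (length b - 1)) < ln ((2 * q (k + h)) * (real M + 1)\<^sup>2)"
        using q1[of k] q1[of "k + h"] by (subst ln_less_cancel_iff) auto
      moreover have "ln (q k * 2 ^ (length b - 1)) = f k + real (length b - 1) * ln 2"
        using q1[of k] by (simp add: ln_mult ln_realpow f_def)
      moreover have "ln ((2 * q (k + h)) * (real M + 1)\<^sup>2) = ln 2 + f (k + h) + 2 * ln (real M + 1)"
        using q1[of "k + h"] by (simp add: ln_mult ln_realpow f_def)
      ultimately have "real (length b - 1) * ln 2 < 2 * ln (real M + 1) + ln 2 + 4 * C * real h"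
        using k(3) by linarith
      then have "real (length b - 1) < (2 * ln (real M + 1) + ln 2 + 4 * C * real h) / ln 2"
        by (simp add: pos_less_divide_eq)
      then have "real (length b - 1) + 2 < len m" by (simp add: len_def h_def)
      then have "real (length b - 1 + 2) < real (l + 1)" using l(2) by simp
      then have "length b - 1 + 2 < l + 1" unfolding of_nat_less_iff .
      then show ?thesis by simp
    qed
    \<comment> \<open>Ones pad b to the common length l; the hits hold for every tail and are not
      disturbed.\<close>
    define c where "c = b @ replicate (l - length b) 1"
    have c: "c \<in> words M l" using b(1) \<open>length b \<le> l\<close> M by (auto simp: words_def c_def)
    show ?thesis
    proof (intro bexI[OF _ c] ballI allI)
      fix t \<delta> :: real assume t: "t \<in> {0..1}"
      define t' where "t' = cfval (replicate (l - length b) 1) t"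
      have t': "t' \<in> {0..1}" using cfval_bounds[of "replicate (l - length b) 1" t] t by (auto simp: t'_def)
      have uc: "cfval (u @ c) t = cfval (u @ b) t'" by (simp add: c_def t'_def cfval_append)
      obtain a where a: "a < 2 ^ m" "nearest_int_dist (real (n a) * cfval (u @ b) t' - \<delta>) \<le> 3 / 2 ^ m"
        using grid_targets_suffice[of m "\<lambda>a. real (n a) * cfval (u @ b) t'" \<delta>] b(2)[OF _ t'] by blast
      define x where "x = real (n a)"
      have x: "Z' \<le> x" "1 \<le> x" using nZ'[of a] Z'1 by (auto simp: x_def)
      have x3: "exp (exp (exp 1)) \<le> x" using x by (simp add: Z'_def)
      have l1: "exp (exp 1) \<le> ln x" using x3 x by (subst ln_ge_iff) auto
      have "(0::real) < exp (exp 1)" by simp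
      then have lp: "0 < ln x" using l1 by linarith
      then have l2: "exp 1 \<le> ln (ln x)" using l1 by (subst ln_ge_iff) auto
      have "(0::real) < exp 1" by simp
      then have "0 < ln (ln x)" using l2 by linarith
      then have l3: "1 \<le> ln (ln (ln x))" using l2 by (subst ln_ge_iff) auto
      have "k + a * s m \<le> 2 * 3 ^ m"
      proof -
        have "a * s m \<le> h" using a(1) by (simp add: h_def)
        then show ?thesis using k(2) by linarith
      qed
      then have kk: "real (k + a * s m) \<le> 2 * 3 ^ m"
        using of_nat_mono[of "k + a * s m" "2 * 3 ^ m", where 'a = real] by simp
      have lnx: "ln x \<le> ln 2 + 2 * C * 3 ^ m"
      proof -
        have "x \<le> 2 * q (k + a * s m)" using Nq(2) by (simp add: x_def n_def)
        then have "ln x \<le> ln (2 * q (k + a * s m))" using x q1[of "k + a * s m"] by (subst ln_le_cancel_iff) auto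
        also have "\<dots> = ln 2 + f (k + a * s m)" using q1[of "k + a * s m"] by (simp add: ln_mult f_def)
        also have "f (k + a * s m) \<le> C * (2 * 3 ^ m)"
          using fC[of "k + a * s m"] mult_left_mono[OF kk C(1)] by linarith
        finally show ?thesis by simp
      qed
      have "15 / 2 ^ m < 1 / ln x powr (1/2)"
      proof -
        have "225 * ln x < 4 ^ m" using lnx m(6) by simp
        also have "(4::real) ^ m = (2 ^ m)\<^sup>2" by (simp add: power2_eq_square flip: power_mult_distrib)
        finally have "sqrt (225 * ln x) < 2 ^ m" using lp by (intro real_less_lsqrt) auto
        moreover have "sqrt 225 = (15::real)" by (rule real_sqrt_unique) auto
        ultimately have "15 * sqrt (ln x) < 2 ^ m" by (simp add: real_sqrt_mult)
        then show ?thesis using lp by (simp add: powr_half_sqrt field_simps)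
      qed
      also have "\<dots> \<le> ln (ln (ln x)) powr (\<epsilon> + 1/2) / ln x powr (1/2)"
        using l3 \<epsilon> by (intro divide_right_mono ge_one_powr_ge_zero) auto
      finally have rhs: "15 / 2 ^ m < ln (ln (ln x)) powr (\<epsilon> + 1/2) / ln x powr (1/2)" .
      have "x * nearest_int_dist (x * \<alpha> - \<gamma>) * nearest_int_dist (x * cfval (u @ c) t - \<delta>) \<le> 5 * (3 / 2 ^ m)"
        using N(3)[of "k + a * s m"] a(2) unfolding x_def n_def uc
        by (intro mult_mono) (auto simp: nearest_int_dist_nonneg)
      then have "x * nearest_int_dist (x * \<alpha> - \<gamma>) * nearest_int_dist (x * cfval (u @ c) t - \<delta>)
          < ln (ln (ln x)) powr (\<epsilon> + 1/2) / ln x powr (1/2)" using rhs by simp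
      moreover have "Z \<le> x" using x(1) by (simp add: Z'_def)
      moreover have "1 \<le> n a" using x(2) by (simp add: x_def)
      ultimately show "\<exists>n. Z \<le> real n \<and> good_approx \<epsilon> \<alpha> \<gamma> (cfval (u @ c) t) \<delta> n"
        unfolding x_def good_approx_def by blast
    qed
  qed
  have "Z \<le> \<theta>" using Z\<theta> by (simp add: Z'_def)
  with le main show ?thesis by blast
qed

section \<open>Dimension of trees of words\<close>

lemma cyl_len_child_ge:
  assumes "0 \<notin> set w" "1 \<le> a" "a \<le> M"
  shows "cyl_len w / (real M + 2)\<^sup>2 \<le> cyl_len (w @ [a])"
proof -
  define q q' where "q = rden w" and "q' = real_of_int (cden_prev w)"
  have q: "q \<ge> 1" "q' \<ge> 0" "q' \<le> q" using cf_bounds[OF assms(1)] by (auto simp: q_def q'_def)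
  have a: "1 \<le> real a" "real a \<le> real M" using assms by auto
  have "real a * q \<le> real M * q" using a q by (intro mult_right_mono) auto
  moreover have "(real M + 2) * q = real M * q + 2 * q" by (simp add: algebra_simps)
  ultimately have le: "real a * q + q' \<le> (real M + 2) * q" "real a * q + q' + q \<le> (real M + 2) * q"
    using q by linarith+
  have pos: "real a * q + q' > 0" using a q by (intro add_pos_nonneg) auto
  have "cyl_len w \<le> 1 / q\<^sup>2" unfolding q_def by (rule cyl_len_le[OF assms(1)])
  then have "cyl_len w / (real M + 2)\<^sup>2 \<le> 1 / q\<^sup>2 / (real M + 2)\<^sup>2" by (intro divide_right_mono) auto
  also have "\<dots> = 1 / (((real M + 2) * q) * ((real M + 2) * q))" by (simp add: power2_eq_square mult_ac)
  also have "\<dots> \<le> 1 / ((real a * q + q') * (real a * q + q' + q))"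
    using pos q le by (intro divide_left_mono mult_mono mult_pos_pos) auto
  also have "\<dots> = cyl_len (w @ [a])"
    by (simp add: cyl_len_def cden_snoc cden_prev_snoc q_def q'_def)
  finally show ?thesis .
qed

lemma cyl_len_le_pow2:
  assumes "0 \<notin> set w"
  shows "cyl_len w \<le> 1 / 2 ^ (length w - 1)"
proof -
  have "cyl_len w \<le> 1 / (rden w)\<^sup>2" by (rule cyl_len_le[OF assms])
  also have "\<dots> \<le> 1 / 2 ^ (length w - 1)"
    using cden_sq_ge_pow2[OF assms] by (intro frac_le) auto
  finally show ?thesis .
qed

lemma cfval_in_cyl_close:
  assumes "0 \<notin> set w" "s \<in> {0..1}" "t \<in> {0..1}"
  shows "\<bar>cfval w s - cfval w t\<bar> \<le> 2 * cyl_len w"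
proof -
  define q q' where "q = rden w" and "q' = real_of_int (cden_prev w)"
  have q: "q \<ge> 1" "q' \<ge> 0" "q' \<le> q" using cf_bounds[OF assms(1)] by (auto simp: q_def q'_def)
  have "\<bar>cfval w s - cfval w t\<bar> \<le> \<bar>s - t\<bar> / q\<^sup>2"
    unfolding q_def by (rule abs_cfval_diff_le) (use assms in auto)
  also have "\<dots> \<le> 1 / q\<^sup>2" using assms by (intro divide_right_mono) auto
  also have "\<dots> = 2 * (1 / (q * (2 * q)))" using q by (simp add: power2_eq_square)
  also have "\<dots> \<le> 2 * (1 / (q * (q + q')))"
    using q by (intro mult_left_mono divide_left_mono mult_pos_pos) auto
  finally show ?thesis by (simp add: cyl_len_def q_def q'_def)
qed

lemma sum_UN_le:
  fixes f :: "'b \<Rightarrow> real"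
  assumes "finite I" "\<And>i. i \<in> I \<Longrightarrow> finite (A i)" "\<And>x. x \<in> (\<Union>i\<in>I. A i) \<Longrightarrow> 0 \<le> f x"
  shows "(\<Sum>x\<in>(\<Union>i\<in>I. A i). f x) \<le> (\<Sum>i\<in>I. \<Sum>x\<in>A i. f x)"
  using assms
proof (induction I rule: finite_induct)
  case (insert i I)
  define B where "B = (\<Union>j\<in>I. A j)"
  have fin: "finite (A i)" "finite B" using insert by (auto simp: B_def)
  have "sum f (A i \<union> B) = sum f (A i) + sum f (B - A i)"
    using fin by (subst sum.union_disjoint[symmetric]) auto
  moreover have "sum f (B - A i) \<le> sum f B" using fin insert.prems(2) by (intro sum_mono2) (auto simp: B_def)
  moreover have "sum f B \<le> (\<Sum>j\<in>I. sum f (A j))" unfolding B_def using insert by auto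
  ultimately show ?case using insert.hyps by (simp add: B_def)
qed simp

text \<open>\<open>sparse\<close> counts the nodes on the path to w at which some digit of {1..M} is
  forbidden. Such a node will cost a factor (M + 2)^2, and the condition on e makes the total cost
  at most ((M + 2) / M) ^ length, no worse than the cutoff of the alphabet.\<close>

locale word_tree =
  fixes M :: nat and T :: "nat list set" and e :: real
  assumes M: "M \<ge> 1" and Nil: "[] \<in> T" and digits: "\<And>w. w \<in> T \<Longrightarrow> set w \<subseteq> {1..M}"
    and prefix: "\<And>w a. w @ [a] \<in> T \<Longrightarrow> w \<in> T" and child: "\<And>w. w \<in> T \<Longrightarrow> \<exists>a. w @ [a] \<in> T"
    and sparse: "\<And>w. w \<in> T \<Longrightarrow>
      real (card {i. i < length w \<and> (\<exists>a\<in>{1..M}. take i w @ [a] \<notin> T)}) \<le> e * real (length w)"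
    and e: "(real M + 2) powr (2 * e) \<le> (real M + 2) / real M"
begin

definition kids :: "nat list \<Rightarrow> nat set" where
  "kids w = {a. w @ [a] \<in> T}"

definition level :: "nat \<Rightarrow> nat list set" where
  "level k = {w \<in> T. length w = k}"

text \<open>A node passes its mass on in proportion to the lengths of the surviving child cylinders,
  so \<open>mass\<close> stays comparable to length wherever all digits are allowed.\<close>

definition ratio :: "nat list \<Rightarrow> nat \<Rightarrow> real" where
  "ratio w a = cyl_len (w @ [a]) / (\<Sum>a'\<in>kids w. cyl_len (w @ [a']))"

definition mass :: "nat list \<Rightarrow> real" where
  "mass w = (\<Prod>i<length w. ratio (take i w) (w ! i))"

definition \<rho> :: real where "\<rho> = ((real M + 2) / real M)\<^sup>2"

definition dim_exp :: real where "dim_exp = 1 - ln \<rho> / ln 2"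

definition limit_set :: "real set" where
  "limit_set = (\<Inter>k. \<Union>w\<in>level k. cfval w ` {0..1})"

lemma pos: "w \<in> T \<Longrightarrow> 0 \<notin> set w"
  using digits[of w] by auto

lemma kids_sub: "w \<in> T \<Longrightarrow> kids w \<subseteq> {1..M}"
  using digits by (fastforce simp: kids_def)

lemma finite_kids: "w \<in> T \<Longrightarrow> finite (kids w)"
  using kids_sub finite_subset by blast

lemma kids_nonempty: "w \<in> T \<Longrightarrow> kids w \<noteq> {}"
  using child by (auto simp: kids_def)

lemma take_in_T: "w \<in> T \<Longrightarrow> take i w \<in> T"
proof (induction w rule: rev_induct)
  case (snoc a w)
  then show ?case using prefix[of w a] by (cases "i \<le> length w") auto
qed (simp add: Nil)

lemma level_sub: "level k \<subseteq> words M k"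
  using digits by (auto simp: level_def words_def)

lemma level_T: "w \<in> level k \<Longrightarrow> w \<in> T"
  by (simp add: level_def)

lemma finite_level: "finite (level k)"
  using level_sub finite_words finite_subset by blast

lemma level_Suc: "level (Suc k) = (\<lambda>(w, a). w @ [a]) ` (SIGMA w:level k. kids w)"
proof (intro equalityI subsetI)
  fix w assume w: "w \<in> level (Suc k)"
  then have "w \<noteq> []" by (auto simp: level_def)
  then have eq: "w = butlast w @ [last w]" by simp
  then have "butlast w \<in> T" "butlast w @ [last w] \<in> T" using w prefix[of "butlast w" "last w"] by (auto simp: level_def)
  then have "(butlast w, last w) \<in> (SIGMA w:level k. kids w)" using w by (auto simp: level_def kids_def)
  then show "w \<in> (\<lambda>(w, a). w @ [a]) ` (SIGMA w:level k. kids w)" using eq by (intro image_eqI) auto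
qed (auto simp: level_def kids_def)

lemma sum_level_Suc: "(\<Sum>w\<in>level (Suc k). f w) = (\<Sum>w\<in>level k. \<Sum>a\<in>kids w. f (w @ [a]))"
proof -
  have "inj_on (\<lambda>(w, a). w @ [a]) (SIGMA w:level k. kids w)" by (auto simp: inj_on_def)
  then have "(\<Sum>w\<in>level (Suc k). f w) = (\<Sum>(w, a)\<in>(SIGMA w:level k. kids w). f (w @ [a]))"
    unfolding level_Suc by (simp add: sum.reindex case_prod_unfold)
  also have "\<dots> = (\<Sum>w\<in>level k. \<Sum>a\<in>kids w. f (w @ [a]))"
    by (rule sum.Sigma[symmetric]) (auto simp: finite_level finite_kids dest: level_T)
  finally show ?thesis .
qed

lemma kids_sum_pos:
  assumes "w \<in> T"
  shows "(\<Sum>a\<in>kids w. cyl_len (w @ [a])) > 0"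
  using assms finite_kids kids_nonempty by (intro sum_pos cyl_len_pos pos) (auto simp: kids_def)

lemma mass_Nil: "mass [] = 1"
  by (simp add: mass_def)

lemma mass_snoc: "mass (w @ [a]) = mass w * ratio w a"
  unfolding mass_def by (simp add: nth_append)

lemma ratio_nonneg: "w \<in> T \<Longrightarrow> w @ [a] \<in> T \<Longrightarrow> 0 \<le> ratio w a"
  unfolding ratio_def using kids_sum_pos[of w] cyl_len_pos[OF pos, of "w @ [a]"]
  by (intro divide_nonneg_nonneg) auto

lemma mass_nonneg: "w \<in> T \<Longrightarrow> 0 \<le> mass w"
proof (induction w rule: rev_induct)
  case (snoc a w)
  then show ?case unfolding mass_snoc using prefix[of w a] ratio_nonneg[of w a] by (intro mult_nonneg_nonneg) auto
qed (simp add: mass_Nil)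

lemma mass_nonneg_level: "w \<in> level k \<Longrightarrow> 0 \<le> mass w"
  by (simp add: level_def mass_nonneg)

lemma sum_mass_kids:
  assumes "w \<in> T"
  shows "(\<Sum>a\<in>kids w. mass (w @ [a])) = mass w"
proof -
  have "(\<Sum>a\<in>kids w. mass (w @ [a])) = mass w * ((\<Sum>a\<in>kids w. cyl_len (w @ [a])) / (\<Sum>a'\<in>kids w. cyl_len (w @ [a'])))"
    unfolding mass_snoc ratio_def by (simp flip: sum_distrib_left sum_divide_distrib)
  then show ?thesis using kids_sum_pos[OF assms] by simp
qed

lemma sum_mass_level: "(\<Sum>w\<in>level k. mass w) = 1"
proof (induction k)
  case 0
  have "level 0 = {[]}" using Nil by (auto simp: level_def)
  then show ?case by (simp add: mass_Nil)
next
  case (Suc k)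
  then show ?case unfolding sum_level_Suc by (simp add: sum_mass_kids level_def)
qed

lemma sum_mass_prefix:
  assumes u: "u \<in> T"
  shows "(\<Sum>w\<in>{w \<in> level (length u + k). take (length u) w = u}. mass w) = mass u"
proof (induction k)
  case 0
  have "{w \<in> level (length u + 0). take (length u) w = u} = {u}" using u by (auto simp: level_def)
  then show ?case by simp
next
  case (Suc k)
  define F where "F w = (if take (length u) w = u then mass w else 0)" for w
  have conv: "(\<Sum>w\<in>{w \<in> level j. take (length u) w = u}. mass w) = (\<Sum>w\<in>level j. F w)" for j
    unfolding F_def by (subst sum.inter_filter[symmetric]) (simp_all add: finite_level)
  have "(\<Sum>w\<in>level (length u + Suc k). F w) = (\<Sum>w\<in>level (length u + k). \<Sum>a\<in>kids w. F (w @ [a]))"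
    by (simp add: sum_level_Suc)
  also have "\<dots> = (\<Sum>w\<in>level (length u + k). F w)"
  proof (intro sum.cong refl)
    fix w assume w: "w \<in> level (length u + k)"
    then have "take (length u) (w @ [a]) = take (length u) w" for a by (simp add: level_def)
    then show "(\<Sum>a\<in>kids w. F (w @ [a])) = F w"
      using w sum_mass_kids[of w] by (auto simp: F_def level_def)
  qed
  finally show ?case using Suc unfolding conv by simp
qed

lemma \<rho>1: "\<rho> \<ge> 1"
  using M unfolding \<rho>_def by (intro one_le_power) (simp add: field_simps)

text \<open>At each step the quotient of mass and length is multiplied by the length of the node
  over that of its surviving children. This is at most (M + 2) / M if all digits survive, and at
  most (M + 2)^2 if only one is known to survive.\<close>

lemma mass_le_aux:
  assumes "w \<in> T"
  shows "mass w \<le> cyl_len w * ((real M + 2) / real M) ^ length w *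
    ((real M + 2)\<^sup>2) ^ card {i. i < length w \<and> (\<exists>a\<in>{1..M}. take i w @ [a] \<notin> T)}"
  using assms
proof (induction w rule: rev_induct)
  case Nil
  then show ?case by (simp add: mass_Nil)
next
  case (snoc a w)
  have w: "w \<in> T" using prefix snoc.prems by blast
  define A where "A = {i. i < length w \<and> (\<exists>a\<in>{1..M}. take i w @ [a] \<notin> T)}"
  define B where "B = {i. i < length (w @ [a]) \<and> (\<exists>a'\<in>{1..M}. take i (w @ [a]) @ [a'] \<notin> T)}"
  define r where "r = (real M + 2) / real M"
  have r1: "r \<ge> 1" using M by (simp add: r_def field_simps)
  have B: "B = A \<union> (if kids w = {1..M} then {} else {length w})"
  proof -
    have "kids w = {1..M} \<longleftrightarrow> (\<forall>a\<in>{1..M}. w @ [a] \<in> T)" using kids_sub[OF w] by (auto simp: kids_def)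
    then show ?thesis by (auto simp: B_def A_def less_Suc_eq)
  qed
  have finA: "finite A" "length w \<notin> A" by (auto simp: A_def)
  have IH: "mass w \<le> cyl_len w * r ^ length w * ((real M + 2)\<^sup>2) ^ card A"
    using snoc.IH[OF w] by (simp add: A_def r_def)
  have cw: "cyl_len w > 0" "cyl_len (w @ [a]) > 0" using cyl_len_pos pos w snoc.prems by auto
  define \<sigma> where "\<sigma> = (\<Sum>a'\<in>kids w. cyl_len (w @ [a']))"
  have \<sigma>0: "\<sigma> > 0" unfolding \<sigma>_def by (rule kids_sum_pos[OF w])
  have bound: "cyl_len w / \<sigma> * ((real M + 2)\<^sup>2) ^ card A \<le> r * ((real M + 2)\<^sup>2) ^ card B"
  proof (cases "kids w = {1..M}")
    case True
    then have "real M / (real M + 2) * cyl_len w \<le> \<sigma>"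
      unfolding \<sigma>_def using sum_cyl_len_children[OF pos[OF w], of M] by simp
    then have "cyl_len w / \<sigma> \<le> r" using \<sigma>0 M unfolding r_def by (simp add: field_simps)
    then show ?thesis using True B by (intro mult_mono) (auto simp: r1 order.trans[OF zero_le_one r1])
  next
    case False
    obtain a' where a': "a' \<in> kids w" using kids_nonempty[OF w] by blast
    then have a'M: "1 \<le> a'" "a' \<le> M" using kids_sub[OF w] by auto
    have "cyl_len w / (real M + 2)\<^sup>2 \<le> cyl_len (w @ [a'])"
      by (rule cyl_len_child_ge[OF pos[OF w] a'M])
    also have "\<dots> \<le> \<sigma>" unfolding \<sigma>_def
      using a' finite_kids[OF w] by (intro member_le_sum less_imp_le cyl_len_pos pos) (auto simp: kids_def)
    finally have "cyl_len w / \<sigma> \<le> (real M + 2)\<^sup>2" using \<sigma>0 by (simp add: field_simps)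
    then have "cyl_len w / \<sigma> * ((real M + 2)\<^sup>2) ^ card A \<le> (real M + 2)\<^sup>2 * ((real M + 2)\<^sup>2) ^ card A"
      by (intro mult_right_mono) auto
    also have "\<dots> = ((real M + 2)\<^sup>2) ^ card B" using False B finA by simp
    also have "\<dots> \<le> r * ((real M + 2)\<^sup>2) ^ card B" using mult_right_mono[OF r1, of "((real M + 2)\<^sup>2) ^ card B"] by simp
    finally show ?thesis .
  qed
  have "mass (w @ [a]) = mass w * (cyl_len (w @ [a]) / \<sigma>)" by (simp add: mass_snoc ratio_def \<sigma>_def)
  also have "\<dots> \<le> (cyl_len w * r ^ length w * ((real M + 2)\<^sup>2) ^ card A) * (cyl_len (w @ [a]) / \<sigma>)"
    using IH cw \<sigma>0 by (intro mult_right_mono) auto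
  also have "\<dots> = (cyl_len (w @ [a]) * r ^ length w) * (cyl_len w / \<sigma> * ((real M + 2)\<^sup>2) ^ card A)" by simp
  also have "\<dots> \<le> (cyl_len (w @ [a]) * r ^ length w) * (r * ((real M + 2)\<^sup>2) ^ card B)"
    using bound cw r1 by (intro mult_left_mono) auto
  finally show ?case by (simp add: B_def r_def mult_ac)
qed

text \<open>Alphabet cutoff and restricted nodes each contribute ((M + 2) / M) ^ k, together \<rho>
  ^ k. The cylinder has length at most 2 ^ -(k - 1), so \<rho> ^ (k - 1) is at most its length to
  the power - ln \<rho> / ln 2; hence \<open>dim_exp\<close>.\<close>

lemma mass_le:
  assumes w: "w \<in> T"
  shows "mass w \<le> \<rho> * cyl_len w powr dim_exp"
proof -
  define k where "k = length w"
  define F where "F = card {i. i < length w \<and> (\<exists>a\<in>{1..M}. take i w @ [a] \<notin> T)}"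
  define r where "r = (real M + 2) / real M"
  have r1: "r \<ge> 1" using M by (simp add: r_def field_simps)
  have c: "cyl_len w > 0" "cyl_len w \<le> 1 / 2 ^ (k - 1)"
    using cyl_len_pos[OF pos[OF w]] cyl_len_le_pow2[OF pos[OF w]] by (auto simp: k_def)
  have "((real M + 2)\<^sup>2) ^ F = (real M + 2) ^ (2 * F)" by (rule power_mult[symmetric])
  also have "\<dots> = (real M + 2) powr real (2 * F)" by (rule powr_realpow[symmetric]) simp
  also have "\<dots> = (real M + 2) powr (2 * real F)" by simp
  also have "\<dots> \<le> (real M + 2) powr (2 * (e * real k))"
    using sparse[OF w] by (intro powr_mono) (auto simp: F_def k_def)
  also have "\<dots> = ((real M + 2) powr (2 * e)) powr real k" by (simp add: powr_powr mult.assoc)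
  also have "\<dots> = ((real M + 2) powr (2 * e)) ^ k" by (simp add: powr_realpow)
  also have "\<dots> \<le> r ^ k" using e by (intro power_mono) (auto simp: r_def)
  finally have F: "((real M + 2)\<^sup>2) ^ F \<le> r ^ k" .
  have "mass w \<le> cyl_len w * r ^ k * ((real M + 2)\<^sup>2) ^ F"
    using mass_le_aux[OF w] by (simp add: k_def F_def r_def)
  also have "\<dots> \<le> cyl_len w * r ^ k * r ^ k" using F c r1 by (intro mult_left_mono) auto
  also have "\<dots> = cyl_len w * \<rho> ^ k"
    by (simp add: \<rho>_def r_def[symmetric] power2_eq_square power_mult_distrib)
  also have "\<rho> ^ k \<le> \<rho> * (1 / cyl_len w) powr (1 - dim_exp)"
  proof -
    have "\<rho> ^ k \<le> \<rho> ^ (1 + (k - 1))" using \<rho>1 by (intro power_increasing) auto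
    also have "\<dots> = \<rho> * \<rho> ^ (k - 1)" by simp
    also have "\<rho> ^ (k - 1) = (2 ^ (k - 1)) powr (1 - dim_exp)"
    proof -
      have "\<rho> = 2 powr (1 - dim_exp)" using \<rho>1 by (simp add: dim_exp_def powr_def)
      then have "\<rho> ^ (k - 1) = (2 powr (1 - dim_exp)) powr real (k - 1)" by (simp add: powr_realpow)
      also have "\<dots> = (2 powr real (k - 1)) powr (1 - dim_exp)" by (simp add: powr_powr mult.commute)
      finally show ?thesis by (simp add: powr_realpow)
    qed
    also have "(2 ^ (k - 1)) powr (1 - dim_exp) \<le> (1 / cyl_len w) powr (1 - dim_exp)"
    proof (intro powr_mono2)
      show "2 ^ (k - 1) \<le> 1 / cyl_len w" using c by (simp add: field_simps)
      show "0 \<le> 1 - dim_exp" using \<rho>1 by (simp add: dim_exp_def)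
    qed auto
    finally show ?thesis using \<rho>1 by simp
  qed
  then have "cyl_len w * \<rho> ^ k \<le> cyl_len w * (\<rho> * (1 / cyl_len w) powr (1 - dim_exp))"
    using c by (intro mult_left_mono) auto
  also have "\<dots> = \<rho> * cyl_len w powr dim_exp"
    using c by (simp add: powr_divide powr_diff)
  finally show ?thesis .
qed

text \<open>6 is the length of [x - 3 D, x + 3 D] over D, \<rho> comes from \<open>mass_le\<close>,
  and (M + 2)^2 from stopping one digit too late.\<close>

definition cover_const :: real where "cover_const = 6 * \<rho> * (real M + 2)\<^sup>2"

lemma cover_const_ge_1: "cover_const \<ge> 1"
proof -
  have "1 * 1 \<le> \<rho> * (real M + 2)\<^sup>2" using \<rho>1 by (intro mult_mono one_le_power) auto
  then show ?thesis by (simp add: cover_const_def)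
qed

text \<open>Each word of level \<open>k\<close> that meets the ball passes through its first prefix with a cylinder of
  length at most \<open>D\<close>; these prefixes have disjoint cylinders of length comparable to \<open>D\<close>.\<close>
lemma local_mass_le:
  assumes D: "D > 0" and dim_exp: "dim_exp > 0" and k: "1 / 2 ^ (k - 1) \<le> D"
  shows "(\<Sum>w\<in>{w \<in> level k. cfval w ` {0..1} \<inter> ball x D \<noteq> {}}. mass w) \<le> cover_const * D powr dim_exp"
proof (cases "D \<ge> 1")
  case True
  have "(\<Sum>w\<in>{w \<in> level k. cfval w ` {0..1} \<inter> ball x D \<noteq> {}}. mass w) \<le> (\<Sum>w\<in>level k. mass w)"
    by (intro sum_mono2) (auto simp: finite_level mass_nonneg_level)
  also have "\<dots> = 1 * 1" by (simp add: sum_mass_level)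
  also have "\<dots> \<le> cover_const * D powr dim_exp"
    using cover_const_ge_1 True dim_exp by (intro mult_mono ge_one_powr_ge_zero) auto
  finally show ?thesis .
next
  case False
  define W where "W = {w \<in> level k. cfval w ` {0..1} \<inter> ball x D \<noteq> {}}"
  define p where "p w = (LEAST j. cyl_len (take j w) \<le> D)" for w
  define A where "A = (\<lambda>w. take (p w) w) ` W"
  have finW: "finite W" using finite_level by (auto simp: W_def)
  then have finA: "finite A" by (simp add: A_def)
  have WT: "w \<in> T" "length w = k" if "w \<in> W" for w using that by (auto simp: W_def level_def)
  have pw: "cyl_len (take (p w) w) \<le> D" "p w \<le> k" "p w \<noteq> 0"
    "\<And>j. j < p w \<Longrightarrow> D < cyl_len (take j w)" if "w \<in> W" for w
  proof -
    have "cyl_len (take k w) \<le> D"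
      using cyl_len_le_pow2[OF pos[OF WT(1)[OF that]]] k WT(2)[OF that] by simp
    then show "cyl_len (take (p w) w) \<le> D" "p w \<le> k"
      unfolding p_def by (auto intro: LeastI Least_le)
    then show "p w \<noteq> 0" using False by (metis cyl_len_Nil take0)
    show "D < cyl_len (take j w)" if "j < p w" for j using not_less_Least[of j "\<lambda>j. cyl_len (take j w) \<le> D"] that
      by (auto simp: p_def)
  qed
  have A: "u \<in> T" "cyl_len u \<le> D" "D / (real M + 2)\<^sup>2 \<le> cyl_len u" "length u \<le> k" if uA: "u \<in> A" for u
  proof -
    obtain w where w: "w \<in> W" "u = take (p w) w" using uA by (auto simp: A_def)
    show "u \<in> T" using take_in_T WT w by simp
    show "cyl_len u \<le> D" "length u \<le> k" using pw(1,2)[OF w(1)] w(2) by auto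
    obtain j where j: "p w = Suc j" using pw(3)[OF w(1)] by (cases "p w") auto
    then have jk: "j < length w" using pw(2)[OF w(1)] WT(2)[OF w(1)] by simp
    then have u: "u = take j w @ [w ! j]" using j w(2) by (simp add: take_Suc_conv_app_nth)
    have "w ! j \<in> {1..M}" using digits[OF WT(1)[OF w(1)]] jk by (meson nth_mem subsetD)
    then have "cyl_len (take j w) / (real M + 2)\<^sup>2 \<le> cyl_len u"
      unfolding u by (intro cyl_len_child_ge pos take_in_T WT(1)[OF w(1)]) auto
    moreover have "D / (real M + 2)\<^sup>2 \<le> cyl_len (take j w) / (real M + 2)\<^sup>2"
      using pw(4)[OF w(1), of j] j by (intro divide_right_mono) auto
    ultimately show "D / (real M + 2)\<^sup>2 \<le> cyl_len u" by linarith
  qed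
  \<comment> \<open>If two stopped cylinders meet in an interior point, the shorter word is a prefix
    of the longer one. Its cylinder is already of length at most D, so minimality of the stopping
    place gives equality.\<close>
  have anti: "u = v" if uv: "u \<in> A" "v \<in> A" "length u \<le> length v"
    "0 < t" "t < 1" "0 < t'" "t' < 1" "cfval u t = cfval v t'" for u v t t'
  proof -
    define v1 v2 where "v1 = take (length u) v" and "v2 = drop (length u) v"
    have v: "v = v1 @ v2" by (simp add: v1_def v2_def)
    have pv: "0 \<notin> set v1" "0 \<notin> set v2" using pos[OF A(1)[OF uv(2)]] unfolding v by auto
    have t2: "0 < cfval v2 t' \<and> cfval v2 t' < 1" by (rule cfval_open[OF pv(2) uv(6,7)])
    have "cfval u t = cfval v1 (cfval v2 t')" using uv(8) v by (metis cfval_append)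
    moreover have "length u = length v1" using uv(3) by (simp add: v1_def)
    ultimately have eq: "u = v1"
      using uv(4,5) pv(1) t2 pos[OF A(1)[OF uv(1)]] by (intro cfval_inj[of u v1 t "cfval v2 t'"]) auto
    obtain w where w: "w \<in> W" "v = take (p w) w" using uv(2) by (auto simp: A_def)
    have eq': "u = take (length u) v" using eq unfolding v1_def .
    have lv: "length v = p w" using pw(2)[OF w(1)] WT(2)[OF w(1)] w(2) by simp
    have "\<not> length u < p w"
    proof
      assume lt: "length u < p w"
      have "take (length u) v = take (length u) w" unfolding w(2) using lt by (simp add: min_def)
      then have "take (length u) w = u" by (rule trans[OF sym eq'[symmetric]])
      then show False using pw(4)[OF w(1) lt] A(2)[OF uv(1)] by simp
    qed
    then have "take (length u) v = v" using uv(3) lv by simp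
    then show ?thesis by (rule trans[OF eq'])
  qed
  \<comment> \<open>Each cylinder of A has a point within D of x, and any two of its points are at
    most 2 D apart.\<close>
  have sumA: "(\<Sum>u\<in>A. cyl_len u) \<le> 6 * D"
  proof -
    have "(\<Sum>u\<in>A. cyl_len u) = (\<Sum>u\<in>A. \<bar>cfval u 1 - cfval u 0\<bar>)"
      by (intro sum.cong refl) (simp add: cyl_len_eq pos A(1))
    also have "\<dots> \<le> measure lebesgue {x - 3 * D..x + 3 * D}"
    proof (rule sum_image_lengths_le[OF finA])
      show "continuous_on {0..1} (cfval u)" if "u \<in> A" for u
        using continuous_on_cfval[OF pos[OF A(1)[OF that]]] .
      show "u = v" if "u \<in> A" "v \<in> A" "0 < t" "t < 1" "0 < t'" "t' < 1" "cfval u t = cfval v t'" for u v t t'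
        using anti[of u v t t'] anti[of v u t' t] that by (cases "length u \<le> length v") auto
      show "cfval u t \<in> {x - 3 * D..x + 3 * D}" if u: "u \<in> A" and t: "0 < t" "t < 1" for u t
      proof -
        obtain w where w: "w \<in> W" "u = take (p w) w" using u by (auto simp: A_def)
        have "cfval w ` {0..1} \<inter> ball x D \<noteq> {}" using w(1) by (simp add: W_def)
        then obtain t' where t': "t' \<in> {0..1}" "cfval w t' \<in> ball x D" by blast
        define z where "z = cfval (drop (p w) w) t'"
        have "0 \<notin> set (drop (p w) w)" using pos[OF WT(1)[OF w(1)]] by (meson in_set_dropD)
        then have z: "z \<in> {0..1}" using cfval_bounds[of "drop (p w) w" t'] t' by (auto simp: z_def)
        have "cfval w t' = cfval u z" unfolding z_def w(2) cfval_append[symmetric] by simp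
        moreover have "\<bar>cfval u t - cfval u z\<bar> \<le> 2 * cyl_len u"
          using t z by (intro cfval_in_cyl_close pos A(1)[OF u]) auto
        ultimately have "\<bar>cfval u t - x\<bar> \<le> 3 * D"
          using t'(2) A(2)[OF u] by (auto simp: dist_real_def abs_le_iff)
        then show ?thesis by (auto simp: abs_le_iff)
      qed
    qed auto
    also have "\<dots> = 6 * D" using D by simp
    finally show ?thesis .
  qed
  have "(\<Sum>w\<in>W. mass w) \<le> (\<Sum>w\<in>(\<Union>u\<in>A. {w \<in> level k. take (length u) w = u}). mass w)"
  proof (intro sum_mono2)
    show "finite (\<Union>u\<in>A. {w \<in> level k. take (length u) w = u})" using finA finite_level by auto
    show "W \<subseteq> (\<Union>u\<in>A. {w \<in> level k. take (length u) w = u})"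
    proof
      fix w assume w: "w \<in> W"
      have "take (length (take (p w) w)) w = take (p w) w" by (auto simp: min_def)
      then show "w \<in> (\<Union>u\<in>A. {w \<in> level k. take (length u) w = u})"
        using w by (auto simp: A_def W_def)
    qed
  qed (auto simp: mass_nonneg_level)
  also have "\<dots> \<le> (\<Sum>u\<in>A. \<Sum>w\<in>{w \<in> level k. take (length u) w = u}. mass w)"
    by (rule sum_UN_le) (auto simp: finA finite_level mass_nonneg_level)
  also have "\<dots> = (\<Sum>u\<in>A. mass u)"
  proof (intro sum.cong refl)
    fix u assume u: "u \<in> A"
    show "(\<Sum>w\<in>{w \<in> level k. take (length u) w = u}. mass w) = mass u"
      using sum_mass_prefix[OF A(1)[OF u], of "k - length u"] A(4)[OF u] by simp
  qed
  also have "\<dots> \<le> (\<Sum>u\<in>A. (\<rho> * (D powr (dim_exp - 1) * (real M + 2)\<^sup>2)) * cyl_len u)"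
  proof (intro sum_mono)
    fix u assume u: "u \<in> A"
    have cu: "cyl_len u > 0" using cyl_len_pos pos A(1)[OF u] by auto
    have s1: "dim_exp - 1 \<le> 0" "0 \<le> 1 - dim_exp" "1 - dim_exp \<le> 1" using \<rho>1 dim_exp by (auto simp: dim_exp_def)
    \<comment> \<open>One factor of the length is split off to be summed over A. The remaining
      exponent is nonpositive, so the lower bound D / (M + 2)^2 on the length applies.\<close>
    have "cyl_len u powr dim_exp = cyl_len u powr (dim_exp - 1) * cyl_len u" using cu by (simp add: powr_diff)
    also have "cyl_len u powr (dim_exp - 1) \<le> (D / (real M + 2)\<^sup>2) powr (dim_exp - 1)"
      using A(3)[OF u] s1 D by (intro powr_mono2') auto
    also have "\<dots> = D powr (dim_exp - 1) * ((real M + 2)\<^sup>2) powr (1 - dim_exp)"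
      using D by (simp add: powr_divide powr_diff field_simps)
    also have "\<dots> \<le> D powr (dim_exp - 1) * ((real M + 2)\<^sup>2) powr 1"
      using s1 by (intro mult_left_mono powr_mono one_le_power) auto
    finally have "cyl_len u powr dim_exp \<le> (D powr (dim_exp - 1) * (real M + 2)\<^sup>2) * cyl_len u"
      using cu by simp
    then have "\<rho> * cyl_len u powr dim_exp \<le> \<rho> * ((D powr (dim_exp - 1) * (real M + 2)\<^sup>2) * cyl_len u)"
      using \<rho>1 by (intro mult_left_mono) auto
    then show "mass u \<le> (\<rho> * (D powr (dim_exp - 1) * (real M + 2)\<^sup>2)) * cyl_len u"
      using mass_le[OF A(1)[OF u]] by (simp add: mult.assoc)
  qed
  also have "\<dots> = (\<rho> * (D powr (dim_exp - 1) * (real M + 2)\<^sup>2)) * (\<Sum>u\<in>A. cyl_len u)"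
    by (simp add: sum_distrib_left)
  also have "\<dots> \<le> (\<rho> * (D powr (dim_exp - 1) * (real M + 2)\<^sup>2)) * (6 * D)"
    using sumA \<rho>1 by (intro mult_left_mono) auto
  also have "\<dots> = cover_const * D powr dim_exp"
    using D by (simp add: cover_const_def powr_diff)
  finally show ?thesis unfolding W_def .
qed

lemma cylinders_mono: "(\<Union>w\<in>level (Suc k). cfval w ` {0..1}) \<subseteq> (\<Union>w\<in>level k. cfval w ` {0..1})"
proof
  fix x assume "x \<in> (\<Union>w\<in>level (Suc k). cfval w ` {0..1})"
  then obtain w a t where w: "w \<in> level k" "w @ [a] \<in> T" and t: "t \<in> {0..1}" "x = cfval (w @ [a]) t"
    unfolding level_Suc by (auto simp: kids_def)
  have "0 \<notin> set [a]" using pos[OF w(2)] by auto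
  then have "cfval [a] t \<in> {0..1}" using cfval_bounds[of "[a]" t] t(1) by auto
  moreover have "x = cfval w (cfval [a] t)" using t(2) by (simp only: cfval_append)
  ultimately show "x \<in> (\<Union>w\<in>level k. cfval w ` {0..1})" using w(1) by blast
qed

text \<open>The limit set is a nested intersection of compact sets, so an open cover of it covers
  some whole level, by finitely many balls. At a level finer than all their radii, the total mass 1
  is distributed over the balls and \<open>local_mass_le\<close> bounds each share.\<close>

lemma cover_sum_ge:
  assumes dim_exp: "dim_exp > 0" and D: "\<And>i::nat. D i > 0" and cover: "limit_set \<subseteq> (\<Union>i. ball (x i) (D i))"
  shows "\<exists>I. finite I \<and> 1 \<le> cover_const * (\<Sum>i\<in>I. D i powr dim_exp)"
proof -
  define K where "K k = (\<Union>w\<in>level k. cfval w ` {0..1})" for k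
  define V where "V = (\<Union>i. ball (x i) (D i))"
  have Kc: "compact (K k)" for k unfolding K_def
    by (intro compact_UN finite_level compact_continuous_image continuous_on_cfval pos) (auto simp: level_def)
  have KS: "K (Suc n) \<subseteq> K n" for n unfolding K_def by (rule cylinders_mono)
  have Kmono: "K n \<subseteq> K m" if "m \<le> n" for m n
    using that by (induction n rule: dec_induct) (use KS in blast)+
  have oV: "open V" by (auto simp: V_def)
  have "\<exists>k. K k - V = {}"
  proof (rule ccontr)
    assume "\<nexists>k. K k - V = {}"
    then have "\<Inter>(range (\<lambda>k. K k - V)) \<noteq> {}"
      using Kmono by (intro compact_nest compact_diff Kc oV) auto
    then show False using cover by (auto simp: limit_set_def K_def V_def)
  qed
  then obtain k0 where k0: "K k0 \<subseteq> V" by auto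
  then have "K k0 \<subseteq> \<Union>((\<lambda>i. ball (x i) (D i)) ` UNIV)" by (simp add: V_def)
  from compactE_image[OF Kc _ this] obtain I where I: "finite I" "K k0 \<subseteq> (\<Union>i\<in>I. ball (x i) (D i))"
    by (metis open_ball)
  have "\<exists>\<delta>>0. \<forall>i\<in>I. \<delta> \<le> D i" using I(1) D
  proof (induction I rule: finite_induct)
    case (insert i I)
    then obtain \<delta> where "\<delta> > 0" "\<forall>i\<in>I. \<delta> \<le> D i" by blast
    then show ?case using D[of i] by (intro exI[of _ "min \<delta> (D i)"]) auto
  qed (auto intro: exI[of _ 1])
  then obtain \<delta> where \<delta>: "\<delta> > 0" "\<forall>i\<in>I. \<delta> \<le> D i" by blast
  obtain j where j: "(1 / 2) ^ j < \<delta>" using real_arch_pow_inv[of \<delta> "1/2"] \<delta> by auto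
  define k where "k = max k0 (Suc j)"
  have kD: "1 / 2 ^ (k - 1) \<le> D i" if "i \<in> I" for i
  proof -
    have "(1 / 2 :: real) ^ (k - 1) \<le> (1 / 2) ^ j" by (intro power_decreasing) (auto simp: k_def)
    then show ?thesis using j \<delta> that by (force simp: power_one_over)
  qed
  have "K k \<subseteq> (\<Union>i\<in>I. ball (x i) (D i))" using I(2) Kmono[of k0 k] by (auto simp: k_def)
  then have sub: "level k \<subseteq> (\<Union>i\<in>I. {w \<in> level k. cfval w ` {0..1} \<inter> ball (x i) (D i) \<noteq> {}})"
    unfolding K_def by (fastforce intro: exI[of _ "0::real"])
  have "1 = (\<Sum>w\<in>level k. mass w)" by (simp add: sum_mass_level)
  also have "\<dots> \<le> (\<Sum>w\<in>(\<Union>i\<in>I. {w \<in> level k. cfval w ` {0..1} \<inter> ball (x i) (D i) \<noteq> {}}). mass w)"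
    using sub I(1) by (intro sum_mono2) (auto simp: finite_level mass_nonneg_level)
  also have "\<dots> \<le> (\<Sum>i\<in>I. \<Sum>w\<in>{w \<in> level k. cfval w ` {0..1} \<inter> ball (x i) (D i) \<noteq> {}}. mass w)"
    by (rule sum_UN_le) (auto simp: I finite_level mass_nonneg_level)
  also have "\<dots> \<le> (\<Sum>i\<in>I. cover_const * D i powr dim_exp)"
    by (intro sum_mono local_mass_le D dim_exp kD)
  finally show ?thesis using I(1) by (intro exI[of _ I]) (simp add: sum_distrib_left)
qed

text \<open>Mass distribution principle: a cover of too small total power would contradict
  \<open>cover_sum_ge\<close>. The bound is stated for supersets H because it is applied to a union
  of limit sets.\<close>

lemma limit_set_hausdorff_dim:
  assumes sub: "limit_set \<subseteq> H" and dim_exp: "dim_exp > 0"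
  shows "ennreal dim_exp \<le> hausdorff_dim H"
  unfolding hausdorff_dim_def
proof (intro INF_greatest)
  fix s' assume s': "s' \<in> {s'. 0 \<le> s' \<and> hausdorff_measure s' H = 0}"
  \<comment> \<open>Half of the minimal total 1 / \<open>cover_const\<close>; the other half is
    reserved for enlarging the pieces to open balls.\<close>
  define c where "c = 1 / (2 * cover_const)"
  have c: "c > 0" using cover_const_ge_1 by (simp add: c_def)
  have "dim_exp < s'"
  proof (rule ccontr)
    assume "\<not> dim_exp < s'"
    then have ss: "0 \<le> s'" "s' \<le> dim_exp" using s' by auto
    have "hausdorff_pre_measure s' 1 H \<le> hausdorff_measure s' H"
      unfolding hausdorff_measure_def by (intro SUP_upper) auto
    then have "hausdorff_pre_measure s' 1 H = 0" using s' by simp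
    then have "hausdorff_pre_measure s' 1 H < ennreal c" using c by simp
    then obtain U :: "nat \<Rightarrow> real set" where U: "H \<subseteq> (\<Union>i. U i)" "\<And>i. bounded (U i)" "\<And>i. diameter (U i) \<le> 1"
      and sum: "(\<Sum>i. diam_pow s' (U i)) < ennreal c"
      unfolding hausdorff_pre_measure_def INF_less_iff by auto
    define d where "d i = diameter (U i)" for i
    have d0: "0 \<le> d i" for i using diameter_ge_0[OF U(2)] by (simp add: d_def)
    \<comment> \<open>Diameters are at most 1, so lowering the exponent only increases the powers.
      The case s' = 0 is separate because \<open>diam_pow\<close> then counts each nonempty piece as
      1.\<close>
    have dp: "ennreal (d i powr dim_exp) \<le> diam_pow s' (U i)" for i
    proof (cases "s' = 0 \<and> U i \<noteq> {}")
      case True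
      have "d i powr dim_exp \<le> 1 powr dim_exp" using d0 U(3) dim_exp by (intro powr_mono2) (auto simp: d_def)
      then show ?thesis using True by (simp add: diam_pow_def)
    next
      case False
      have "d i powr dim_exp \<le> d i powr s'"
      proof (cases "d i = 0")
        case nz: False
        then show ?thesis using ss d0[of i] U(3)[of i] by (intro powr_mono') (auto simp: d_def)
      qed simp
      then show ?thesis using False by (auto simp: diam_pow_def d_def intro!: ennreal_leI)
    qed
    \<comment> \<open>Radii strictly above the diameters give open balls containing the pieces, also
      when a diameter is 0. The excesses c / 2 ^ (i + 1) sum to c.\<close>
    have "\<exists>D>d i. D powr dim_exp < d i powr dim_exp + c * (1 / 2) ^ Suc i" for i
    proof -
      have "((\<lambda>x. x powr dim_exp) \<longlongrightarrow> d i powr dim_exp) (at_right (d i))"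
      proof (intro tendsto_powr' tendsto_intros disjI2 conjI)
        show "eventually (\<lambda>x. 0 \<le> x) (at_right (d i))"
          using eventually_at_right_less[of "d i"] by eventually_elim (use d0[of i] in linarith)
      qed (use dim_exp in auto)
      then have "eventually (\<lambda>x. x powr dim_exp < d i powr dim_exp + c * (1 / 2) ^ Suc i) (at_right (d i))"
        by (rule order_tendstoD) (use c in simp)
      then have "eventually (\<lambda>x. x powr dim_exp < d i powr dim_exp + c * (1 / 2) ^ Suc i \<and> d i < x) (at_right (d i))"
        by (intro eventually_conj eventually_at_right_less)
      then show ?thesis using eventually_happens'[OF trivial_limit_at_right_real] by blast
    qed
    then obtain D where D: "\<And>i. D i > d i" "\<And>i. D i powr dim_exp < d i powr dim_exp + c * (1 / 2) ^ Suc i" by metis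
    define x where "x i = (SOME y. y \<in> U i)" for i
    have "U i \<subseteq> ball (x i) (D i)" for i
    proof
      fix y assume y: "y \<in> U i"
      then have "x i \<in> U i" unfolding x_def by (rule someI)
      then have "dist (x i) y \<le> d i" unfolding d_def using y by (intro diameter_bounded_bound U(2))
      then show "y \<in> ball (x i) (D i)" using D(1)[of i] by simp
    qed
    then have "(\<Union>i. U i) \<subseteq> (\<Union>i. ball (x i) (D i))" by (intro UN_mono order.refl)
    then have cov: "limit_set \<subseteq> (\<Union>i. ball (x i) (D i))"
      by (rule order.trans[OF order.trans[OF sub U(1)]])
    have D0: "D i > 0" for i using D(1)[of i] d0[of i] by linarith
    obtain I where I: "finite I" "1 \<le> cover_const * (\<Sum>i\<in>I. D i powr dim_exp)"
      using cover_sum_ge[OF dim_exp D0 cov] by blast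
    have "ennreal (\<Sum>i\<in>I. d i powr dim_exp) = (\<Sum>i\<in>I. ennreal (d i powr dim_exp))" by (simp add: sum_ennreal)
    also have "\<dots> \<le> (\<Sum>i\<in>I. diam_pow s' (U i))" by (intro sum_mono dp)
    also have "\<dots> \<le> (\<Sum>i. diam_pow s' (U i))" using I(1) by (intro sum_le_suminf) auto
    finally have "ennreal (\<Sum>i\<in>I. d i powr dim_exp) < ennreal c" using sum by order
    then have 1: "(\<Sum>i\<in>I. d i powr dim_exp) < c" by (simp add: ennreal_less_iff sum_nonneg)
    have "(\<Sum>i\<in>I. (1 / 2 :: real) ^ Suc i) \<le> (\<Sum>i. (1 / 2) ^ Suc i)"
      using I(1) power_half_series by (intro sum_le_suminf) (auto simp: sums_iff)
    also have "\<dots> = 1" using power_half_series by (simp add: sums_iff)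
    finally have "c * (\<Sum>i\<in>I. (1 / 2) ^ Suc i) \<le> c * 1" using c by (intro mult_left_mono) auto
    moreover have "(\<Sum>i\<in>I. D i powr dim_exp) \<le> (\<Sum>i\<in>I. d i powr dim_exp + c * (1 / 2) ^ Suc i)"
      using D(2) by (intro sum_mono less_imp_le)
    moreover have "(\<Sum>i\<in>I. d i powr dim_exp + c * (1 / 2) ^ Suc i) = (\<Sum>i\<in>I. d i powr dim_exp) + c * (\<Sum>i\<in>I. (1 / 2) ^ Suc i)"
      by (simp add: sum.distrib sum_distrib_left)
    ultimately have "(\<Sum>i\<in>I. D i powr dim_exp) < 2 * c" using 1 by linarith
    then have "cover_const * (\<Sum>i\<in>I. D i powr dim_exp) < cover_const * (2 * c)"
      using cover_const_ge_1 by (intro mult_strict_left_mono) auto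
    also have "\<dots> = 1" using cover_const_ge_1 by (simp add: c_def)
    finally show False using I(2) by simp
  qed
  then show "ennreal dim_exp \<le> ennreal s'" by (intro ennreal_leI) simp
qed

end

text \<open>Covering by N intervals of length 1 / N has total power N ^ -\<epsilon> in exponent 1 +
  \<epsilon>, which tends to 0; the remaining pieces of the sequence are empty.\<close>

lemma hausdorff_dim_unit_interval_le:
  fixes G :: "real set"
  assumes "G \<subseteq> {0..1}"
  shows "hausdorff_dim G \<le> 1"
proof (rule ennreal_le_epsilon)
  fix \<epsilon> :: real assume \<epsilon>: "\<epsilon> > 0"
  have "hausdorff_measure (1 + \<epsilon>) G = 0"
  proof -
    have "hausdorff_pre_measure (1 + \<epsilon>) r G \<le> 0" if r: "r > 0" for r
    proof -
      have "hausdorff_pre_measure (1 + \<epsilon>) r G \<le> ennreal (real N powr (- \<epsilon>))" if N: "1 / r \<le> real N" "N \<ge> 1" for N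
      proof -
        define U where "U i = (if i < N then {real i / N..(real i + 1) / N} else {})" for i :: nat
        have diam: "diameter (U i) = (if i < N then 1 / N else 0)" for i
        proof -
          have "real i / N \<le> (real i + 1) / N" by (intro divide_right_mono) auto
          then show ?thesis by (auto simp: U_def diff_divide_distrib[symmetric])
        qed
        have cov: "G \<subseteq> (\<Union>i. U i)"
        proof
          fix x assume "x \<in> G"
          then have x: "0 \<le> x" "x \<le> 1" using assms by auto
          show "x \<in> (\<Union>i. U i)"
          proof (cases "x = 1")
            case True
            have "x \<in> U (N - 1)" using True N by (auto simp: U_def field_simps of_nat_diff)
            then show ?thesis by blast
          next
            case False
            define i where "i = nat \<lfloor>N * x\<rfloor>"
            have i: "real i \<le> N * x" "N * x < real i + 1" using x by (auto simp: i_def)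
            have "N * x < N" using x False N by simp
            then have "i < N" using i by linarith
            then have "x \<in> U i" using i N by (auto simp: U_def field_simps)
            then show ?thesis by blast
          qed
        qed
        have bd: "bounded (U i) \<and> diameter (U i) \<le> r" for i
        proof -
          have "1 / real N \<le> r" using N r by (simp add: field_simps)
          then show ?thesis using r unfolding diam by (auto simp: U_def)
        qed
        have "hausdorff_pre_measure (1 + \<epsilon>) r G \<le> (\<Sum>i. diam_pow (1 + \<epsilon>) (U i))"
          unfolding hausdorff_pre_measure_def by (rule INF_lower) (use cov bd in auto)
        also have "\<dots> = (\<Sum>i<N. diam_pow (1 + \<epsilon>) (U i))"
          by (rule suminf_finite) (use \<epsilon> in \<open>auto simp: diam_pow_def diam\<close>)
        also have "\<dots> = (\<Sum>i<N. ennreal ((1 / N) powr (1 + \<epsilon>)))"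
          using \<epsilon> by (intro sum.cong refl) (auto simp: diam_pow_def diam)
        also have "\<dots> = ennreal (real N * (1 / N) powr (1 + \<epsilon>))"
          by (simp add: ennreal_mult ennreal_of_nat_eq_real_of_nat)
        also have "real N * (1 / N) powr (1 + \<epsilon>) = real N powr (- \<epsilon>)"
          using N by (simp add: powr_divide powr_add powr_minus field_simps)
        finally show ?thesis .
      qed
      then have "eventually (\<lambda>N. hausdorff_pre_measure (1 + \<epsilon>) r G \<le> ennreal (real N powr (- \<epsilon>))) sequentially"
        using eventually_ge_at_top[of "max 1 (nat \<lceil>1 / r\<rceil>)"]
        by (auto elim!: eventually_mono)
      moreover have "(\<lambda>N. ennreal (real N powr (- \<epsilon>))) \<longlonglongrightarrow> ennreal 0"
        using \<epsilon> by (intro tendsto_ennrealI tendsto_neg_powr filterlim_real_sequentially) auto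
      ultimately show ?thesis using tendsto_lowerbound[OF _ _ sequentially_bot] by fastforce
    qed
    then show ?thesis unfolding hausdorff_measure_def by (intro antisym SUP_least) auto
  qed
  then have "hausdorff_dim G \<le> ennreal (1 + \<epsilon>)"
    unfolding hausdorff_dim_def by (intro INF_lower) (use \<epsilon> in auto)
  then show "hausdorff_dim G \<le> 1 + ennreal \<epsilon>" using \<epsilon> by (simp add: ennreal_plus)
qed

section \<open>The tree with forced blocks\<close>

lemma cden_take_mono:
  assumes "0 \<notin> set w" "i \<le> j"
  shows "cden (take i w) \<le> cden (take j w)"
proof -
  have eq: "take j w = take i w @ drop i (take j w)"
    using assms(2) by (metis append_take_drop_id min.absorb1 take_take)
  have "0 \<notin> set (take i w)" "0 \<notin> set (drop i (take j w))"
    using assms(1) by (auto dest: in_set_takeD in_set_dropD)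
  then show ?thesis by (subst eq) (rule cden_mono_append)
qed

lemma cden_sq_mono:
  assumes "0 \<notin> set u" "cden u \<le> cden v"
  shows "(rden u)\<^sup>2 \<le> (rden v)\<^sup>2"
  using assms cf_bounds(1)[OF assms(1)] by (intro power_mono) auto

lemma cden_take_step:
  assumes "set w \<subseteq> {1..M}" "0 < i" "i \<le> length w"
  shows "cden (take i w) \<le> (int M + 1) * cden (take (i - 1) w)"
proof -
  obtain j where j: "i = Suc j" using assms(2) by (cases i) auto
  have eq: "take i w = take j w @ [w ! j]" using assms(3) j by (simp add: take_Suc_conv_app_nth)
  have "w ! j \<in> {1..M}" using assms(1,3) j by (meson Suc_le_lessD nth_mem subsetD)
  moreover have "0 \<notin> set (take j w)" using assms(1) by (auto dest: in_set_takeD)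
  ultimately show ?thesis unfolding eq using j by (simp add: cden_snoc_le)
qed

text \<open>The first prefix with denominator above n has denominator at most (M + 1) n, since one
  digit adds at most the factor M + 1. \<open>cfval_approx_lower\<close> applies to that
  prefix.\<close>

lemma nearest_int_dist_cfval_ge:
  assumes w: "set w \<subseteq> {1..M}" and t: "t \<in> {0..1}" and n: "1 \<le> n" "int n < cden w"
  shows "1 / (2 * (real M + 1)) \<le> real n * nearest_int_dist (real n * cfval w t)"
proof -
  have w0: "0 \<notin> set w" using w by auto
  define i where "i = (LEAST i. int n < cden (take i w))"
  have "int n < cden (take (length w) w)" using n by simp
  then have i: "int n < cden (take i w)" "i \<le> length w"
    unfolding i_def by (rule LeastI, rule Least_le)
  have "i \<noteq> 0" using i(1) n(1) by (cases i) auto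
  then have "i - 1 < i" by simp
  then have "\<not> int n < cden (take (i - 1) w)" unfolding i_def by (rule not_less_Least)
  then have "(int M + 1) * cden (take (i - 1) w) \<le> (int M + 1) * int n" by (intro mult_left_mono) auto
  then have "cden (take i w) \<le> (int M + 1) * int n"
    using cden_take_step[OF w _ i(2)] \<open>i \<noteq> 0\<close> by linarith
  then have "rden (take i w) \<le> real_of_int ((int M + 1) * int n)" unfolding of_int_le_iff .
  then have le: "rden (take i w) \<le> (real M + 1) * real n" by simp
  have p: "0 \<notin> set (take i w)" "0 \<notin> set (drop i w)" using w0 by (auto dest: in_set_takeD in_set_dropD)
  define x where "x = cfval (drop i w) t"
  have x: "0 \<le> x" "x \<le> 1" using cfval_bounds[OF p(2)] t by (auto simp: x_def)
  have eq: "cfval w t = cfval (take i w) x" unfolding x_def cfval_append[symmetric] by simp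
  have q: "rden (take i w) \<ge> 1" using cf_bounds(1)[OF p(1)] by simp
  have "1 / (2 * ((real M + 1) * real n)) \<le> 1 / (2 * rden (take i w))"
    using le q by (intro frac_le) auto
  also have "\<dots> \<le> \<bar>real_of_int (int n) * cfval (take i w) x - real_of_int (round (real n * cfval w t))\<bar>"
    using cfval_approx_lower[OF p(1) x, of "int n" "round (real n * cfval w t)"] n i(1) by simp
  also have "\<dots> = nearest_int_dist (real n * cfval w t)" by (simp add: nearest_int_dist_eq_round eq)
  finally have "real n * (1 / (2 * ((real M + 1) * real n))) \<le> real n * nearest_int_dist (real n * cfval w t)"
    by (intro mult_left_mono) auto
  then show ?thesis using n by simp
qed

lemma BadI:
  assumes "c > 0" "\<And>n. 1 \<le> n \<Longrightarrow> c \<le> real n * nearest_int_dist (real n * x)"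
  shows "x \<in> Bad"
proof -
  have "eventually (\<lambda>n. ereal c \<le> ereal (real n * nearest_int_dist (real n * x))) sequentially"
    using eventually_ge_at_top[of 1] by eventually_elim (use assms(2) in auto)
  then have "ereal c \<le> liminf (\<lambda>n. ereal (real n * nearest_int_dist (real n * x)))"
    by (rule Liminf_bounded)
  then show ?thesis using assms(1) unfolding Bad_def by (auto intro: less_le_trans[of 0 "ereal c"])
qed

text \<open>After the first prefix \<open>u\<close> whose squared denominator reaches \<open>\<theta> s\<close>, the next \<open>l s\<close> digits have to
  be \<open>b s u\<close>; all other digits are free.\<close>
locale forced_tree =
  fixes M :: nat and \<theta> :: "nat \<Rightarrow> real" and l :: "nat \<Rightarrow> nat" and b :: "nat \<Rightarrow> nat list \<Rightarrow> nat list"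
    and e :: real
  assumes M: "M \<ge> 1"
    and \<theta>_ge: "\<And>s. real s + 2 \<le> \<theta> s"
    and \<theta>_Suc: "\<And>s. \<theta> s * (real M + 1) ^ (2 * l s + 2) \<le> \<theta> (Suc s)"
    and l_sum: "\<And>s. real (\<Sum>j\<le>s. l j) \<le> e * ln (\<theta> s)"
    and b: "\<And>s u. set u \<subseteq> {1..M} \<Longrightarrow> \<theta> s \<le> (rden u)\<^sup>2 \<Longrightarrow>
      (rden u)\<^sup>2 < \<theta> s * (real M + 1)\<^sup>2 \<Longrightarrow> b s u \<in> words M (l s)"
    and e: "e \<ge> 0" "(real M + 2) powr (2 * (2 * ln (real M + 1) * e)) \<le> (real M + 2) / real M"
begin

text \<open>The crossing of \<theta> s is read off two consecutive prefixes, so extending the word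
  does not change it (\<open>trigger_snoc\<close>); as denominators do not decrease, it happens at
  most once (\<open>trigger_unique\<close>).\<close>

definition trigger :: "nat \<Rightarrow> nat list \<Rightarrow> nat \<Rightarrow> bool" where
  "trigger s w i \<longleftrightarrow> 0 < i \<and> i \<le> length w \<and> \<theta> s \<le> (rden (take i w))\<^sup>2 \<and>
    (rden (take (i - 1) w))\<^sup>2 < \<theta> s"

definition T :: "nat list set" where
  "T = {w. set w \<subseteq> {1..M} \<and> (\<forall>s i j. trigger s w i \<and> i \<le> j \<and> j < length w \<and> j < i + l s \<longrightarrow>
     w ! j = b s (take i w) ! (j - i))}"

lemma \<theta>_pos: "\<theta> s > 0"
  using \<theta>_ge[of s] by linarith

lemma \<theta>_mono: "s \<le> s' \<Longrightarrow> \<theta> s \<le> \<theta> s'"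
proof (rule lift_Suc_mono_le)
  fix s
  have "\<theta> s * 1 \<le> \<theta> s * (real M + 1) ^ (2 * l s + 2)"
    using \<theta>_pos[of s] by (intro mult_left_mono one_le_power) auto
  then show "\<theta> s \<le> \<theta> (Suc s)" using \<theta>_Suc[of s] by simp
qed

lemma trigger_take: "n \<le> length w \<Longrightarrow> trigger s (take n w) i \<longleftrightarrow> trigger s w i \<and> i \<le> n"
  by (auto simp: trigger_def min_def)

lemma trigger_snoc: "i \<le> length w \<Longrightarrow> trigger s (w @ [a]) i \<longleftrightarrow> trigger s w i"
  by (auto simp: trigger_def)

lemma trigger_upper:
  assumes "set w \<subseteq> {1..M}" "trigger s w i"
  shows "(rden (take i w))\<^sup>2 < \<theta> s * (real M + 1)\<^sup>2"
proof -
  have i: "0 < i" "i \<le> length w" "(rden (take (i - 1) w))\<^sup>2 < \<theta> s"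
    using assms(2) by (auto simp: trigger_def)
  have p: "0 \<notin> set (take i w)" using assms(1) by (auto dest: in_set_takeD)
  have "rden (take i w) \<le> real_of_int ((int M + 1) * cden (take (i - 1) w))"
    unfolding of_int_le_iff by (rule cden_take_step[OF assms(1) i(1,2)])
  then have "(rden (take i w))\<^sup>2 \<le> ((real M + 1) * cden (take (i - 1) w))\<^sup>2"
    using cf_bounds(1)[OF p] by (intro power_mono) auto
  also have "\<dots> = (rden (take (i - 1) w))\<^sup>2 * (real M + 1)\<^sup>2" by (simp add: power_mult_distrib)
  also have "\<dots> < \<theta> s * (real M + 1)\<^sup>2" using i(3) by (intro mult_strict_right_mono) auto
  finally show ?thesis .
qed

lemma trigger_unique:
  assumes w: "set w \<subseteq> {1..M}" and i: "trigger s w i" and j: "trigger s w j"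
  shows "i = j"
proof -
  have "\<not> i < j" if i: "trigger s w i" and j: "trigger s w j" for i j
  proof
    assume ij: "i < j"
    have w0: "0 \<notin> set w" and wi: "0 \<notin> set (take i w)" using w by (auto dest: in_set_takeD)
    have "cden (take i w) \<le> cden (take (j - 1) w)" using ij by (intro cden_take_mono w0) auto
    then have "(rden (take i w))\<^sup>2 \<le> (rden (take (j - 1) w))\<^sup>2"
      by (rule cden_sq_mono[OF wi])
    then show False using i j by (auto simp: trigger_def)
  qed
  then show ?thesis using i j by (meson linorder_neqE_nat)
qed

lemma trigger_le:
  assumes w: "set w \<subseteq> {1..M}" and i: "trigger s w i"
  shows "\<theta> s \<le> (rden w)\<^sup>2"
proof -
  have w0: "0 \<notin> set w" and wi: "0 \<notin> set (take i w)" using w by (auto dest: in_set_takeD)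
  have "cden (take i w) \<le> cden (take (length w) w)"
    using i by (intro cden_take_mono w0) (auto simp: trigger_def)
  then show ?thesis using cden_sq_mono[OF wi, of w] i by (auto simp: trigger_def)
qed

text \<open>A block cannot enlarge the denominator enough to reach the next threshold, so blocks do not overlap.\<close>
lemma active_unique:
  assumes w: "set w \<subseteq> {1..M}" and i: "trigger s w i" "length w < i + l s"
    and j: "trigger s' w j" "length w < j + l s'"
  shows "s = s'"
proof -
  have "\<not> s < s'" if i: "trigger s w i" "length w < i + l s" and j: "trigger s' w j" for s s' i j
  proof
    assume "s < s'"
    have wi: "0 \<notin> set (take i w)" and w0: "0 \<notin> set w" using w by (auto dest: in_set_takeD)
    have dw: "set (drop i w) \<subseteq> {1..M}" using w by (meson set_drop_subset subset_trans)
    have "cden (take i w @ drop i w) \<le> (int M + 1) ^ length (drop i w) * cden (take i w)"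
      by (rule cden_append_le_pow[OF wi dw])
    then have "rden w \<le> real_of_int ((int M + 1) ^ (length w - i) * cden (take i w))"
      unfolding of_int_le_iff by simp
    then have "(rden w)\<^sup>2 \<le> ((real M + 1) ^ (length w - i) * cden (take i w))\<^sup>2"
      using cf_bounds(1)[OF w0] by (intro power_mono) auto
    also have "\<dots> = (real M + 1) ^ (2 * (length w - i)) * (rden (take i w))\<^sup>2"
      by (simp add: power_mult_distrib mult.commute flip: power_mult)
    also have "\<dots> < (real M + 1) ^ (2 * (length w - i)) * (\<theta> s * (real M + 1)\<^sup>2)"
      using trigger_upper[OF w i(1)] by (intro mult_strict_left_mono) auto
    also have "\<dots> \<le> (real M + 1) ^ (2 * l s) * (\<theta> s * (real M + 1)\<^sup>2)"
      using i(2) \<theta>_pos[of s] by (intro mult_right_mono power_increasing) auto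
    also have "\<dots> = \<theta> s * (real M + 1) ^ (2 * l s + 2)" by (simp add: power_add power2_eq_square)
    also have "\<dots> \<le> \<theta> (Suc s)" by (rule \<theta>_Suc)
    also have "\<dots> \<le> \<theta> s'" using \<open>s < s'\<close> by (intro \<theta>_mono) auto
    also have "\<dots> \<le> (rden w)\<^sup>2" by (rule trigger_le[OF w j])
    finally show False by simp
  qed
  then show ?thesis using i j by (meson linorder_neqE_nat)
qed

lemma TD: "w \<in> T \<Longrightarrow> set w \<subseteq> {1..M}"
  by (simp add: T_def)

lemma T_nth:
  "w \<in> T \<Longrightarrow> trigger s w i \<Longrightarrow> i \<le> j \<Longrightarrow> j < length w \<Longrightarrow> j < i + l s \<Longrightarrow>
    w ! j = b s (take i w) ! (j - i)"
  unfolding T_def by blast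

lemma T_prefix:
  assumes "w @ [a] \<in> T"
  shows "w \<in> T"
proof -
  have "w ! j = b s (take i w) ! (j - i)"
    if "trigger s w i" "i \<le> j" "j < length w" "j < i + l s" for s i j
  proof -
    have i: "i \<le> length w" using that by (simp add: trigger_def)
    then have "trigger s (w @ [a]) i" using that(1) by (simp add: trigger_snoc)
    then have "(w @ [a]) ! j = b s (take i (w @ [a])) ! (j - i)" using that assms by (simp add: T_def)
    then show ?thesis using that i by (simp add: nth_append)
  qed
  then show ?thesis using assms by (simp add: T_def)
qed

lemma T_snoc:
  assumes w: "w \<in> T" and a: "a \<in> {1..M}"
    and act: "\<And>s i. trigger s w i \<Longrightarrow> length w < i + l s \<Longrightarrow> a = b s (take i w) ! (length w - i)"
  shows "w @ [a] \<in> T"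
proof -
  have "(w @ [a]) ! j = b s (take i (w @ [a])) ! (j - i)"
    if h: "trigger s (w @ [a]) i" "i \<le> j" "j < length (w @ [a])" "j < i + l s" for s i j
  proof -
    have i: "i \<le> length w" using h by simp
    then have tr: "trigger s w i" using h(1) by (simp add: trigger_snoc)
    show ?thesis
    proof (cases "j < length w")
      case True
      then have "w ! j = b s (take i w) ! (j - i)" using w tr h by (simp add: T_def)
      then show ?thesis using True i by (simp add: nth_append)
    next
      case False
      then have "j = length w" using h by simp
      then show ?thesis using act[OF tr] h i by simp
    qed
  qed
  moreover have "set (w @ [a]) \<subseteq> {1..M}" using TD[OF w] a by simp
  ultimately show ?thesis unfolding T_def by blast
qed

text \<open>At most one block is active at any node, so the demands on the next digit never
  conflict: it is either the digit of that block or free.\<close>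

lemma T_child:
  assumes w: "w \<in> T"
  shows "\<exists>a. w @ [a] \<in> T"
proof (cases "\<exists>s i. trigger s w i \<and> length w < i + l s")
  case True
  then obtain s i where si: "trigger s w i" "length w < i + l s" by blast
  have i: "i \<le> length w" "\<theta> s \<le> (rden (take i w))\<^sup>2" using si by (auto simp: trigger_def)
  have ti: "set (take i w) \<subseteq> {1..M}" using TD[OF w] by (meson set_take_subset subset_trans)
  have bw: "b s (take i w) \<in> words M (l s)"
    by (rule b[OF ti i(2) trigger_upper[OF TD[OF w] si(1)]])
  define a where "a = b s (take i w) ! (length w - i)"
  have bM: "set (b s (take i w)) \<subseteq> {1..M}" and "length (b s (take i w)) = l s"
    using bw unfolding words_def by simp_all
  then have "a \<in> set (b s (take i w))" unfolding a_def using si(2) i by (intro nth_mem) auto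
  then have "a \<in> {1..M}" by (rule subsetD[OF bM])
  moreover have "a = b s' (take i' w) ! (length w - i')" if h: "trigger s' w i'" "length w < i' + l s'" for s' i'
  proof -
    have "s = s'" by (rule active_unique[OF TD[OF w] si h])
    moreover have "i = i'"
      using h(1) unfolding \<open>s = s'\<close>[symmetric] by (rule trigger_unique[OF TD[OF w] si(1)])
    ultimately show ?thesis by (simp add: a_def)
  qed
  ultimately show ?thesis using T_snoc[OF w] by blast
next
  case False
  then show ?thesis using T_snoc[OF w, of 1] M by auto
qed

text \<open>Restricted nodes lie inside blocks whose threshold w has reached. Counting each of these
  in full up to the last one, m, gives at most e ln (\<theta> m), and \<theta> m is at most the
  squared denominator of w, hence at most (M + 1) ^ (2 * length w).\<close>

lemma T_sparse:
  assumes w: "w \<in> T"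
  shows "real (card {n. n < length w \<and> (\<exists>a\<in>{1..M}. take n w @ [a] \<notin> T)})
    \<le> (2 * ln (real M + 1) * e) * real (length w)"
proof -
  define N where "N = {n. n < length w \<and> (\<exists>a\<in>{1..M}. take n w @ [a] \<notin> T)}"
  define S where "S = {s. \<exists>i. trigger s w i}"
  define pos where "pos s = (SOME i. trigger s w i)" for s
  note wM = TD[OF w]
  have w0: "0 \<notin> set w" using wM by auto
  have takeT: "take n w \<in> T" for n
    using w
  proof (induction w rule: rev_induct)
    case (snoc a w)
    then show ?case using T_prefix[of w a] by (cases "n \<le> length w") auto
  qed simp
  have pos: "trigger s w (pos s)" if "s \<in> S" for s using that unfolding S_def pos_def by (auto intro: someI_ex)
  have S_le: "\<theta> s \<le> (rden w)\<^sup>2" if "s \<in> S" for s using trigger_le[OF wM pos[OF that]] .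
  have "S \<subseteq> {..nat \<lceil>(rden w)\<^sup>2\<rceil>}"
  proof
    fix s assume "s \<in> S"
    then have "real s \<le> (rden w)\<^sup>2" using S_le[of s] \<theta>_ge[of s] by linarith
    then show "s \<in> {..nat \<lceil>(rden w)\<^sup>2\<rceil>}" by simp linarith
  qed
  then have finS: "finite S" using finite_subset by blast
  have sub: "N \<subseteq> (\<Union>s\<in>S. {pos s..<pos s + l s})"
  proof
    fix n assume n: "n \<in> N"
    then obtain a where a: "a \<in> {1..M}" "take n w @ [a] \<notin> T" and nl: "n < length w" by (auto simp: N_def)
    have "\<exists>s i. trigger s (take n w) i \<and> length (take n w) < i + l s"
      using T_snoc[OF takeT[of n] a(1)] a(2) by blast
    then obtain s i where si: "trigger s w i" "i \<le> n" "n < i + l s" using nl by (auto simp: trigger_take)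
    then have "s \<in> S" by (auto simp: S_def)
    moreover have "i = pos s" by (rule trigger_unique[OF wM si(1) pos[OF \<open>s \<in> S\<close>]])
    ultimately show "n \<in> (\<Union>s\<in>S. {pos s..<pos s + l s})" using si by auto
  qed
  have cN: "card N \<le> (\<Sum>s\<in>S. l s)"
  proof -
    have "card N \<le> card (\<Union>s\<in>S. {pos s..<pos s + l s})" using sub finS by (intro card_mono) auto
    also have "\<dots> \<le> (\<Sum>s\<in>S. card {pos s..<pos s + l s})" by (rule card_UN_le[OF finS])
    finally show ?thesis by simp
  qed
  have lnM: "ln (real M + 1) \<ge> 0" by simp
  have "real (\<Sum>s\<in>S. l s) \<le> (2 * ln (real M + 1) * e) * real (length w)"
  proof (cases "S = {}")
    case False
    define m where "m = Max S"
    have m: "m \<in> S" "\<And>s. s \<in> S \<Longrightarrow> s \<le> m" using finS False by (auto simp: m_def)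
    have "(\<Sum>s\<in>S. l s) \<le> (\<Sum>s\<le>m. l s)" using m by (intro sum_mono2) auto
    then have "real (\<Sum>s\<in>S. l s) \<le> real (\<Sum>s\<le>m. l s)" by (rule of_nat_mono)
    also have "\<dots> \<le> e * ln (\<theta> m)" by (rule l_sum)
    also have "\<dots> \<le> e * (2 * (real (length w) * ln (real M + 1)))"
    proof (intro mult_left_mono e)
      have "rden w \<le> real_of_int ((int M + 1) ^ length w)"
        unfolding of_int_le_iff by (rule cden_le_pow[OF wM])
      then have "(rden w)\<^sup>2 \<le> ((real M + 1) ^ length w)\<^sup>2"
        using cf_bounds(1)[OF w0] by (intro power_mono) auto
      then have "\<theta> m \<le> ((real M + 1) ^ length w)\<^sup>2" using S_le[OF m(1)] by linarith
      then have "ln (\<theta> m) \<le> ln (((real M + 1) ^ length w)\<^sup>2)" using \<theta>_pos[of m] by (subst ln_le_cancel_iff) auto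
      also have "\<dots> = 2 * (real (length w) * ln (real M + 1))" by (simp add: ln_realpow)
      finally show "ln (\<theta> m) \<le> 2 * (real (length w) * ln (real M + 1))" .
    qed
    finally show ?thesis by (simp add: mult_ac)
  qed (use e lnM in simp)
  then show ?thesis using cN unfolding N_def[symmetric] by linarith
qed

sublocale word_tree M T "2 * ln (real M + 1) * e"
proof
  show "[] \<in> T" by (simp add: T_def trigger_def)
qed (use M TD T_prefix T_child T_sparse e in auto)

lemma limit_set_unit: "limit_set \<subseteq> {0..1}"
proof
  fix x assume "x \<in> limit_set"
  then have "x \<in> (\<Union>w\<in>level 0. cfval w ` {0..1})" unfolding limit_set_def by blast
  then show "x \<in> {0..1}" by (auto simp: level_def split: if_splits)
qed

lemma limit_set_Bad: "limit_set \<subseteq> Bad"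
proof
  fix x assume x: "x \<in> limit_set"
  show "x \<in> Bad"
  proof (rule BadI)
    show "0 < 1 / (2 * (real M + 1))" by simp
    fix n :: nat assume n: "1 \<le> n"
    have "x \<in> (\<Union>w\<in>level (2 * n). cfval w ` {0..1})" using x unfolding limit_set_def by blast
    then obtain w t where w: "w \<in> T" "length w = 2 * n" and t: "t \<in> {0..1}" "x = cfval w t"
      by (auto simp: level_def)
    have "int n < 2 ^ n" using less_exp[of n] by (metis of_nat_less_iff of_nat_numeral of_nat_power)
    also have "\<dots> \<le> cden w" using cden_ge_pow2[OF pos[OF w(1)]] w(2) by simp
    finally show "1 / (2 * (real M + 1)) \<le> real n * nearest_int_dist (real n * x)"
      unfolding t(2) by (intro nearest_int_dist_cfval_ge[OF TD[OF w(1)] t(1) n])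
  qed
qed

lemma limit_set_forced:
  assumes x: "x \<in> limit_set"
  obtains u t where "set u \<subseteq> {1..M}" "\<theta> r \<le> (rden u)\<^sup>2"
    "(rden u)\<^sup>2 < \<theta> r * (real M + 1)\<^sup>2" "t \<in> {0..1}" "x = cfval (u @ b r u) t"
proof -
  obtain k where k: "\<theta> r < 2 ^ k" using real_arch_pow[of 2 "\<theta> r"] by auto
  \<comment> \<open>The threshold is crossed within \<open>Suc k\<close> digits because the squared
    denominator is then at least 2 ^ k; the further \<open>l r\<close> digits contain the whole
    block.\<close>
  have "x \<in> (\<Union>w\<in>level (Suc k + l r). cfval w ` {0..1})" using x unfolding limit_set_def by blast
  then obtain w t where w: "w \<in> T" "length w = Suc k + l r" and t: "t \<in> {0..1}" "x = cfval w t"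
    by (auto simp: level_def)
  note wM = TD[OF w(1)]
  have p: "0 \<notin> set (take i w)" for i using wM by (auto dest: in_set_takeD)
  define i where "i = (LEAST i. \<theta> r \<le> (rden (take i w))\<^sup>2)"
  have "\<theta> r \<le> (rden (take (Suc k) w))\<^sup>2"
    using cden_sq_ge_pow2[OF p[of "Suc k"]] k w(2) by simp
  then have i: "\<theta> r \<le> (rden (take i w))\<^sup>2" "i \<le> Suc k"
    unfolding i_def by (rule LeastI, rule Least_le)
  have "i \<noteq> 0" using i(1) \<theta>_ge[of r] by (cases i) auto
  then have "i - 1 < i" by simp
  then have "\<not> \<theta> r \<le> (rden (take (i - 1) w))\<^sup>2" unfolding i_def by (rule not_less_Least)
  then have tr: "trigger r w i" using i w(2) \<open>i \<noteq> 0\<close> by (simp add: trigger_def)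
  define u where "u = take i w"
  have u: "set u \<subseteq> {1..M}" using wM unfolding u_def by (meson set_take_subset subset_trans)
  have up: "(rden u)\<^sup>2 < \<theta> r * (real M + 1)\<^sup>2" unfolding u_def by (rule trigger_upper[OF wM tr])
  have bl: "length (b r u) = l r" using b[OF u _ up] i(1) by (simp add: u_def words_def)
  have tk: "take (l r) (drop i w) = b r u"
  proof (rule nth_equalityI)
    show "length (take (l r) (drop i w)) = length (b r u)" using i(2) w(2) bl by simp
    fix j assume j: "j < length (take (l r) (drop i w))"
    then have "w ! (i + j) = b r (take i w) ! (i + j - i)"
      using i(2) w(2) by (intro T_nth[OF w(1) tr]) auto
    then show "take (l r) (drop i w) ! j = b r u ! j" using j i(2) w(2) by (simp add: u_def)
  qed
  have weq: "w = (u @ b r u) @ drop (i + l r) w"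
    unfolding tk[symmetric] by (simp only: u_def take_add[symmetric] append_take_drop_id)
  define t' where "t' = cfval (drop (i + l r) w) t"
  have "0 \<notin> set (drop (i + l r) w)" using wM by (auto dest: in_set_dropD)
  then have "t' \<in> {0..1}" using cfval_bounds t(1) by (auto simp: t'_def)
  moreover have "x = cfval (u @ b r u) t'" unfolding t(2) t'_def cfval_append[symmetric] by (subst weq) simp
  ultimately show ?thesis using that[of u t'] u up i(1) by (simp add: u_def)
qed

end

text \<open>Windows from \<open>forcing_window\<close> are placed one after another, each so far out
  that the sparsity condition holds for all blocks so far. The limit set of the resulting tree is
  G.\<close>

lemma good_set_bounded_digits:
  fixes \<epsilon> :: real and \<alpha> \<gamma> :: "nat \<Rightarrow> real"
  assumes \<epsilon>: "\<epsilon> > 0" and \<alpha>: "\<And>i. i \<ge> 1 \<Longrightarrow> \<alpha> i \<in> K_set" and M: "M \<ge> 1200"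
  shows "\<exists>G. G \<subseteq> Bad \<and> G \<subseteq> {0..1} \<and>
    (\<forall>H. G \<subseteq> H \<longrightarrow> ennreal (1 - ln (((real M + 2) / real M)\<^sup>2) / ln 2) \<le> hausdorff_dim H) \<and>
    (\<forall>\<beta>\<in>G. \<forall>i\<ge>1. \<forall>\<delta>. infinite {n. good_approx \<epsilon> (\<alpha> i) (\<gamma> i) \<beta> \<delta> n})"
proof -
  \<comment> \<open>Solves 4 e ln (M + 1) ln (M + 2) = ln ((M + 2) / M), the equality case of the
    sparsity condition of the tree.\<close>
  define e where "e = ln ((real M + 2) / real M) / (4 * ln (real M + 1) * ln (real M + 2))"
  have lnM: "ln (real M + 1) > 0" "ln (real M + 2) > 0" using M by auto
  have "(real M + 2) / real M > 1" using M by simp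
  then have e0: "e > 0" unfolding e_def using lnM by (intro divide_pos_pos mult_pos_pos ln_gt_zero) auto
  have e2: "(real M + 2) powr (2 * (2 * ln (real M + 1) * e)) \<le> (real M + 2) / real M"
  proof -
    have "2 * (2 * ln (real M + 1) * e) * ln (real M + 2) = ln ((real M + 2) / real M)"
      using lnM by (simp add: e_def)
    then show ?thesis using M by (simp add: powr_def)
  qed
  \<comment> \<open>Every index i >= 1 is treated at infinitely many stages s, one for each second
    component of the decoded pair.\<close>
  define idx where "idx s = Suc (fst (prod_decode s))" for s
  define P where "P s Z \<theta> l \<longleftrightarrow> Z \<le> \<theta> \<and> real l \<le> e / 2 * ln \<theta> \<and>
    (\<forall>u. set u \<subseteq> {1..M} \<and> \<theta> \<le> (rden u)\<^sup>2 \<and>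
       (rden u)\<^sup>2 < \<theta> * (real M + 1)\<^sup>2 \<longrightarrow>
      (\<exists>b\<in>words M l. \<forall>t\<in>{0..1}. \<forall>\<delta>. \<exists>n::nat. Z \<le> real n \<and>
         good_approx \<epsilon> (\<alpha> (idx s)) (\<gamma> (idx s)) (cfval (u @ b) t) \<delta> n))" for s Z \<theta> l
  have "\<exists>\<theta> l. P s Z \<theta> l" for s Z
  proof -
    have "\<alpha> (idx s) \<in> K_set" by (rule \<alpha>) (simp add: idx_def)
    then show ?thesis
      using forcing_window[OF M \<epsilon>, of "\<alpha> (idx s)" "e / 2" Z "\<gamma> (idx s)"] e0
      unfolding P_def by simp
  qed
  then obtain \<Theta> \<Lambda> where P: "\<And>s Z. P s Z (\<Theta> s Z) (\<Lambda> s Z)" by metis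
  \<comment> \<open>The state is a lower bound Z for the next threshold and the number F of digits
    in earlier blocks. The three terms of the maximum keep the thresholds unbounded, leave room for
    the preceding block, and make F at most (e / 2) ln \<theta>; the new block uses the other half
    of e.\<close>
  define st where "st = rec_nat (2::real, 0::nat) (\<lambda>s (Z, F).
    (max (real s + 3) (max (\<Theta> s Z * (real M + 1) ^ (2 * \<Lambda> s Z + 2)) (exp (2 * real (F + \<Lambda> s Z) / e))), F + \<Lambda> s Z))"
  define Z F where "Z s = fst (st s)" and "F s = snd (st s)" for s
  define \<theta> l where "\<theta> s = \<Theta> s (Z s)" and "l s = \<Lambda> s (Z s)" for s
  have F_Suc: "F (Suc s) = F s + l s" for s
    by (simp add: F_def l_def Z_def st_def case_prod_unfold)
  have Z_Suc: "Z (Suc s) = max (real s + 3) (max (\<theta> s * (real M + 1) ^ (2 * l s + 2)) (exp (2 * real (F (Suc s)) / e)))" for s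
    unfolding F_Suc by (simp add: Z_def F_def \<theta>_def l_def st_def case_prod_unfold)
  have Z0: "Z 0 = 2" "F 0 = 0" by (simp_all add: Z_def F_def st_def)
  have Pt: "P s (Z s) (\<theta> s) (l s)" for s unfolding \<theta>_def l_def by (rule P)
  have F_sum: "F s = (\<Sum>j<s. l j)" for s by (induction s) (simp_all add: Z0 F_Suc)
  have Z_ge: "real s + 2 \<le> Z s" for s by (cases s) (simp_all add: Z0 Z_Suc)
  have Z_exp: "2 * real (F s) / e \<le> ln (Z s)" for s
  proof (cases s)
    case (Suc k)
    have "exp (2 * real (F s) / e) \<le> Z s" unfolding Suc Z_Suc by simp
    then show ?thesis by (subst ln_ge_iff) (use Z_ge[of s] in auto)
  qed (simp add: Z0)
  have Z\<theta>: "Z s \<le> \<theta> s" for s using Pt[of s] by (simp add: P_def)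
  have \<theta>_Suc: "\<theta> s * (real M + 1) ^ (2 * l s + 2) \<le> \<theta> (Suc s)" for s
    using Z\<theta>[of "Suc s"] unfolding Z_Suc by simp
  have l_sum: "real (\<Sum>j\<le>s. l j) \<le> e * ln (\<theta> s)" for s
  proof -
    have "real (F s) \<le> e / 2 * ln (Z s)" using Z_exp[of s] e0 by (simp add: field_simps)
    also have "\<dots> \<le> e / 2 * ln (\<theta> s)"
      using Z\<theta>[of s] Z_ge[of s] e0 by (intro mult_left_mono) auto
    finally have "real (F s) \<le> e / 2 * ln (\<theta> s)" .
    moreover have "real (l s) \<le> e / 2 * ln (\<theta> s)" using Pt[of s] by (simp add: P_def)
    moreover have "(\<Sum>j\<le>s. l j) = F s + l s" by (simp add: F_sum lessThan_Suc_atMost[symmetric])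
    ultimately show ?thesis by simp
  qed
  define trg where "trg s u \<longleftrightarrow> set u \<subseteq> {1..M} \<and> \<theta> s \<le> (rden u)\<^sup>2 \<and>
       (rden u)\<^sup>2 < \<theta> s * (real M + 1)\<^sup>2" for s u
  have "\<exists>b. trg s u \<longrightarrow> b \<in> words M (l s) \<and> (\<forall>t\<in>{0..1}. \<forall>\<delta>. \<exists>n::nat. Z s \<le> real n \<and>
         good_approx \<epsilon> (\<alpha> (idx s)) (\<gamma> (idx s)) (cfval (u @ b) t) \<delta> n)" for s u
    using Pt[of s] unfolding P_def trg_def by blast
  then obtain b where b: "\<And>s u. trg s u \<Longrightarrow> b s u \<in> words M (l s)"
    "\<And>s u t \<delta>. trg s u \<Longrightarrow> t \<in> {0..1} \<Longrightarrow> \<exists>n::nat. Z s \<le> real n \<and>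
         good_approx \<epsilon> (\<alpha> (idx s)) (\<gamma> (idx s)) (cfval (u @ b s u) t) \<delta> n"
    by metis
  interpret ft: forced_tree M \<theta> l b e
  proof
    show "real s + 2 \<le> \<theta> s" for s using Z_ge[of s] Z\<theta>[of s] by linarith
    show "b s u \<in> words M (l s)" if "set u \<subseteq> {1..M}" "\<theta> s \<le> (rden u)\<^sup>2"
      "(rden u)\<^sup>2 < \<theta> s * (real M + 1)\<^sup>2" for s u
      by (rule b(1)) (use that in \<open>simp add: trg_def\<close>)
  qed (use M \<theta>_Suc l_sum e0 e2 in auto)
  have s_pos: "ft.dim_exp > 0"
  proof -
    have "((real M + 2) / real M)\<^sup>2 \<le> (1202 / 1200)\<^sup>2"
      using M by (intro power_mono) (auto simp: field_simps)
    also have "\<dots> < (2::real)" by (simp add: power2_eq_square)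
    finally have "ft.\<rho> < 2" by (simp add: ft.\<rho>_def)
    then have "ln ft.\<rho> < ln 2" using ft.\<rho>1 by (subst ln_less_cancel_iff) auto
    then show ?thesis by (simp add: ft.dim_exp_def)
  qed
  have dim: "ennreal (1 - ln (((real M + 2) / real M)\<^sup>2) / ln 2) \<le> hausdorff_dim H" if "ft.limit_set \<subseteq> H" for H
    using ft.limit_set_hausdorff_dim[OF that s_pos] by (simp add: ft.dim_exp_def ft.\<rho>_def)
  have inf: "infinite {n. good_approx \<epsilon> (\<alpha> i) (\<gamma> i) \<beta> \<delta> n}" if \<beta>: "\<beta> \<in> ft.limit_set" and i: "i \<ge> 1" for \<beta> i \<delta>
  proof -
    have "\<exists>n\<ge>m. good_approx \<epsilon> (\<alpha> i) (\<gamma> i) \<beta> \<delta> n" for m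
    proof -
      define s where "s = prod_encode (i - 1, m)"
      have idx: "idx s = i" using i by (simp add: idx_def s_def)
      have ms: "m \<le> s" unfolding s_def by (rule le_prod_encode_2)
      obtain u t where u: "set u \<subseteq> {1..M}" "\<theta> s \<le> (rden u)\<^sup>2"
        "(rden u)\<^sup>2 < \<theta> s * (real M + 1)\<^sup>2" "t \<in> {0..1}" "\<beta> = cfval (u @ b s u) t"
        using ft.limit_set_forced[OF \<beta>] by blast
      then have "trg s u" by (simp add: trg_def)
      from b(2)[OF this u(4), of \<delta>] obtain n :: nat where n: "Z s \<le> real n" "good_approx \<epsilon> (\<alpha> i) (\<gamma> i) \<beta> \<delta> n"
        unfolding idx u(5) by blast
      have "real m \<le> real n" using n(1) Z_ge[of s] ms by simp
      then show ?thesis using n(2) by auto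
    qed
    then show ?thesis unfolding infinite_nat_iff_unbounded_le by auto
  qed
  show ?thesis
    by (intro exI[of _ ft.limit_set] conjI allI impI ballI ft.limit_set_Bad ft.limit_set_unit dim inf)
qed

theorem theorem1p4:
  fixes \<epsilon> :: real and \<alpha> \<gamma> :: "nat \<Rightarrow> real"
  assumes "\<epsilon> > 0"
    and "\<And>i. i \<ge> 1 \<Longrightarrow> \<alpha> i \<in> K_set"
  shows "\<exists>G. G \<subseteq> Bad \<and> hausdorff_dim G = 1 \<and>
    (\<forall>\<beta>\<in>G. \<forall>i\<ge>1. \<forall>\<delta>::real.
      infinite {n::nat. n \<ge> 1 \<and>
        real n * nearest_int_dist (real n * \<alpha> i - \<gamma> i) * nearest_int_dist (real n * \<beta> - \<delta>)
          < ln (ln (ln (real n))) powr (\<epsilon> + 1/2) / ln (real n) powr (1/2)})"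
proof -
  define good where "good M G \<longleftrightarrow> G \<subseteq> Bad \<and> G \<subseteq> {0..1} \<and>
    (\<forall>H. G \<subseteq> H \<longrightarrow> ennreal (1 - ln (((real M + 2) / real M)\<^sup>2) / ln 2) \<le> hausdorff_dim H) \<and>
    (\<forall>\<beta>\<in>G. \<forall>i\<ge>1. \<forall>\<delta>. infinite {n. good_approx \<epsilon> (\<alpha> i) (\<gamma> i) \<beta> \<delta> n})" for M :: nat and G
  have "\<exists>G. good M G" if "M \<ge> 1200" for M
    unfolding good_def by (rule good_set_bounded_digits[OF assms that])
  then have "good M (SOME G. good M G)" if "M \<ge> 1200" for M
    using that by (blast intro: someI_ex)
  then obtain G where good: "\<And>M. M \<ge> 1200 \<Longrightarrow> good M (G M)"
    by (rule that[of "\<lambda>M. SOME G. good M G"])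
  have G: "G M \<subseteq> Bad" "G M \<subseteq> {0..1}"
    "\<And>H. G M \<subseteq> H \<Longrightarrow> ennreal (1 - ln (((real M + 2) / real M)\<^sup>2) / ln 2) \<le> hausdorff_dim H"
    "\<And>\<beta> i \<delta>. \<beta> \<in> G M \<Longrightarrow> i \<ge> 1 \<Longrightarrow> infinite {n. good_approx \<epsilon> (\<alpha> i) (\<gamma> i) \<beta> \<delta> n}"
    if "M \<ge> 1200" for M
    using good[OF that] by (simp_all add: good_def)
  define U where "U = (\<Union>M\<in>{1200..}. G M)"
  have "U \<subseteq> {0..1}" using G(2) by (auto simp: U_def)
  then have "hausdorff_dim U \<le> 1" by (rule hausdorff_dim_unit_interval_le)
  \<comment> \<open>U contains each G M, so the lower bounds for all M hold for the same set U and
    pass to the limit.\<close>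
  moreover have "1 \<le> hausdorff_dim U"
  proof (rule tendsto_upperbound)
    show "eventually (\<lambda>M. ennreal (1 - ln (((real M + 2) / real M)\<^sup>2) / ln 2) \<le> hausdorff_dim U) sequentially"
      using eventually_ge_at_top[of 1200]
    proof eventually_elim
      case (elim M)
      then show ?case by (intro G(3)) (auto simp: U_def)
    qed
    have "(\<lambda>M::nat. 1 - ln (((real M + 2) / real M)\<^sup>2) / ln 2) \<longlonglongrightarrow> 1" by real_asymp
    then show "(\<lambda>M::nat. ennreal (1 - ln (((real M + 2) / real M)\<^sup>2) / ln 2)) \<longlonglongrightarrow> 1"
      using tendsto_ennrealI by fastforce
  qed simp
  ultimately have "hausdorff_dim U = 1" by (rule antisym)
  moreover have "U \<subseteq> Bad" using G(1) by (auto simp: U_def)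
  moreover have "\<forall>\<beta>\<in>U. \<forall>i\<ge>1. \<forall>\<delta>. infinite {n. good_approx \<epsilon> (\<alpha> i) (\<gamma> i) \<beta> \<delta> n}"
    using G(4) by (auto simp: U_def)
  ultimately show ?thesis unfolding good_approx_def by blast
qed

end
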